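(* Let $\kappa,\rho\in\mathcal{P}_b^r$. The set ${}_\kappa B_\rho=\{b_{w,\underline l,\underline a}\mid w\in{}_\kappa S_\rho,\ \underline l\in\{0,1\}^b,\ \underline a\in\mathbb{N}^b\}$ is a basis of $1_\kappa T_b^{\lambda,\underline N}1_\rho$ as a $\mathbb{Z}\times\mathbb{Z}^2$-graded $\Bbbk$-module.
   Context: $\Bbbk$ is a commutative unital ring, $\underline N=(N_1,\dots,N_r)\in\mathbb N^r$. The dg-enhanced KLRW algebra $T_b^{\lambda,\underline N}$ is the $\Bbbk$-algebra spanned by braid-like diagrams read bottom to top (product $D\cdot D'$ = $D$ stacked on top of $D'$, zero if colours/labels do not match): a leftmost vertical blue strand labelled $\lambda$; $r$ red strands labelled $N_1,\dots,N_r$ left to right, never crossing each other or the blue strand; $b$ black strands, which may cross black and red strands, carry dots, and, when they are the first strand right of the blue strand, be nailed (touch the blue strand at a point and go back). Dots, crossings: homological degree $0$; nails: homological degree $1$. Diagrams are up to graded braid-like planar isotopy (no critical points created; exchanging heights of far-apart generators of homological degrees $a,c$ gives $(-1)^{ac}$). With $x_j$ a dot on the $j$-th strand right of blue, $\tau_j$ a crossing of strands $j,j+1$, $\omega$ a nail on the first strand, top factor written on the left, the relations are: (i) on black strands $\tau_j^2=0$, $\tau_j\tau_{j+1}\tau_j=\tau_{j+1}\tau_j\tau_{j+1}$, $\tau_jx_j-x_{j+1}\tau_j=1=x_j\tau_j-\tau_jx_{j+1}$; (ii) dots slide through black/red crossings; (iii) a black strand crossing a red strand labelled $N_i$ twice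 equals $N_i$ dots on the black strand; (iv) the braid relation holds for two black and one red strand unless the red strand is the middle one, in which case $\tau_j\tau_{j+1}\tau_j=\tau_{j+1}\tau_j\tau_{j+1}+\sum_{k+\ell=N_i-1}x_j^kx_{j+2}^\ell$; (v) $\omega x_1=x_1\omega$, $\omega^2=0$, $\tau_1\omega\tau_1\omega=-\omega\tau_1\omega\tau_1$. Gradings: a black/black crossing has $(q,\lambda)$-degree $(-2,0)$, a dot $(2,0)$, a black/red crossing with red label $N_i$ degree $(N_i,0)$, a nail $(0,2)$. $\mathcal{P}_b^r$ is the set of $(b_0,\dots,b_r)\in\mathbb N^{r+1}$ with $\sum b_i=b$; $1_\rho$ for $\rho\in\mathcal P_b^r$ is the idempotent with all strands vertical, $b_0$ black strands between blue and the first red strand and $b_i$ black strands right of the $i$-th red strand. ${}_\kappa S_\rho$ is the set of permutations viewed as diagrams with the blue strand on the left, strands ordered at the bottom according to $1_\rho$ and at the top according to $1_\kappa$, with no red/red crossings in any reduced expression. A reduced expression $\sigma_{i_1}\cdots\sigma_{i_k}$ is left-adjusted if $i_1+\cdots+i_k$ is minimal (diagrammatically: every strand pulled as far left as possible). For $w\in{}_\kappa S_\rho$, $\underline l\in\{0,1\}^b$, $\underline a\in\mathbb N^b$, the element $b_{w,\underline l,\underline a}\in1_\kappa T_b^{\lambda,\underline N}1_\rho$ is obtained by: choosing a left-adjusted reduced expression of $w$ as a diagram; for each $i$ with $l_i=1$, nailing the $i$-th black strand (counting at the top from the left) on the blue strand by pulling it from its leftmost position; then adding $a_i$ dots on the $i$-th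 black strand at the top. *)

theory Defs
  imports Main
begin

text \<open>Strands to the right of the blue strand, left to right (positions 0,1,...).
  Rd i is the i-th red strand (0-indexed), labelled N ! i.\<close>
datatype color = Blk | Rd nat

text \<open>Generators: Dot j = x_{j+1}, Cross j = tau_{j+1}, Nail = omega
  (positions are 0-indexed, position 0 is the first strand right of blue).\<close>
datatype gen = Dot nat | Cross nat | Nail

definition is_red :: "color \<Rightarrow> bool" where
  "is_red c \<longleftrightarrow> (\<exists>i. c = Rd i)"

definition swp :: "nat \<Rightarrow> 'a list \<Rightarrow> 'a list" where
  "swp j s = s[j := s ! Suc j, Suc j := s ! j]"

fun step :: "color list \<Rightarrow> gen \<Rightarrow> color list option" where
  "step s (Dot j) = (if j < length s \<and> s ! j = Blk then Some s else None)"
| "step s (Cross j) = (if Suc j < length s \<and> \<not> (is_red (s ! j) \<and> is_red (s ! Suc j))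
                       then Some (swp j s) else None)"
| "step s Nail = (if 0 < length s \<and> s ! 0 = Blk then Some s else None)"

text \<open>Words are written as products, top factor first (leftmost = top).
  run s w = Some t: the diagram w is defined with bottom sequence s and top sequence t.\<close>
fun run :: "color list \<Rightarrow> gen list \<Rightarrow> color list option" where
  "run s [] = Some s"
| "run s (g # w) = (case run s w of None \<Rightarrow> None | Some t \<Rightarrow> step t g)"

definition Pbr :: "nat \<Rightarrow> nat \<Rightarrow> nat list set" where
  "Pbr b r = {\<rho>. length \<rho> = Suc r \<and> sum_list \<rho> = b}"

definition state :: "nat list \<Rightarrow> color list" where
  "state \<rho> = replicate (hd \<rho>) Blk @
      concat (map (\<lambda>i. Rd i # replicate (\<rho> ! Suc i) Blk) [0..<length \<rho> - 1])"

definition blk :: "color list \<Rightarrow> nat \<Rightarrow> bool" where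
  "blk s j \<longleftrightarrow> j < length s \<and> s ! j = Blk"

definition rd :: "color list \<Rightarrow> nat \<Rightarrow> nat \<Rightarrow> bool" where
  "rd s j i \<longleftrightarrow> j < length s \<and> s ! j = Rd i"

fun supp :: "gen \<Rightarrow> nat set" where
  "supp (Dot j) = {j}"
| "supp (Cross j) = {j, Suc j}"
| "supp Nail = {0}"

fun hdeg :: "gen \<Rightarrow> nat" where
  "hdeg Nail = 1"
| "hdeg _ = 0"

definition lc :: "(gen list \<times> 'k::comm_ring_1) list \<Rightarrow> gen list \<Rightarrow> 'k" where
  "lc xs w = sum_list (map snd (filter (\<lambda>p. fst p = w) xs))"

text \<open>Relations (as "expression = 0") applicable with bottom colour sequence s.\<close>
definition templ :: "nat list \<Rightarrow> color list \<Rightarrow> (gen list \<times> 'k::comm_ring_1) list set" where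
  "templ N s =
     \<comment> \<open>(i) black strands\<close>
     {[([Cross j, Cross j], 1)] | j. blk s j \<and> blk s (Suc j)}
   \<union> {[([Cross j, Dot j], 1), ([Dot (Suc j), Cross j], -1), ([], -1)] | j. blk s j \<and> blk s (Suc j)}
   \<union> {[([Dot j, Cross j], 1), ([Cross j, Dot (Suc j)], -1), ([], -1)] | j. blk s j \<and> blk s (Suc j)}
     \<comment> \<open>(ii) dots slide through black/red crossings\<close>
   \<union> {[([Dot (Suc j), Cross j], 1), ([Cross j, Dot j], -1)] | j i. blk s j \<and> rd s (Suc j) i}
   \<union> {[([Dot j, Cross j], 1), ([Cross j, Dot (Suc j)], -1)] | j i. rd s j i \<and> blk s (Suc j)}
     \<comment> \<open>(iii) black/red double crossing\<close>
   \<union> {[([Cross j, Cross j], 1), (replicate (N ! i) (Dot j), -1)] | j i. blk s j \<and> rd s (Suc j) i}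
   \<union> {[([Cross j, Cross j], 1), (replicate (N ! i) (Dot (Suc j)), -1)] | j i. rd s j i \<and> blk s (Suc j)}
     \<comment> \<open>(i)/(iv) braid relation, middle strand black, at most one red strand\<close>
   \<union> {[([Cross j, Cross (Suc j), Cross j], 1), ([Cross (Suc j), Cross j, Cross (Suc j)], -1)] | j.
        blk s (Suc j) \<and> Suc (Suc j) < length s \<and> (blk s j \<or> blk s (Suc (Suc j)))}
     \<comment> \<open>(iv) braid relation, middle strand red\<close>
   \<union> {[([Cross j, Cross (Suc j), Cross j], 1), ([Cross (Suc j), Cross j, Cross (Suc j)], -1)]
        @ map (\<lambda>k. (replicate k (Dot j) @ replicate (N ! i - 1 - k) (Dot (Suc (Suc j))), -1)) [0..<N ! i]
        | j i. blk s j \<and> rd s (Suc j) i \<and> blk s (Suc (Suc j))}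
     \<comment> \<open>(v) nails\<close>
   \<union> (if blk s 0 then {[([Nail, Dot 0], 1), ([Dot 0, Nail], -1)], [([Nail, Nail], 1)]} else {})
   \<union> (if blk s 0 \<and> blk s 1 then
        {[([Cross 0, Nail, Cross 0, Nail], 1), ([Nail, Cross 0, Nail, Cross 0], 1)]} else {})
     \<comment> \<open>graded isotopy: exchanging far-apart generators\<close>
   \<union> {[([g, h], 1), ([h, g], - ((-1) ^ (hdeg g * hdeg h)))] | g h. supp g \<inter> supp h = {}}"

definition wrap :: "gen list \<Rightarrow> gen list \<Rightarrow> (gen list \<Rightarrow> 'k::comm_ring_1) \<Rightarrow> gen list \<Rightarrow> 'k" where
  "wrap u v R w = (if \<exists>m. w = u @ m @ v then R (THE m. w = u @ m @ v) else 0)"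

text \<open>The part of the two-sided ideal of relations inside 1_t F 1_s, F the free
  (path) algebra on the generators; elements are finitely supported coefficient
  functions on words.\<close>
inductive_set Ideal :: "nat list \<Rightarrow> color list \<Rightarrow> color list \<Rightarrow> (gen list \<Rightarrow> 'k::comm_ring_1) set"
  for N s t where
  I0: "(\<lambda>_. 0) \<in> Ideal N s t"
| Iadd: "f \<in> Ideal N s t \<Longrightarrow> g \<in> Ideal N s t \<Longrightarrow> (\<lambda>w. f w + g w) \<in> Ideal N s t"
| Ismult: "f \<in> Ideal N s t \<Longrightarrow> (\<lambda>w. c * f w) \<in> Ideal N s t"
| Igen: "xs \<in> templ N s0 \<Longrightarrow> (\<forall>p\<in>set xs. run s0 (fst p) = Some t0) \<Longrightarrow>
         run s v = Some s0 \<Longrightarrow> run t0 u = Some t \<Longrightarrow> wrap u v (lc xs) \<in> Ideal N s t"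

definition word_vec :: "gen list \<Rightarrow> gen list \<Rightarrow> 'k::comm_ring_1" where
  "word_vec v u = (if u = v then 1 else 0)"

text \<open>The family B (indexed by I) of words from s to t is a basis of
  1_t T 1_s = 1_t F 1_s / (ideal) as a k-module.\<close>
definition is_basis :: "'k::comm_ring_1 itself \<Rightarrow> nat list \<Rightarrow> color list \<Rightarrow> color list
    \<Rightarrow> 'i set \<Rightarrow> ('i \<Rightarrow> gen list) \<Rightarrow> bool" where
  "is_basis _ N s t I B \<longleftrightarrow>
     (\<forall>i\<in>I. run s (B i) = Some t) \<and>
     (\<forall>v. run s v = Some t \<longrightarrow>
        (\<exists>c :: 'i \<Rightarrow> 'k. finite {i\<in>I. c i \<noteq> 0} \<and>
           (\<lambda>u. word_vec v u - (\<Sum>i\<in>{i\<in>I. c i \<noteq> 0}. c i * word_vec (B i) u))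
             \<in> (Ideal N s t :: (gen list \<Rightarrow> 'k) set))) \<and>
     (\<forall>c :: 'i \<Rightarrow> 'k. finite {i\<in>I. c i \<noteq> 0} \<and>
        (\<lambda>u. \<Sum>i\<in>{i\<in>I. c i \<noteq> 0}. c i * word_vec (B i) u) \<in> (Ideal N s t :: (gen list \<Rightarrow> 'k) set)
        \<longrightarrow> (\<forall>i\<in>I. c i = 0))"

definition sw :: "nat \<Rightarrow> nat \<Rightarrow> nat" where
  "sw i p = (if p = i then Suc i else if p = Suc i then i else p)"

text \<open>perm_of [i1,...,ik] = s_{i1} o ... o s_{ik}: the strand at bottom position p ends
  at top position perm_of is p (top factor first).\<close>
fun perm_of :: "nat list \<Rightarrow> nat \<Rightarrow> nat" where
  "perm_of [] = id"
| "perm_of (i # is) = sw i \<circ> perm_of is"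

text \<open>_kappa S_rho: permutations of the strand positions matching colours of
  bottom (rho) and top (kappa); red strands automatically never cross.\<close>
definition Sperm :: "nat list \<Rightarrow> nat list \<Rightarrow> (nat \<Rightarrow> nat) set" where
  "Sperm \<kappa> \<rho> = {w. bij_betw w {0..<length (state \<rho>)} {0..<length (state \<rho>)} \<and>
      (\<forall>p\<ge>length (state \<rho>). w p = p) \<and>
      (\<forall>p<length (state \<rho>). state \<kappa> ! (w p) = state \<rho> ! p)}"

definition reduced_expr :: "nat \<Rightarrow> (nat \<Rightarrow> nat) \<Rightarrow> nat list \<Rightarrow> bool" where
  "reduced_expr n w is \<longleftrightarrow> perm_of is = w \<and> (\<forall>i\<in>set is. Suc i < n) \<and>
     (\<forall>js. (\<forall>j\<in>set js. Suc j < n) \<and> perm_of js = w \<longrightarrow> length is \<le> length js)"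

definition left_adjusted :: "nat \<Rightarrow> (nat \<Rightarrow> nat) \<Rightarrow> nat list \<Rightarrow> bool" where
  "left_adjusted n w is \<longleftrightarrow> reduced_expr n w is \<and>
     (\<forall>js. reduced_expr n w js \<longrightarrow> sum_list is \<le> sum_list js)"

definition black_pos :: "color list \<Rightarrow> nat list" where
  "black_pos s = filter (\<lambda>p. s ! p = Blk) [0..<length s]"

text \<open>Level t (t = 0 top, t = length is bottom) lies below the first t crossings;
  position at level t of the strand with top position q.\<close>
definition lvlpos :: "nat list \<Rightarrow> nat \<Rightarrow> nat \<Rightarrow> nat" where
  "lvlpos is q t = perm_of (rev (take t is)) q"

definition leftmost :: "nat list \<Rightarrow> nat \<Rightarrow> nat" where
  "leftmost is q = Min (lvlpos is q ` {0..length is})"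

definition leftlvl :: "nat list \<Rightarrow> nat \<Rightarrow> nat" where
  "leftlvl is q = (LEAST t. t \<le> length is \<and> lvlpos is q t = leftmost is q)"

text \<open>Pull the strand at position m to the blue strand, nail it, and go back.\<close>
definition nail_piece :: "nat \<Rightarrow> gen list" where
  "nail_piece m = rev (map Cross [0..<m]) @ [Nail] @ map Cross [0..<m]"

definition bword :: "nat list \<Rightarrow> nat \<Rightarrow> nat list \<Rightarrow> bool list \<Rightarrow> nat list \<Rightarrow> gen list" where
  "bword \<kappa> b is l a =
    (let q = (\<lambda>i. black_pos (state \<kappa>) ! i);
         P = (\<lambda>t. concat (map (\<lambda>i. if l ! i \<and> leftlvl is (q i) = t
                                    then nail_piece (leftmost is (q i)) else []) [0..<b]))
     in concat (map (\<lambda>i. replicate (a ! i) (Dot (q i))) [0..<b]) @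
        concat (map (\<lambda>t. P t @ (if t < length is then [Cross (is ! t)] else []))
                    [0..<Suc (length is)]))"

definition Bidx :: "nat \<Rightarrow> nat list \<Rightarrow> nat list \<Rightarrow> ((nat \<Rightarrow> nat) \<times> bool list \<times> nat list) set" where
  "Bidx b \<kappa> \<rho> = {(w, l, a). w \<in> Sperm \<kappa> \<rho> \<and> length l = b \<and> length a = b}"

end

theory Submission
  imports Defs "HOL-Computational_Algebra.Formal_Laurent_Series"
begin

text \<open>Forgetting dots, crossings act like the simple reflections \<open>s_1, s_2, ...\<close> and the nail like the reflection
  \<open>s_0\<close> of the Coxeter group of type B, so a pair \<open>(w, l)\<close> is a signed permutation: the strands of \<open>w\<close>, with a sign
  for every nailed strand. In a left-adjusted diagram no strand moves left again after a move to the right, so at its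
  leftmost level a strand has only strands to its left that it never crosses; hence the dot-free part of a basis
  word is a reduced word of its signed permutation.

  Spanning: modulo words with fewer crossings and nails, dots slide to the top, the braid relations hold up to sign, and
  the square of a crossing or of a nail vanishes. Tits' proof of Matsumoto's theorem then shows that a dot-free
  word is either lower or, up to sign and lower words, equal to the basis word of its signed permutation.

  Linear independence: in the polynomial representation, localized so that crossings become
  Demazure operators acting on functions of signed arrangements, the matrix of the dot-free basis words is
  triangular with respect to the type B length, with units on the diagonal. The variables are specialized to sparse powers of
  one Laurent variable, which makes their differences invertible over any ground ring and still
  separates the finitely many monomials of a given linear dependence.\<close>

section \<open>Left-adjusted words\<close>

text \<open>Red strands never cross, so only part of the type B group is available. The Coxeter
  arguments survive because red labels stay positive and in their original order: a descent of a
  \<open>legit\<close> arrangement is never a red/red crossing, and every reduced word met in Tits'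
  induction is an allowed diagram. Minimality of the letter sum enters through one fact,
  \<open>left_adjusted_valley\<close>; nailed strands can then be treated one crossing at a time,
  from the bottom upwards. Over a ring with zero divisors, independence needs leading coefficients
  that are units, not just nonzero. They are products of signs, powers of variables and inverse
  differences, so the variables must be invertible as well. In Laurent series X^i - X^j with i < j
  is X^i (1 - X^(j - i)), and the second factor is inverted by a geometric series. Recording
  coefficients at arrangements, instead of acting on polynomials, makes it enough to look at a
  single coefficient: the one at an arrangement of greatest length in the support.\<close>

lemma perm_of_append: "perm_of (u @ v) = perm_of u \<circ> perm_of v"
  by (induction u) (simp_all add: comp_assoc)

lemma sw_sw [simp]: "sw i \<circ> sw i = id"
  by (auto simp: sw_def fun_eq_iff)

lemma sw_commute: "Suc i < j \<Longrightarrow> sw i \<circ> sw j = sw j \<circ> sw i"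
  by (auto simp: sw_def fun_eq_iff)

lemma sw_braid: "sw i \<circ> (sw (Suc i) \<circ> sw i) = sw (Suc i) \<circ> (sw i \<circ> sw (Suc i))"
  by (auto simp: sw_def fun_eq_iff)

lemma perm_of_commute_low:
  assumes "\<forall>i\<in>set u. Suc i < m"
  shows "sw m \<circ> perm_of u = perm_of u \<circ> sw m"
  using assms
proof (induction u)
  case (Cons i u)
  have "sw m \<circ> perm_of (i # u) = (sw m \<circ> sw i) \<circ> perm_of u" by (simp add: comp_assoc)
  also have "\<dots> = (sw i \<circ> sw m) \<circ> perm_of u" using Cons.prems sw_commute[of i m] by simp
  also have "\<dots> = sw i \<circ> (sw m \<circ> perm_of u)" by (simp add: comp_assoc)
  also have "sw m \<circ> perm_of u = perm_of u \<circ> sw m" using Cons.IH Cons.prems by (metis list.set_intros(2))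
  finally show ?case by (simp only: perm_of.simps comp_assoc)
qed simp

lemma perm_of_commute_high:
  assumes "\<forall>i\<in>set u. Suc m < i"
  shows "sw m \<circ> perm_of u = perm_of u \<circ> sw m"
  using assms
proof (induction u)
  case (Cons i u)
  have "sw m \<circ> perm_of (i # u) = (sw m \<circ> sw i) \<circ> perm_of u" by (simp add: comp_assoc)
  also have "\<dots> = (sw i \<circ> sw m) \<circ> perm_of u" using Cons.prems sw_commute[of m i] by simp
  also have "\<dots> = sw i \<circ> (sw m \<circ> perm_of u)" by (simp add: comp_assoc)
  also have "sw m \<circ> perm_of u = perm_of u \<circ> sw m" using Cons.IH Cons.prems by (metis list.set_intros(2))
  finally show ?case by (simp only: perm_of.simps comp_assoc)
qed simp

text \<open>Letters below \<open>m\<close> and letters above \<open>Suc m\<close> are never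
  adjacent, so they commute and the high ones can be gathered on the left.\<close>

lemma perm_of_filter:
  assumes "\<forall>i\<in>set u. i < m \<or> Suc m < i"
  shows "perm_of u = perm_of (filter (\<lambda>i. Suc m < i) u @ filter (\<lambda>i. i < m) u)"
  using assms
proof (induction u)
  case (Cons i u)
  let ?h = "filter (\<lambda>i. Suc m < i) u" and ?l = "filter (\<lambda>i. i < m) u"
  have IH: "perm_of u = perm_of ?h \<circ> perm_of ?l"
    using Cons.IH Cons.prems by (metis list.set_intros(2) perm_of_append)
  show ?case
  proof (cases "i < m")
    case True
    then have f: "filter (\<lambda>i. Suc m < i) (i # u) = ?h" "filter (\<lambda>i. i < m) (i # u) = i # ?l"
      by auto
    have "sw i \<circ> perm_of ?h = perm_of ?h \<circ> sw i"
      using True by (intro perm_of_commute_high) auto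
    then show ?thesis unfolding f perm_of_append perm_of.simps IH
      by (simp only: flip: comp_assoc)
  next
    case False
    then have f: "filter (\<lambda>i. Suc m < i) (i # u) = i # ?h" "filter (\<lambda>i. i < m) (i # u) = ?l"
      using Cons.prems by auto
    show ?thesis unfolding f perm_of_append perm_of.simps IH
      by (simp only: comp_assoc)
  qed
qed simp

text \<open>All letters of \<open>a\<close> and \<open>D\<close> commute with \<open>sw m\<close>,
  so the two copies of \<open>m\<close> meet and cancel, or enclose \<open>k\<close> alone. In the
  second case the braid move replaces one letter \<open>Suc k\<close> by \<open>k\<close>: same
  length, letter sum smaller by one.\<close>

lemma braid_down:
  assumes a: "\<forall>i\<in>set a. Suc i < m" and D: "\<forall>i\<in>set D. Suc i < m"
  shows "perm_of (m # a @ m # D) = perm_of (a @ D)"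
    and "m = Suc k \<Longrightarrow> perm_of (m # a @ k # D @ [m]) = perm_of (a @ k # m # k # D)"
proof -
  have ca: "sw m \<circ> perm_of a = perm_of a \<circ> sw m" by (rule perm_of_commute_low[OF a])
  have cD: "sw m \<circ> perm_of D = perm_of D \<circ> sw m" by (rule perm_of_commute_low[OF D])
  have "perm_of (m # a @ m # D) = (sw m \<circ> perm_of a) \<circ> sw m \<circ> perm_of D"
    by (simp add: perm_of_append comp_assoc)
  also have "\<dots> = perm_of a \<circ> (sw m \<circ> sw m) \<circ> perm_of D"
    unfolding ca by (simp only: comp_assoc)
  finally show "perm_of (m # a @ m # D) = perm_of (a @ D)"
    by (simp add: perm_of_append)
  assume k: "m = Suc k"
  have "perm_of (m # a @ k # D @ [m]) = (sw m \<circ> perm_of a) \<circ> sw k \<circ> (perm_of D \<circ> sw m)"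
    by (simp add: perm_of_append comp_assoc)
  also have "\<dots> = perm_of a \<circ> (sw m \<circ> (sw k \<circ> sw m)) \<circ> perm_of D"
    unfolding ca cD[symmetric] by (simp only: comp_assoc)
  also have "\<dots> = perm_of a \<circ> (sw k \<circ> (sw m \<circ> sw k)) \<circ> perm_of D"
    using sw_braid[of k] k by simp
  finally show "perm_of (m # a @ k # D @ [m]) = perm_of (a @ k # m # k # D)"
    by (simp add: perm_of_append comp_assoc)
qed

text \<open>The classical normal form in symmetric groups, with length and letter sum under control.
  Two consecutive copies of the top letter enclose a word with a smaller top letter, in which the
  induction hypothesis leaves that letter at most once; by \<open>braid_down\<close> the two copies
  then cancel or merge into one.\<close>

lemma top_letter_once:
  assumes "\<forall>i\<in>set u. i < m"
  shows "\<exists>v. perm_of v = perm_of u \<and> (\<forall>i\<in>set v. i < m) \<and> length v \<le> length u \<and>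
             sum_list v \<le> sum_list u \<and> count_list v (m - 1) \<le> 1"
  using assms
proof (induction m arbitrary: u)
  case 0
  then show ?case by (intro exI[of _ u]) auto
next
  case (Suc m)
  from Suc.prems show ?case
  proof (induction "count_list u m" arbitrary: u rule: less_induct)
    case less
    show ?case
    proof (cases "count_list u m \<le> 1")
      case True
      then show ?thesis using less.prems by (intro exI[of _ u]) auto
    next
      case False
      then have "m \<in> set u" by (metis count_list_0_iff le0)
      then obtain A u' where u': "u = A @ m # u'" "m \<notin> set A"
        by (meson split_list_first)
      then have "m \<in> set u'" using False
        by (metis One_nat_def count_list.simps(2) count_list_0_iff count_list_append add_0 le_refl)
      then obtain V C where V: "u' = V @ m # C" "m \<notin> set V" by (meson split_list_first)
      have u: "u = A @ (m # V @ [m]) @ C" using u' V by simp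
      have Vm: "\<forall>i\<in>set V. i < m" using less.prems u V(2) by (auto simp: less_Suc_eq)
      from Suc.IH[OF Vm] obtain V' where V': "perm_of V' = perm_of V" "\<forall>i\<in>set V'. i < m"
        "length V' \<le> length V" "sum_list V' \<le> sum_list V" "count_list V' (m - 1) \<le> 1" by blast
      have V'm: "count_list V' m = 0" using V'(2) by (auto simp: count_list_0_iff)
      have Vm0: "count_list V m = 0" using V(2) by (simp add: count_list_0_iff)
      have *: "\<exists>W. perm_of W = perm_of (m # V @ [m]) \<and> (\<forall>i\<in>set W. i < Suc m) \<and>
          length W \<le> length V + 2 \<and> sum_list W \<le> sum_list V + 2 * m \<and> count_list W m < 2"
      proof (cases "m - 1 \<in> set V'")
        case False
        have "\<forall>i\<in>set V'. Suc i < m" using False V'(2) 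
          by (metis Suc_lessI diff_Suc_1)
        from braid_down(1)[OF this, of "[]"]
        have "perm_of (m # V @ [m]) = perm_of V'" using V'(1) by (simp add: perm_of_append)
        then show ?thesis using V' V'm by (intro exI[of _ V']) auto
      next
        case True
        then obtain a D where aD: "V' = a @ (m - 1) # D" "m - 1 \<notin> set a" by (meson split_list_first)
        have "m - 1 \<notin> set D" using V'(5) aD by (auto simp: count_list_0_iff)
        obtain k where m: "m = Suc k" using True V'(2) by (cases m) auto
        have "i < m \<and> Suc i \<noteq> m" if "i \<in> set a \<union> set D" for i
          using that aD V'(2) \<open>m - 1 \<notin> set D\<close> m by auto
        then have a: "\<forall>i\<in>set a. Suc i < m" "\<forall>i\<in>set D. Suc i < m"
          by (simp_all add: Suc_lessI)
        have V: "perm_of V = perm_of (a @ k # D)" using V'(1) aD m by simp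
        have "perm_of (m # V @ [m]) = perm_of (m # a @ k # D @ [m])"
          by (simp only: V perm_of.simps perm_of_append comp_assoc append_Cons append_assoc)
        also have "\<dots> = perm_of (a @ k # m # k # D)"
          by (rule braid_down(2)[OF a m])
        finally show ?thesis using V' aD V'm a unfolding m
          by (intro exI[of _ "a @ k # Suc k # k # D"]) (auto simp: count_list_0_iff)
      qed
      then obtain W where W: "perm_of W = perm_of (m # V @ [m])" "\<forall>i\<in>set W. i < Suc m"
          "length W \<le> length V + 2" "sum_list W \<le> sum_list V + 2 * m" "count_list W m < 2" by blast
      have "count_list (A @ W @ C) m < count_list u m"
        unfolding u using W(5) by simp
      moreover have "\<forall>i\<in>set (A @ W @ C). i < Suc m" using W(2) less.prems u by auto
      ultimately obtain v where v: "perm_of v = perm_of (A @ W @ C)" "\<forall>i\<in>set v. i < Suc m"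
         "length v \<le> length (A @ W @ C)" "sum_list v \<le> sum_list (A @ W @ C)"
         "count_list v (Suc m - 1) \<le> 1" using less.hyps[of "A @ W @ C"] by blast
      have "perm_of v = perm_of u" unfolding v(1) u perm_of_append W(1) ..
      then show ?thesis using v(2-5) W(3,4) u by (intro exI[of _ v]) auto
    qed
  qed
qed

lemma lvlpos_Suc:
  "t < length is \<Longrightarrow> lvlpos is q (Suc t) = sw (is ! t) (lvlpos is q t)"
  by (simp add: lvlpos_def take_Suc_conv_app_nth)

lemma lvlpos_0 [simp]: "lvlpos is q 0 = q"
  by (simp add: lvlpos_def)

lemma reduced_exprD:
  "reduced_expr n w is \<Longrightarrow> perm_of js = w \<Longrightarrow> \<forall>j\<in>set js. Suc j < n \<Longrightarrow> length is \<le> length js"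
  by (auto simp: reduced_expr_def)

text \<open>A braid move \<open>m, m - 1, m\<close> to \<open>m - 1, m, m - 1\<close> would lower the sum of the letters.\<close>
lemma left_adjusted_no_peak:
  assumes la: "left_adjusted n w is" and dec: "is = A @ m # U @ m # C"
    and U: "\<forall>i\<in>set U. i < m \<or> Suc m < i"
  shows False
proof -
  let ?h = "filter (\<lambda>i. Suc m < i) U" and ?l = "filter (\<lambda>i. i < m) U"
  have red: "reduced_expr n w is" using la by (simp add: left_adjusted_def)
  have bd: "\<forall>i\<in>set is. Suc i < n" and w: "perm_of is = w" using red by (auto simp: reduced_expr_def)
  have len: "length U = length ?h + length ?l" and sum: "sum_list U = sum_list ?h + sum_list ?l"
    using U by (induction U) auto
  obtain v where v: "perm_of v = perm_of ?l" "\<forall>i\<in>set v. i < m" "length v \<le> length ?l"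
     "sum_list v \<le> sum_list ?l" "count_list v (m - 1) \<le> 1"
    using top_letter_once[of ?l m] by auto
  have h: "sw m \<circ> perm_of ?h = perm_of ?h \<circ> sw m" by (rule perm_of_commute_high) auto
  have "perm_of (m # U @ [m]) = sw m \<circ> perm_of ?h \<circ> perm_of ?l \<circ> sw m"
    using perm_of_filter[OF U] by (simp add: perm_of_append comp_assoc)
  also have "\<dots> = perm_of ?h \<circ> perm_of (m # v @ [m])"
    unfolding h by (simp add: perm_of_append comp_assoc v(1))
  finally have eq: "perm_of (m # U @ [m]) = perm_of ?h \<circ> perm_of (m # v @ [m])" .
  \<comment> \<open>The strict drop of the sum is claimed only when the length is kept; with
    \<open>m = 0\<close> there is nothing to gain. A shorter \<open>W\<close> is excluded at the end
    by reducedness.\<close>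
  have "\<exists>W. perm_of W = perm_of (m # v @ [m]) \<and> (\<forall>i\<in>set W. i \<le> m) \<and>
      length W \<le> length v + 2 \<and> sum_list W < sum_list v + 2 * m + (if length W < length v + 2 then 1 else 0)"
  proof (cases "m - 1 \<in> set v")
    case False
    have "\<forall>i\<in>set v. Suc i < m" using False v(2) by (metis Suc_lessI diff_Suc_1)
    from braid_down(1)[OF this, of "[]"]
    have "perm_of (m # v @ [m]) = perm_of v" by simp
    then show ?thesis using v(2) by (intro exI[of _ v]) auto
  next
    case True
    then obtain a D where aD: "v = a @ (m - 1) # D" "m - 1 \<notin> set a" by (meson split_list_first)
    have "m - 1 \<notin> set D" using v(5) aD by (auto simp: count_list_0_iff)
    obtain k where m: "m = Suc k" using True v(2) by (cases m) auto
    have "i < m \<and> Suc i \<noteq> m" if "i \<in> set a \<union> set D" for i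
      using that aD v(2) \<open>m - 1 \<notin> set D\<close> m by auto
    then have a: "\<forall>i\<in>set a. Suc i < m" "\<forall>i\<in>set D. Suc i < m"
      by (simp_all add: Suc_lessI)
    have "perm_of (m # v @ [m]) = perm_of (a @ k # m # k # D)"
      using braid_down(2)[OF a m] aD m by simp
    moreover have "sum_list (a @ k # m # k # D) < sum_list v + 2 * m"
      using aD m by simp
    ultimately show ?thesis using aD a unfolding m
      by (intro exI[of _ "a @ k # Suc k # k # D"]) auto
  qed
  then obtain W where W: "perm_of W = perm_of (m # v @ [m])" "\<forall>i\<in>set W. i \<le> m"
    "length W \<le> length v + 2"
    "sum_list W < sum_list v + 2 * m + (if length W < length v + 2 then 1 else 0)" by blast
  let ?js = "A @ ?h @ W @ C"
  have isA: "is = A @ (m # U @ [m]) @ C" using dec by simp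
  have pj: "perm_of ?js = w"
    unfolding w[symmetric] isA perm_of_append eq W(1) by (simp add: comp_assoc)
  have bj: "\<forall>j\<in>set ?js. Suc j < n"
  proof -
    have "Suc m < n" using bd dec by simp
    then show ?thesis using bd W(2) by (auto simp: isA)
  qed
  have lj: "length ?js \<le> length is" using W(3) v(3) len isA by simp
  moreover have "length is \<le> length ?js" by (rule reduced_exprD[OF red pj bj])
  ultimately have lj: "length ?js = length is" by simp
  have "reduced_expr n w ?js"
    unfolding reduced_expr_def using pj bj lj reduced_exprD[OF red] by auto
  then have "sum_list is \<le> sum_list ?js" using la unfolding left_adjusted_def by blast
  moreover have "\<not> length W < length v + 2" using lj v(3) len isA by simp
  ultimately show False using W(4) v(4) sum isA by simp
qed

text \<open>Followed downwards, a strand that has moved right cannot move left again. Between a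
  right move and the next left move it rests at a position \<open>Suc m\<close>, so both moves are
  the letter \<open>m\<close> and the letters in between avoid \<open>m\<close> and
  \<open>Suc m\<close>: the pattern excluded by \<open>left_adjusted_no_peak\<close>.\<close>

lemma left_adjusted_valley:
  assumes la: "left_adjusted n w is" and t: "t < length is"
    and right: "lvlpos is q (Suc t) = Suc (lvlpos is q t)"
    and "Suc t \<le> t1" "t1 \<le> t2" "t2 \<le> length is"
  shows "lvlpos is q t1 \<le> lvlpos is q t2"
proof (rule ccontr)
  let ?p = "lvlpos is q"
  have step: "?p (Suc i) = sw (is ! i) (?p i)" if "i < length is" for i
    using that by (rule lvlpos_Suc)
  assume "\<not> ?thesis"
  have "\<exists>i\<ge>t1. i < t2 \<and> ?p (Suc i) < ?p i"
  proof (rule ccontr)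
    assume "\<not> ?thesis"
    then have a: "?p i \<le> ?p (Suc i)" if "t1 \<le> i" "i < t2" for i using that by force
    have "?p t1 \<le> ?p t2" using \<open>t1 \<le> t2\<close> a by (induction t2 rule: dec_induct) (fastforce intro: order_trans)+
    then show False using \<open>\<not> ?p t1 \<le> ?p t2\<close> by simp
  qed
  then obtain i0 where i0: "t1 \<le> i0" "i0 < t2" "?p (Suc i0) < ?p i0" by blast
  \<comment> \<open>\<open>L\<close> is the first left move below level \<open>t\<close>;
    \<open>R\<close> will be the last right move above \<open>L\<close>.\<close>
  define L where "L = (LEAST i. t < i \<and> ?p (Suc i) < ?p i)"
  have L: "t < L \<and> ?p (Suc L) < ?p L" unfolding L_def
    by (rule LeastI[of _ i0]) (use i0 assms in auto)
  have "L \<le> i0" unfolding L_def by (rule Least_le) (use i0 assms in auto)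
  then have Ll: "L < length is" using i0 assms by simp
  define R where "R = (GREATEST i. i < L \<and> ?p (Suc i) > ?p i)"
  have R: "R < L \<and> ?p (Suc R) > ?p R" unfolding R_def
    by (rule GreatestI_nat[of _ t L]) (use L right in auto)
  have Rmax: "i \<le> R" if "i < L" "?p (Suc i) > ?p i" for i unfolding R_def
    by (rule Greatest_le_nat[of _ i L]) (use that in auto)
  have "t \<le> R" using Rmax[of t] L right by simp
  have const: "?p (Suc i) = ?p i" if "R < i" "i < L" for i
  proof -
    have "\<not> ?p (Suc i) > ?p i" using Rmax[of i] that by auto
    moreover have "\<not> ?p (Suc i) < ?p i"
      using not_less_Least[of i "\<lambda>i. t < i \<and> ?p (Suc i) < ?p i"] that \<open>t \<le> R\<close> by (auto simp: L_def)
    ultimately show ?thesis by simp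
  qed
  define m where "m = is ! R"
  have pR: "?p R = m" "?p (Suc R) = Suc m"
    using step[of R] R Ll unfolding m_def sw_def by (auto split: if_splits)
  have pi: "?p i = Suc m" if "R < i" "i \<le> L" for i
  proof -
    have "Suc R \<le> i" using that by simp
    then show ?thesis using that(2) pR const by (induction i rule: dec_induct) auto
  qed
  have isL: "is ! L = m"
    using step[of L] Ll L pi[of L] R unfolding sw_def by (auto split: if_splits)
  have mid: "is ! i < m \<or> Suc m < is ! i" if "R < i" "i < L" for i
    using step[of i] Ll pi[of i] pi[of "Suc i"] that unfolding sw_def by (auto split: if_splits)
  define U where "U = take (L - Suc R) (drop (Suc R) is)"
  have "is = take R is @ m # drop (Suc R) is"
    using R Ll m_def id_take_nth_drop[of R "is"] by simp
  also have "drop (Suc R) is = U @ drop L is"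
    unfolding U_def using R Ll
    by (metis Suc_leI add.commute append_take_drop_id drop_drop le_add_diff_inverse2)
  also have "drop L is = m # drop (Suc L) is"
    using Ll isL by (metis Cons_nth_drop_Suc)
  finally have dec: "is = take R is @ m # U @ m # drop (Suc L) is" .
  have "\<forall>i\<in>set U. i < m \<or> Suc m < i"
  proof
    fix i assume "i \<in> set U"
    then obtain k where k: "k < L - Suc R" "i = is ! (Suc R + k)"
      unfolding U_def in_set_conv_nth using Ll by auto
    then show "i < m \<or> Suc m < i" using mid[of "Suc R + k"] by simp
  qed
  from left_adjusted_no_peak[OF la dec this] show False .
qed

section \<open>Signed arrangements and type B length\<close>

text \<open>The type B inversions of a pair with \<open>a\<close> left of \<open>c\<close>: one test
  for the difference root, one for the sum root.\<close>

definition pr :: "int \<Rightarrow> int \<Rightarrow> nat" where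
  "pr a c = of_bool (c < a) + of_bool (a + c < 0)"

text \<open>The type B length of a signed permutation in one-line notation.\<close>
fun blen :: "int list \<Rightarrow> nat" where
  "blen [] = 0"
| "blen (a # r) = of_bool (a < 0) + (\<Sum>c\<leftarrow>r. pr a c) + blen r"

text \<open>Strands are labelled by their bottom position plus one; a label changes its sign when the strand is nailed.\<close>
fun sact :: "gen \<Rightarrow> int list \<Rightarrow> int list" where
  "sact (Dot j) y = y"
| "sact (Cross j) y = swp j y"
| "sact Nail y = y[0 := - (y ! 0)]"

definition base :: "nat \<Rightarrow> int list" where
  "base n = map (\<lambda>i. int (Suc i)) [0..<n]"

definition arr :: "nat \<Rightarrow> gen list \<Rightarrow> int list" where
  "arr n u = foldr sact u (base n)"

definition col :: "color list \<Rightarrow> int \<Rightarrow> color" where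
  "col s q = s ! (nat \<bar>q\<bar> - 1)"

text \<open>The invariant of arrangements produced by a run. The last clause records that red
  strands do not cross each other.\<close>

definition legit :: "color list \<Rightarrow> int list \<Rightarrow> bool" where
  "legit s y \<longleftrightarrow> distinct (map abs y) \<and> set (map abs y) = set (base (length s)) \<and>
     (\<forall>q\<in>set y. q < 0 \<longrightarrow> col s q = Blk) \<and>
     filter (\<lambda>q. is_red (col s q)) y = filter (\<lambda>q. is_red (col s q)) (base (length s))"

fun desc :: "gen \<Rightarrow> int list \<Rightarrow> bool" where
  "desc (Dot j) y = False"
| "desc (Cross j) y = (Suc j < length y \<and> y ! Suc j < y ! j)"
| "desc Nail y = (0 < length y \<and> y ! 0 < 0)"

fun is_dot :: "gen \<Rightarrow> bool" where
  "is_dot (Dot j) = True"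
| "is_dot _ = False"

text \<open>The filtration degree. Dots are ignored because the correction terms of the relations
  are words of dots, which thus become strictly lower.\<close>

definition cnt :: "gen list \<Rightarrow> nat" where
  "cnt u = length (filter (\<lambda>g. \<not> is_dot g) u)"

lemma cnt_simps [simp]: "cnt [] = 0" "cnt (Dot j # u) = cnt u" "cnt (Cross j # u) = Suc (cnt u)"
  "cnt (Nail # u) = Suc (cnt u)" "cnt (u @ v) = cnt u + cnt v"
  by (simp_all add: cnt_def)

lemma arr_simps [simp]: "arr n [] = base n" "arr n (g # u) = sact g (arr n u)"
  by (simp_all add: arr_def)

lemma swp_append [simp]: "swp (length p) (p @ a # b # r) = p @ b # a # r"
  by (simp add: swp_def nth_append list_update_append)

lemma split_at_pair:
  assumes "Suc j < length y"
  obtains p a b r where "y = p @ a # b # r" "length p = j" "y ! j = a" "y ! Suc j = b"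
proof -
  have "y = take j y @ y ! j # y ! Suc j # drop (Suc (Suc j)) y"
    using assms by (simp add: Cons_nth_drop_Suc)
  then show ?thesis using assms that[of "take j y" "y ! j" "y ! Suc j" "drop (Suc (Suc j)) y"] by simp
qed

lemma length_swp [simp]: "length (swp j y) = length y"
  by (simp add: swp_def)

lemma swp_swp [simp]: "Suc j < length y \<Longrightarrow> swp j (swp j y) = y"
  by (elim split_at_pair) auto

lemma map_swp: "Suc j < length y \<Longrightarrow> map f (swp j y) = swp j (map f y)"
  by (simp add: swp_def map_update)

lemma set_swp: "Suc j < length y \<Longrightarrow> set (swp j y) = set y"
  by (elim split_at_pair) auto

lemma distinct_swp: "Suc j < length y \<Longrightarrow> distinct (swp j y) = distinct y"
  by (elim split_at_pair) auto

lemma nth_swp: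
  "Suc j < length y \<Longrightarrow> k < length y \<Longrightarrow> swp j y ! k = (if k = j then y ! Suc j else if k = Suc j then y ! j else y ! k)"
  by (auto simp: swp_def nth_list_update)

lemma pr_diff: "a < b \<Longrightarrow> pr b a = Suc (pr a b)"
  by (auto simp: pr_def add.commute)

text \<open>Negating \<open>a\<close> exchanges the two summands of \<open>pr\<close>, so a nail
  changes the length only through the sign of its own label.\<close>

lemma pr_neg: "c \<noteq> a \<Longrightarrow> c \<noteq> - a \<Longrightarrow> pr (- a) c = pr a c"
  by (auto simp: pr_def)

lemma blen_swap: "a < b \<Longrightarrow> blen (p @ b # a # r) = Suc (blen (p @ a # b # r))"
  by (induction p) (auto simp: pr_diff)

lemma length_base [simp]: "length (base n) = n"
  by (simp add: base_def)

lemma map_abs_base [simp]: "map abs (base n) = base n"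
  by (simp add: base_def)

lemma set_base: "set (base n) = int ` {1..n}"
  by (force simp: base_def image_iff Bex_def gr0_conv_Suc Suc_le_eq)

lemma distinct_base [simp]: "distinct (base n)"
  by (simp add: base_def distinct_map inj_on_def)

lemma sorted_base: "sorted (base n)"
  by (simp add: base_def sorted_iff_nth_mono)

lemma base_nth: "i < n \<Longrightarrow> base n ! i = int (Suc i)"
  by (simp add: base_def)

lemma blen_base [simp]: "blen (base n) = 0"
proof -
  have *: "blen y = 0" if "sorted y" "\<forall>a\<in>set y. 0 < a" for y
    using that
  proof (induction y)
    case (Cons a y)
    then have "(\<Sum>c\<leftarrow>y. pr a c) = (\<Sum>c\<leftarrow>y. 0)"
      by (intro arg_cong[of _ _ sum_list] map_cong) (auto simp: pr_def)
    then show ?case using Cons by simp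
  qed simp
  show ?thesis by (rule *) (auto simp: sorted_base set_base)
qed

lemma map_col_base [simp]: "map (col s) (base (length s)) = s"
  by (rule nth_equalityI) (auto simp: base_nth col_def nat_add_distrib)

lemma legit_base: "legit s (base (length s))"
  by (auto simp: legit_def set_base)

lemma legit_length: "legit s y \<Longrightarrow> length y = length s"
  unfolding legit_def by (metis distinct_card length_map length_base distinct_base)

lemma legit_nonzero: "legit s y \<Longrightarrow> q \<in> set y \<Longrightarrow> q \<noteq> 0"
  unfolding legit_def set_base by force

lemma legit_distinct: "legit s y \<Longrightarrow> distinct y"
  by (simp add: legit_def distinct_map)

lemma legit_swap_iff:
  assumes "\<not> (is_red (col s a) \<and> is_red (col s b))"
  shows "legit s (p @ b # a # r) \<longleftrightarrow> legit s (p @ a # b # r)"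
proof -
  have 1: "filter (\<lambda>q. is_red (col s q)) (p @ b # a # r) = filter (\<lambda>q. is_red (col s q)) (p @ a # b # r)"
    using assms by simp
  have 2: "distinct (map abs (p @ b # a # r)) = distinct (map abs (p @ a # b # r))" by auto
  have 3: "set (p @ b # a # r) = set (p @ a # b # r)" by auto
  show ?thesis unfolding legit_def 1 2 set_map 3 ..
qed

lemma legit_neg:
  assumes "col s a = Blk"
  shows "legit s (- a # r) \<longleftrightarrow> legit s (a # r)"
proof -
  have "col s (- a) = Blk" using assms by (simp add: col_def)
  then have 1: "filter (\<lambda>q. is_red (col s q)) (- a # r) = filter (\<lambda>q. is_red (col s q)) (a # r)"
    using assms by (simp add: is_red_def)
  have 2: "map abs (- a # r) = map abs (a # r)" by simp
  have 3: "(\<forall>q\<in>set (- a # r). q < 0 \<longrightarrow> col s q = Blk) = (\<forall>q\<in>set (a # r). q < 0 \<longrightarrow> col s q = Blk)"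
    using assms \<open>col s (- a) = Blk\<close> by simp
  show ?thesis unfolding legit_def 1 2 3 ..
qed

lemma legit_step:
  assumes "legit s y" and "step (map (col s) y) g = Some t"
  shows "legit s (sact g y)" and "t = map (col s) (sact g y)"
proof -
  have "legit s (sact g y) \<and> t = map (col s) (sact g y)"
  proof (cases g)
    case (Dot j)
    then show ?thesis using assms by (auto split: if_splits)
  next
    case (Cross j)
    then have j: "Suc j < length y" and t: "t = map (col s) (swp j y)" 
      and c: "\<not> (is_red (col s (y ! j)) \<and> is_red (col s (y ! Suc j)))"
      using assms(2) by (auto simp: map_swp split: if_splits)
    from j obtain p a b r where y: "y = p @ a # b # r" "length p = j" "y ! j = a" "y ! Suc j = b"
      by (rule split_at_pair)
    have "swp j y = p @ b # a # r" by (simp add: y(1) flip: y(2))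
    then have "legit s (swp j y)" using assms(1) c y legit_swap_iff[of s a b p r] by simp
    then show ?thesis using t Cross by simp
  next
    case Nail
    obtain a r where y: "y = a # r" using assms(2) Nail by (cases y) auto
    then have t: "t = map (col s) y" and c: "col s a = Blk"
      using assms(2) Nail by (simp_all split: if_splits)
    have "col s (- a) = col s a" by (simp add: col_def)
    then show ?thesis using assms(1) legit_neg[OF c] Nail t y by simp
  qed
  then show "legit s (sact g y)" "t = map (col s) (sact g y)" by auto
qed

lemma run_append: "run s (u @ v) = (case run s v of None \<Rightarrow> None | Some t \<Rightarrow> run t u)"
  by (induction u) (auto split: option.splits)

lemma run_appendE:
  assumes "run s (u @ v) = Some t"
  obtains s0 where "run s v = Some s0" "run s0 u = Some t"
  using assms by (auto simp: run_append split: option.splits)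

lemma run_ConsE:
  assumes "run s (g # u) = Some t"
  obtains s0 where "run s u = Some s0" "step s0 g = Some t"
  using assms by (auto split: option.splits)

lemma run_legit:
  assumes "run s u = Some t"
  shows "legit s (arr (length s) u) \<and> t = map (col s) (arr (length s) u)"
  using assms
proof (induction u arbitrary: t)
  case Nil
  then show ?case by (simp add: legit_base)
next
  case (Cons g u)
  from Cons.prems obtain s0 where s0: "run s u = Some s0" "step s0 g = Some t" by (rule run_ConsE)
  from Cons.IH[OF s0(1)] s0(2) legit_step[of s "arr (length s) u" g t] show ?case by auto
qed

lemma step_sact_sact:
  assumes "legit s y" "step (map (col s) y) g = Some t"
  shows "sact g (sact g y) = y"
  using assms by (cases g) (auto split: if_splits)

lemma step_back:
  assumes "legit s y" "step (map (col s) y) g = Some t"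
  shows "step t g = Some (map (col s) y)"
proof (cases g)
  case (Cross j)
  then show ?thesis using assms
    by (auto simp: nth_swp split: if_splits)
qed (use assms in \<open>auto split: if_splits\<close>)

lemma red_positive:
  assumes "legit s y" "q \<in> set y" "is_red (col s q)" shows "0 < q"
proof -
  have "\<not> q < 0" using assms unfolding legit_def is_red_def by (metis color.distinct(1))
  moreover have "q \<noteq> 0" using legit_nonzero assms by blast
  ultimately show ?thesis by simp
qed

text \<open>Red labels are positive and increase from left to right, so a descending pair contains a
  black strand, and a negative first label is black. Hence descents are always allowed
  generators.\<close>

lemma desc_step:
  assumes "legit s y" "desc g y"
  shows "step (map (col s) y) g = Some (map (col s) (sact g y))"
proof (cases g)
  case (Cross j)
  then have j: "Suc j < length y" "y ! Suc j < y ! j" using assms(2) by auto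
  have "\<not> (is_red (col s (y ! j)) \<and> is_red (col s (y ! Suc j)))"
  proof
    assume red: "is_red (col s (y ! j)) \<and> is_red (col s (y ! Suc j))"
    have "sorted (filter (\<lambda>q. is_red (col s q)) y)"
      using assms(1) sorted_base unfolding legit_def by (metis sorted_wrt_filter)
    then show False using red j by (elim split_at_pair) (auto simp: sorted_append)
  qed
  then show ?thesis using j Cross by (simp add: map_swp)
next
  case Nail
  then obtain a r where y: "y = a # r" "a < 0" using assms(2) by (cases y) auto
  then have "col s a = Blk" using assms(1) by (auto simp: legit_def)
  moreover have "col s (- a) = col s a" by (simp add: col_def)
  ultimately show ?thesis using y Nail by simp
qed (use assms in auto)

lemma blen_step:
  assumes "legit s y" "step (map (col s) y) g = Some t" "\<not> is_dot g"
  shows "if desc g y then Suc (blen (sact g y)) = blen y else blen (sact g y) = Suc (blen y)"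
proof (cases g)
  case (Cross j)
  then have j: "Suc j < length y" using assms(2) by (auto split: if_splits)
  then show ?thesis using Cross legit_distinct[OF assms(1)]
    by (elim split_at_pair) (auto simp: blen_swap)
next
  case Nail
  then obtain a r where y: "y = a # r" using assms(2) by (cases y) auto
  have c: "c \<noteq> a \<and> c \<noteq> - a" if "c \<in> set r" for c
  proof -
    have "\<bar>a\<bar> \<notin> abs ` set r" using assms(1) by (simp add: legit_def y)
    then have "\<bar>c\<bar> \<noteq> \<bar>a\<bar>" using imageI[OF that, of abs] by force
    then show ?thesis by auto
  qed
  have "a \<noteq> 0" using legit_nonzero[OF assms(1)] y by simp
  moreover have "(\<Sum>c\<leftarrow>r. pr (- a) c) = (\<Sum>c\<leftarrow>r. pr a c)"
    using c by (intro arg_cong[of _ _ sum_list] map_cong) (auto simp: pr_neg)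
  ultimately show ?thesis using Nail y by auto
qed (use assms in auto)

lemma desc_sact:
  assumes "legit s y" "desc g y"
  shows "legit s (sact g y)" "Suc (blen (sact g y)) = blen y" "sact g (sact g y) = y"
    "step (map (col s) (sact g y)) g = Some (map (col s) y)" "\<not> is_dot g"
proof -
  note st = desc_step[OF assms]
  show nd: "\<not> is_dot g" using assms(2) by (cases g) auto
  show "legit s (sact g y)" by (rule legit_step(1)[OF assms(1) st])
  show "Suc (blen (sact g y)) = blen y" using blen_step[OF assms(1) st nd] assms(2) by simp
  show "sact g (sact g y) = y" by (rule step_sact_sact[OF assms(1) st])
  show "step (map (col s) (sact g y)) g = Some (map (col s) y)" by (rule step_back[OF assms(1) st])
qed

text \<open>Without crossing descents the labels increase; without a nail descent the first label,
  hence every label, is positive.\<close>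

lemma no_desc_base:
  assumes "legit s y" "\<And>g. \<not> desc g y"
  shows "y = base (length s)"
proof -
  have so: "sorted y" unfolding sorted_iff_nth_Suc
    using assms(2) by (metis desc.simps(2) not_less)
  have "0 < a" if "a \<in> set y" for a
  proof -
    from that obtain b r where y: "y = b # r" by (cases y) auto
    then have "0 \<le> b" using assms(2)[of Nail] by simp
    moreover have "b \<le> a" using so y that by auto
    moreover have "a \<noteq> 0" using legit_nonzero assms(1) that by blast
    ultimately show ?thesis by simp
  qed
  then have "map abs y = y" by (intro map_idI) (simp add: less_imp_le)
  then show ?thesis using assms(1) so sorted_base unfolding legit_def
    by (metis sorted_distinct_set_unique distinct_base)
qed

section \<open>Reduced words of signed permutations\<close>

definition reduced :: "color list \<Rightarrow> gen list \<Rightarrow> int list \<Rightarrow> bool" where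
  "reduced s u y \<longleftrightarrow> run s u = Some (map (col s) y) \<and> arr (length s) u = y \<and>
     (\<forall>g\<in>set u. \<not> is_dot g) \<and> length u = blen y"

lemma reduced_Cons_desc:
  assumes "legit s y" "desc g y" "reduced s u (sact g y)"
  shows "reduced s (g # u) y"
  using assms(3) desc_sact[OF assms(1,2)] by (simp add: reduced_def)

lemma reduced_legit: "reduced s u y \<Longrightarrow> legit s y"
  unfolding reduced_def using run_legit by blast

lemma ex_reduced: "legit s y \<Longrightarrow> \<exists>u. reduced s u y"
proof (induction "blen y" arbitrary: y rule: less_induct)
  case less
  show ?case
  proof (cases "\<exists>g. desc g y")
    case False
    then have "y = base (length s)" using no_desc_base less.prems by blast
    then have "reduced s [] y" by (simp add: reduced_def)
    then show ?thesis ..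
  next
    case True
    then obtain g where g: "desc g y" ..
    note d = desc_sact[OF less.prems g]
    from less.hyps[OF _ d(1)] d(2) obtain u where "reduced s u (sact g y)" by auto
    then show ?thesis using reduced_Cons_desc[OF less.prems g] by blast
  qed
qed

lemma blen_arr_le:
  assumes "run s u = Some t"
  shows "blen (arr (length s) u) \<le> cnt u"
  using assms
proof (induction u arbitrary: t)
  case (Cons g u)
  from Cons.prems obtain s0 where s0: "run s u = Some s0" "step s0 g = Some t" by (rule run_ConsE)
  note l = run_legit[OF s0(1)]
  show ?case
  proof (cases "is_dot g")
    case True
    then show ?thesis using Cons.IH[OF s0(1)] by (cases g) auto
  next
    case False
    then have "blen (arr (length s) (g # u)) \<le> Suc (blen (arr (length s) u))"
      using blen_step[of s "arr (length s) u" g t] l s0(2) by (auto split: if_splits)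
    moreover have "cnt (g # u) = Suc (cnt u)" using False by (cases g) auto
    ultimately show ?thesis using Cons.IH[OF s0(1)] by simp
  qed
qed simp

lemma cnt_dotfree: "\<forall>g\<in>set u. \<not> is_dot g \<Longrightarrow> cnt u = length u"
  by (simp add: cnt_def)

text \<open>The arrangement of \<open>u\<close> has length at most \<open>length u\<close>, and one
  letter changes the length by one, so \<open>g\<close> must be a step up and \<open>u\<close> must
  be reduced.\<close>

lemma reduced_ConsD:
  assumes "reduced s (g # u) y"
  shows "desc g y" "reduced s u (sact g y)"
proof -
  note A = assms[unfolded reduced_def arr_simps]
  have r: "run s (g # u) = Some (map (col s) y)" and a: "sact g (arr (length s) u) = y"
    using A by blast+
  have nd: "\<not> is_dot g" "\<forall>g\<in>set u. \<not> is_dot g" using A by (meson list.set_intros)+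
  have len: "Suc (length u) = blen y" using A by (metis length_Cons)
  from r obtain s0 where s0: "run s u = Some s0" "step s0 g = Some (map (col s) y)" by (rule run_ConsE)
  define x where "x = arr (length s) u"
  have l: "legit s x" "s0 = map (col s) x" using run_legit[OF s0(1)] x_def by auto
  have st: "step (map (col s) x) g = Some (map (col s) y)" using s0 l by simp
  have bx: "blen x \<le> length u" using blen_arr_le[OF s0(1)] cnt_dotfree[OF nd(2)] x_def by simp
  have yx: "y = sact g x" using a x_def by simp
  have b: "blen y = Suc (blen x)" "\<not> desc g x"
    using blen_step[OF l(1) st nd(1)] bx len yx by (auto split: if_splits)
  have sy: "sact g y = x" using step_sact_sact[OF l(1) st] yx by simp
  have ly: "legit s y" using legit_step[OF l(1) st] yx by simp
  have "step (map (col s) y) g = Some (map (col s) x)" by (rule step_back[OF l(1) st])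
  from blen_step[OF ly this nd(1)] show "desc g y" using b sy by (auto split: if_splits)
  show "reduced s u (sact g y)" unfolding reduced_def sy using s0 l nd len b x_def by simp
qed

section \<open>Linear combinations of words modulo the relations\<close>

lemma wrap_mid [simp]: "wrap u v R (u @ m @ v) = R m"
proof -
  have "(THE x. u @ m @ v = u @ x @ v) = m" by (rule the_equality) auto
  then show ?thesis unfolding wrap_def by auto
qed

lemma wrap_else: "\<nexists>m. w = u @ m @ v \<Longrightarrow> wrap u v R w = 0"
  by (simp add: wrap_def)

lemma wrap_cases:
  obtains m where "w = u @ m @ v" | "\<nexists>m. w = u @ m @ v"
  by blast

lemma wrap_0: "wrap u v (\<lambda>_. 0) = (\<lambda>_. 0)"
  by (auto simp: wrap_def)

lemma wrap_add: "wrap u v (\<lambda>w. f w + g w) = (\<lambda>w. wrap u v f w + wrap u v g w)"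
  by (auto simp: wrap_def)

lemma wrap_mult: "wrap u v (\<lambda>w. c * f w) = (\<lambda>w. c * wrap u v f w)"
  by (auto simp: wrap_def)

lemma wrap_word_vec: "wrap u v (word_vec x) = word_vec (u @ x @ v)"
proof
  fix w
  show "wrap u v (word_vec x) w = word_vec (u @ x @ v) w"
    by (rule wrap_cases[of w u v]) (auto simp: wrap_else word_vec_def)
qed

lemma wrap_wrap: "wrap u v (wrap u' v' R) = wrap (u @ u') (v' @ v) R"
proof
  fix w
  show "wrap u v (wrap u' v' R) w = wrap (u @ u') (v' @ v) R w"
  proof (cases "\<exists>m. w = (u @ u') @ m @ (v' @ v)")
    case True
    then obtain m where m: "w = (u @ u') @ m @ (v' @ v)" ..
    then have "w = u @ (u' @ m @ v') @ v" by simp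
    then have "wrap u v (wrap u' v' R) w = R m" by (simp only: wrap_mid)
    also have "\<dots> = wrap (u @ u') (v' @ v) R w" unfolding m by (simp only: wrap_mid)
    finally show ?thesis .
  next
    case no: False
    show ?thesis
    proof (cases "\<exists>m. w = u @ m @ v")
      case True
      then obtain m where m: "w = u @ m @ v" ..
      then have "\<nexists>x. m = u' @ x @ v'" using no by auto
      then have "wrap u v (wrap u' v' R) w = 0" unfolding m wrap_mid by (rule wrap_else)
      then show ?thesis using wrap_else[OF no] by simp
    next
      case False
      show ?thesis unfolding wrap_else[OF no] wrap_else[OF False] ..
    qed
  qed
qed

lemma wrap_Nil [simp]: "wrap [] [] R = R"
  using wrap_mid[of "[]" "[]" R] by (simp add: fun_eq_iff)

lemma lc_Nil [simp]: "lc [] = (\<lambda>_. 0)"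
  by (simp add: lc_def fun_eq_iff)

lemma lc_Cons [simp]: "lc ((w, c) # xs) = (\<lambda>u. c * word_vec w u + lc xs u)"
  by (auto simp: lc_def fun_eq_iff word_vec_def)

lemma lc_append: "lc (xs @ ys) = (\<lambda>u. lc xs u + lc ys u)"
  by (simp add: lc_def fun_eq_iff)

text \<open>The sum of \<open>J\<close> and the linear span of \<open>W\<close>. Membership replaces
  computation in the quotient by \<open>J\<close>; coefficients are extracted only at the end, in
  \<open>wspan_coefficients\<close>.\<close>

inductive_set wspan :: "(gen list \<Rightarrow> 'k::comm_ring_1) set \<Rightarrow> gen list set \<Rightarrow> (gen list \<Rightarrow> 'k) set"
  for J W where
  wspan_ideal: "f \<in> J \<Longrightarrow> f \<in> wspan J W"
| wspan_word: "u \<in> W \<Longrightarrow> word_vec u \<in> wspan J W"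
| wspan_add: "f \<in> wspan J W \<Longrightarrow> g \<in> wspan J W \<Longrightarrow> (\<lambda>w. f w + g w) \<in> wspan J W"
| wspan_mult: "f \<in> wspan J W \<Longrightarrow> (\<lambda>w. c * f w) \<in> wspan J W"

lemma wspan_diff: "f \<in> wspan J W \<Longrightarrow> g \<in> wspan J W \<Longrightarrow> (\<lambda>w. f w - g w) \<in> wspan J W"
  using wspan_add[of f J W "\<lambda>w. (-1) * g w"] wspan_mult[of g J W "-1"] by simp

lemma wspan_trans:
  assumes "f \<in> wspan J W" "\<And>u. u \<in> W \<Longrightarrow> word_vec u \<in> wspan J W'"
  shows "f \<in> wspan J W'"
  using assms(1) by induction (auto intro: wspan.intros assms(2))

lemma wspan_cong_word:
  assumes "(\<lambda>w. word_vec u w - c * word_vec v w) \<in> wspan J W" "word_vec v \<in> wspan J W"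
  shows "word_vec u \<in> wspan J W"
  using wspan_add[OF assms(1) wspan_mult[OF assms(2), of c]] by simp

lemma Ideal_wrap:
  assumes "f \<in> Ideal N s t" "run s' v = Some s" "run t u = Some t'"
  shows "wrap u v f \<in> Ideal N s' t'"
  using assms(1)
proof induction
  case (Igen xs s0 t0 v0 u0)
  have "run s' (v0 @ v) = Some s0" using Igen assms by (simp add: run_append)
  moreover have "run t0 (u @ u0) = Some t'" using Igen assms by (simp add: run_append)
  ultimately show ?case using Igen unfolding wrap_wrap by (intro Ideal.Igen) auto
qed (auto simp: wrap_0 wrap_add wrap_mult intro: Ideal.intros)

section \<open>Filtration by the number of crossings and nails\<close>

definition low :: "nat list \<Rightarrow> color list \<Rightarrow> color list \<Rightarrow> nat \<Rightarrow> (gen list \<Rightarrow> 'k::comm_ring_1) set" where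
  "low N s t L = wspan (Ideal N s t) {u. run s u = Some t \<and> cnt u < L}"

lemma low_ideal: "f \<in> Ideal N s t \<Longrightarrow> f \<in> low N s t L"
  unfolding low_def by (rule wspan_ideal)

lemma low_word: "run s u = Some t \<Longrightarrow> cnt u < L \<Longrightarrow> word_vec u \<in> low N s t L"
  unfolding low_def by (intro wspan_word) simp

lemma low_add: "f \<in> low N s t L \<Longrightarrow> g \<in> low N s t L \<Longrightarrow> (\<lambda>w. f w + g w) \<in> low N s t L"
  unfolding low_def by (rule wspan_add)

lemma low_diff: "f \<in> low N s t L \<Longrightarrow> g \<in> low N s t L \<Longrightarrow> (\<lambda>w. f w - g w) \<in> low N s t L"
  unfolding low_def by (rule wspan_diff)

lemma low_mult: "f \<in> low N s t L \<Longrightarrow> (\<lambda>w. c * f w) \<in> low N s t L"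
  unfolding low_def by (rule wspan_mult)

lemma low_wrap:
  assumes "f \<in> low N s t L" "run s' v = Some s" "run t u = Some t'" "L + cnt u + cnt v \<le> L'"
  shows "wrap u v f \<in> low N s' t' L'"
  using assms(1) unfolding low_def
proof induction
  case (wspan_ideal f)
  then show ?case using Ideal_wrap assms by (blast intro: wspan.wspan_ideal)
next
  case (wspan_word x)
  then show ?case using assms(2-4) unfolding wrap_word_vec
    by (intro wspan.wspan_word) (auto simp: run_append)
qed (auto simp: wrap_add wrap_mult intro: wspan.intros)

definition lead_eq :: "'k::comm_ring_1 itself \<Rightarrow> nat list \<Rightarrow> color list \<Rightarrow> color list \<Rightarrow> nat \<Rightarrow> gen list \<Rightarrow> gen list \<Rightarrow> bool" where
  "lead_eq _ N s t L u v \<longleftrightarrow> (\<exists>e::'k. (e = 1 \<or> e = -1) \<and> (\<lambda>w. word_vec u w - e * word_vec v w) \<in> low N s t L)"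

lemma low_0: "(\<lambda>_. 0) \<in> low N s t L"
  by (rule low_ideal[OF Ideal.I0])

lemma lead_eq_refl: "lead_eq TYPE('k::comm_ring_1) N s t L u u"
  unfolding lead_eq_def by (intro exI[of _ 1]) (simp add: low_0)

lemma lead_eq_sym: "lead_eq TYPE('k::comm_ring_1) N s t L u v \<Longrightarrow> lead_eq TYPE('k) N s t L v u"
proof -
  assume "lead_eq TYPE('k) N s t L u v"
  then obtain e :: 'k where e: "e = 1 \<or> e = -1" and l: "(\<lambda>w. word_vec u w - e * word_vec v w) \<in> low N s t L"
    by (auto simp: lead_eq_def)
  have "e * e = 1" using e by auto
  have "(\<lambda>w. word_vec v w - e * word_vec u w) = (\<lambda>w. - e * (word_vec u w - e * word_vec v w))"
    using e by (auto simp: fun_eq_iff algebra_simps)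
  then show ?thesis using low_mult[OF l, of "- e"] e unfolding lead_eq_def by (intro exI[of _ e]) simp
qed

lemma lead_eq_trans:
  assumes "lead_eq TYPE('k::comm_ring_1) N s t L u v" "lead_eq TYPE('k) N s t L v x"
  shows "lead_eq TYPE('k) N s t L u x"
proof -
  from assms(1) obtain e :: 'k where e: "e = 1 \<or> e = -1"
    and l: "(\<lambda>w. word_vec u w - e * word_vec v w) \<in> low N s t L" by (auto simp: lead_eq_def)
  from assms(2) obtain e' :: 'k where e': "e' = 1 \<or> e' = -1"
    and l': "(\<lambda>w. word_vec v w - e' * word_vec x w) \<in> low N s t L" by (auto simp: lead_eq_def)
  from low_add[OF l low_mult[OF l', of e]]
  have "(\<lambda>w. word_vec u w - (e * e') * word_vec x w) \<in> low N s t L" by (simp add: algebra_simps)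
  then show ?thesis using e e' unfolding lead_eq_def by (intro exI[of _ "e * e'"]) auto
qed

lemma lead_eq_wrap:
  assumes "lead_eq TYPE('k::comm_ring_1) N s t L u v" "run s' y = Some s" "run t x = Some t'"
    "L + cnt x + cnt y \<le> L'"
  shows "lead_eq TYPE('k) N s' t' L' (x @ u @ y) (x @ v @ y)"
proof -
  from assms(1) obtain e :: 'k where e: "e = 1 \<or> e = -1"
    and l: "(\<lambda>w. word_vec u w + (- e) * word_vec v w) \<in> low N s t L" by (auto simp: lead_eq_def)
  have "(\<lambda>w. word_vec (x @ u @ y) w + (- e) * word_vec (x @ v @ y) w) \<in> low N s' t' L'"
    using low_wrap[OF l assms(2-4)] unfolding wrap_add wrap_mult wrap_word_vec .
  then show ?thesis using e unfolding lead_eq_def by auto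
qed

lemma lead_eq_low:
  assumes "lead_eq TYPE('k::comm_ring_1) N s t L u v" "(word_vec v :: _ \<Rightarrow> 'k) \<in> low N s t L"
  shows "(word_vec u :: _ \<Rightarrow> 'k) \<in> low N s t L"
  using assms wspan_cong_word unfolding lead_eq_def low_def by blast

section \<open>Single relations as members of the ideal\<close>

lemma rel_ideal:
  assumes "xs \<in> templ N s0" "\<forall>p\<in>set xs. run s0 (fst p) = Some t0"
  shows "lc xs \<in> Ideal N s0 t0"
  using Ideal.Igen[OF assms, of s0 "[]" "[]" t0] by simp

lemma rel2:
  fixes N :: "nat list"
  assumes "[(a, 1), (b, -1)] \<in> (templ N s0 :: (gen list \<times> 'k::comm_ring_1) list set)"
    "run s0 a = Some t0" "run s0 b = Some t0"
  shows "(\<lambda>w. word_vec a w - word_vec b w :: 'k) \<in> Ideal N s0 t0"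
  using rel_ideal[OF assms(1), of t0] assms(2,3) by simp

lemma rel3:
  fixes N :: "nat list"
  assumes "[(a, 1), (b, -1), (c, -1)] \<in> (templ N s0 :: (gen list \<times> 'k::comm_ring_1) list set)"
    "run s0 a = Some t0" "run s0 b = Some t0" "run s0 c = Some t0"
  shows "(\<lambda>w. word_vec a w - word_vec b w - word_vec c w :: 'k) \<in> Ideal N s0 t0"
  using rel_ideal[OF assms(1), of t0] assms(2-4) by (simp add: algebra_simps)

lemma templ_bb:
  assumes "blk s j" "blk s (Suc j)"
  shows "[([Cross j, Cross j], 1)] \<in> templ N s"
    "[([Cross j, Dot j], 1), ([Dot (Suc j), Cross j], -1), ([], -1)] \<in> templ N s"
    "[([Dot j, Cross j], 1), ([Cross j, Dot (Suc j)], -1), ([], -1)] \<in> templ N s"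
  unfolding templ_def
  \<comment> \<open>The union is nested to the left: the last component is tried, then the search
    descends with \<open>UnI1\<close>. The third alternative serves the innermost set.\<close>
  by ((rule UnI2, intro CollectI exI conjI, rule refl, (rule assms)+) | rule UnI1 | (intro CollectI exI conjI, rule refl, (rule assms)+))+

lemma templ_br:
  assumes "blk s j" "rd s (Suc j) i"
  shows "[([Dot (Suc j), Cross j], 1), ([Cross j, Dot j], -1)] \<in> templ N s"
    "[([Cross j, Cross j], 1), (replicate (N ! i) (Dot j), -1)] \<in> templ N s"
  unfolding templ_def
  by ((rule UnI2, intro CollectI exI conjI, rule refl, (rule assms)+) | rule UnI1 | (intro CollectI exI conjI, rule refl, (rule assms)+))+

lemma templ_rb:
  assumes "rd s j i" "blk s (Suc j)"
  shows "[([Dot j, Cross j], 1), ([Cross j, Dot (Suc j)], -1)] \<in> templ N s"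
    "[([Cross j, Cross j], 1), (replicate (N ! i) (Dot (Suc j)), -1)] \<in> templ N s"
  unfolding templ_def
  by ((rule UnI2, intro CollectI exI conjI, rule refl, (rule assms)+) | rule UnI1 | (intro CollectI exI conjI, rule refl, (rule assms)+))+

lemma templ_braid:
  assumes "blk s (Suc j)" "Suc (Suc j) < length s" "blk s j \<or> blk s (Suc (Suc j))"
  shows "[([Cross j, Cross (Suc j), Cross j], 1), ([Cross (Suc j), Cross j, Cross (Suc j)], -1)] \<in> templ N s"
  unfolding templ_def
  by ((rule UnI2, intro CollectI exI conjI, rule refl, (rule assms)+) | rule UnI1 | (intro CollectI exI conjI, rule refl, (rule assms)+))+

lemma templ_braid_red:
  assumes "blk s j" "rd s (Suc j) i" "blk s (Suc (Suc j))"
  shows "[([Cross j, Cross (Suc j), Cross j], 1), ([Cross (Suc j), Cross j, Cross (Suc j)], -1)]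
        @ map (\<lambda>k. (replicate k (Dot j) @ replicate (N ! i - 1 - k) (Dot (Suc (Suc j))), -1)) [0..<N ! i]
    \<in> templ N s"
  unfolding templ_def
  by ((rule UnI2, intro CollectI exI conjI, rule refl, (rule assms)+) | rule UnI1 | (intro CollectI exI conjI, rule refl, (rule assms)+))+

lemma templ_nail:
  assumes "blk s 0"
  shows "[([Nail, Dot 0], 1), ([Dot 0, Nail], -1)] \<in> templ N s" "[([Nail, Nail], 1)] \<in> templ N s"
  unfolding templ_def
  by (rule UnI1, rule UnI1, rule UnI2, use assms in simp)+

lemma templ_nail_braid:
  assumes "blk s 0" "blk s 1"
  shows "[([Cross 0, Nail, Cross 0, Nail], 1), ([Nail, Cross 0, Nail, Cross 0], 1)] \<in> templ N s"
  unfolding templ_def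
  by (rule UnI1, rule UnI2, use assms in simp)

text \<open>Two nails always share position 0, so generators with disjoint supports are never both
  odd and the sign is +1.\<close>

lemma templ_isotopy:
  assumes "supp g \<inter> supp h = {}"
  shows "[([g, h], 1), ([h, g], -1)] \<in> templ N s"
proof -
  have "hdeg g * hdeg h = 0" using assms by (cases g; cases h) auto
  moreover have "[([g, h], 1), ([h, g], - ((-1) ^ (hdeg g * hdeg h)))] \<in> templ N s"
    unfolding templ_def by (rule UnI2, use assms in blast)
  ultimately show ?thesis by (simp only: power_0)
qed

lemma run_far_commute:
  assumes "supp g \<inter> supp h = {}" "run s [g, h] = Some t"
  shows "run s [h, g] = Some t"
  using assms by (cases g; cases h) (auto simp: nth_swp swp_def list_update_swap split: if_splits)

lemma isotopy_ideal:
  assumes "supp g \<inter> supp h = {}" "run s [g, h] = Some t"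
  shows "(\<lambda>w. word_vec [g, h] w - word_vec [h, g] w) \<in> Ideal N s t"
  using rel2[OF templ_isotopy[OF assms(1)] assms(2) run_far_commute[OF assms]] .

section \<open>Moving dots to the top\<close>

lemma step_Dot_Some: "step s (Dot j) = Some t \<longleftrightarrow> j < length s \<and> s ! j = Blk \<and> t = s"
  by auto

lemma step_Cross_Some: "step s (Cross j) = Some t \<longleftrightarrow>
   Suc j < length s \<and> \<not> (is_red (s ! j) \<and> is_red (s ! Suc j)) \<and> t = swp j s"
  by auto

lemma not_red [simp]: "\<not> is_red c \<longleftrightarrow> c = Blk"
  by (cases c) (auto simp: is_red_def)

text \<open>The only correction is the empty word, at a black/black crossing. Its \<open>cnt\<close>
  is 0, whence the bound 1; past red strands, nails and distant generators the dot slides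
  freely.\<close>

lemma dot_slide:
  fixes N :: "nat list"
  assumes "run s [g, Dot i] = Some t" "\<not> is_dot g"
  shows "\<exists>k. run s [Dot k, g] = Some t \<and>
    (\<lambda>w. word_vec [g, Dot i] w - word_vec [Dot k, g] w :: 'k::comm_ring_1) \<in> low N s t 1"
proof (cases "supp g \<inter> supp (Dot i) = {}")
  case True
  then show ?thesis using run_far_commute[OF True assms(1)] isotopy_ideal[OF True assms(1)] low_ideal by blast
next
  case False
  have i: "i < length s" "s ! i = Blk" and st: "step s g = Some t"
    using assms(1) by (auto split: if_splits)
  show ?thesis
  proof (cases g)
    case Nail
    with False have "i = 0" by simp
    then have "blk s 0" using i by (simp add: blk_def)
    from rel2[OF templ_nail(1)[OF this], of t] show ?thesis
      using assms(1) Nail \<open>i = 0\<close> st by (intro exI[of _ 0]) (auto intro!: low_ideal split: if_splits)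
  next
    case (Cross j)
    then have j: "Suc j < length s" and t: "t = swp j s" 
      using st unfolding Cross step_Cross_Some by auto
    have run_nil: "(word_vec [] :: _ \<Rightarrow> 'k) \<in> low N s t 1" if "blk s j" "blk s (Suc j)"
    proof -
      have "swp j s = s" using that by (auto simp: swp_def blk_def intro!: nth_equalityI simp: nth_list_update)
      then show ?thesis using t by (intro low_word) simp_all
    qed
    from False Cross consider "i = j" | "i = Suc j" by auto
    then show ?thesis
    proof cases
      case 1
      have b: "blk s j" using i 1 by (simp add: blk_def)
      have r: "run s [Dot (Suc j), Cross j] = Some t"
        using i 1 j t st unfolding Cross by (auto simp: nth_swp)
      have r': "run s [Cross j, Dot j] = Some t" using assms(1) Cross 1 by simp
      show ?thesis
      proof (cases "s ! Suc j")
        case Blk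
        then have b': "blk s (Suc j)" using j by (simp add: blk_def)
        have "run s [] = Some t" using t b b' by (auto simp: swp_def blk_def intro!: nth_equalityI simp: nth_list_update)
        from low_add[OF low_ideal[OF rel3[OF templ_bb(2)[OF b b'] r' r this]] run_nil[OF b b']]
        show ?thesis using r 1 Cross by (intro exI[of _ "Suc j"]) simp
      next
        case (Rd m)
        then have b': "rd s (Suc j) m" using j by (simp add: rd_def)
        from low_mult[OF low_ideal[OF rel2[OF templ_br(1)[OF b b'] r r']], of "-1"]
        show ?thesis using r 1 Cross by (intro exI[of _ "Suc j"]) simp
      qed
    next
      case 2
      have b: "blk s (Suc j)" using i 2 by (simp add: blk_def)
      have r: "run s [Dot j, Cross j] = Some t"
        using i 2 j t st unfolding Cross by (auto simp: nth_swp)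
      have r': "run s [Cross j, Dot (Suc j)] = Some t" using assms(1) Cross 2 by simp
      show ?thesis
      proof (cases "s ! j")
        case Blk
        then have b': "blk s j" using j by (simp add: blk_def)
        have "run s [] = Some t" using t b b' by (auto simp: swp_def blk_def intro!: nth_equalityI simp: nth_list_update)
        from low_mult[OF low_add[OF low_ideal[OF rel3[OF templ_bb(3)[OF b' b] r r' this]] run_nil[OF b' b]], of "-1"]
        show ?thesis using r 2 Cross by (intro exI[of _ j]) simp
      next
        case (Rd m)
        then have b': "rd s j m" using j by (simp add: rd_def)
        from low_mult[OF low_ideal[OF rel2[OF templ_rb(1)[OF b' b] r r']], of "-1"]
        show ?thesis using r 2 Cross by (intro exI[of _ j]) simp
      qed
    qed
  qed (use assms in simp)
qed

lemma is_dotE: assumes "is_dot d" obtains i where "d = Dot i"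
  using assms by (cases d) auto

lemma cnt_dots: "\<forall>d\<in>set ds. is_dot d \<Longrightarrow> cnt ds = 0"
  by (simp add: cnt_def)

lemma dots_slide:
  fixes N :: "nat list"
  assumes "run s (g # ds) = Some t" "\<not> is_dot g" "\<forall>d\<in>set ds. is_dot d"
  shows "\<exists>ds'. (\<forall>d\<in>set ds'. is_dot d) \<and> run s (ds' @ [g]) = Some t \<and>
    (\<lambda>w. word_vec (g # ds) w - word_vec (ds' @ [g]) w :: 'k::comm_ring_1) \<in> low N s t 1"
  using assms
proof (induction ds arbitrary: t)
  case Nil
  then show ?case by (intro exI[of _ "[]"]) (simp add: low_0)
next
  case (Cons d ds)
  obtain i where d: "d = Dot i" using Cons.prems is_dotE by auto
  from Cons.prems(1) have "run s ([g, d] @ ds) = Some t" by simp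
  then obtain s0 where s0: "run s ds = Some s0" "run s0 [g, d] = Some t" by (rule run_appendE)
  from dot_slide[OF s0(2)[unfolded d] Cons.prems(2), where ?'k = 'k and N = N] d
  obtain k where k: "run s0 [Dot k, g] = Some t"
    "(\<lambda>w. word_vec [g, d] w - word_vec [Dot k, g] w :: 'k) \<in> low N s0 t 1" by blast
  have c: "cnt ds = 0" using Cons.prems by (intro cnt_dots) simp
  have "(\<lambda>w. word_vec [g, d] w + (-1) * word_vec [Dot k, g] w :: 'k) \<in> low N s0 t 1" using k(2) by simp
  from low_wrap[OF this s0(1), of "[]" t 1, unfolded wrap_add wrap_mult wrap_word_vec] c
  have 1: "(\<lambda>w. word_vec (g # d # ds) w + (-1) * word_vec (Dot k # g # ds) w :: 'k) \<in> low N s t 1" by simp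
  from k(1) obtain t1 where t1: "step s0 g = Some t1" "step t1 (Dot k) = Some t" by (auto split: option.splits)
  then have "run s (g # ds) = Some t1" using s0 by simp
  from Cons.IH[OF this Cons.prems(2)] Cons.prems(3)
  obtain ds' where ds': "\<forall>d\<in>set ds'. is_dot d" "run s (ds' @ [g]) = Some t1"
    "(\<lambda>w. word_vec (g # ds) w - word_vec (ds' @ [g]) w :: 'k) \<in> low N s t1 1" by auto
  have "(\<lambda>w. word_vec (g # ds) w + (-1) * word_vec (ds' @ [g]) w :: 'k) \<in> low N s t1 1" using ds'(3) by simp
  from low_wrap[OF this, of s "[]" "[Dot k]" t 1, unfolded wrap_add wrap_mult wrap_word_vec] t1
  have 2: "(\<lambda>w. word_vec (Dot k # g # ds) w + (-1) * word_vec (Dot k # ds' @ [g]) w :: 'k) \<in> low N s t 1" by simp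
  show ?case using low_add[OF 1 2] ds' t1 by (intro exI[of _ "Dot k # ds'"]) simp
qed

text \<open>Letters are added from the bottom. At a crossing or nail, \<open>dots_slide\<close>
  lifts the dots collected so far; its error has \<open>cnt\<close> 0, so on top of
  \<open>u0\<close> it stays below the \<open>cnt\<close> of the whole word.\<close>

lemma dots_up:
  fixes N :: "nat list"
  assumes "run s u = Some t"
  shows "\<exists>ds u0. (\<forall>d\<in>set ds. is_dot d) \<and> (\<forall>d\<in>set u0. \<not> is_dot d) \<and> run s (ds @ u0) = Some t \<and> 
    cnt u0 = cnt u \<and> (\<lambda>w. word_vec u w - word_vec (ds @ u0) w :: 'k::comm_ring_1) \<in> low N s t (cnt u)"
  using assms
proof (induction u arbitrary: t)
  case Nil
  then show ?case by (intro exI[of _ "[]"]) (simp add: low_0)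
next
  case (Cons g u)
  from Cons.prems obtain s0 where s0: "run s u = Some s0" "step s0 g = Some t" by (rule run_ConsE)
  from Cons.IH[OF s0(1)] obtain ds u0 where u0: "\<forall>d\<in>set ds. is_dot d" "\<forall>d\<in>set u0. \<not> is_dot d"
    "run s (ds @ u0) = Some s0" "cnt u0 = cnt u"
    "(\<lambda>w. word_vec u w - word_vec (ds @ u0) w :: 'k) \<in> low N s s0 (cnt u)" by blast
  have "(\<lambda>w. word_vec u w + (-1) * word_vec (ds @ u0) w :: 'k) \<in> low N s s0 (cnt u)" using u0(5) by simp
  from low_wrap[OF this, of s "[]" "[g]" t "cnt (g # u)", unfolded wrap_add wrap_mult wrap_word_vec] s0
  have 1: "(\<lambda>w. word_vec (g # u) w + (-1) * word_vec (g # ds @ u0) w :: 'k) \<in> low N s t (cnt (g # u))"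
    by (simp add: cnt_def)
  show ?case
  proof (cases "is_dot g")
    case True
    then show ?thesis using 1 u0 s0 by (intro exI[of _ "g # ds"] exI[of _ u0]) (simp add: cnt_def)
  next
    case False
    from u0(3) obtain s1 where s1: "run s u0 = Some s1" "run s1 ds = Some s0" by (rule run_appendE)
    then have "run s1 (g # ds) = Some t" using s0 by simp
    from dots_slide[OF this False u0(1), where ?'k = 'k and N = N] obtain ds' where
      ds': "\<forall>d\<in>set ds'. is_dot d" "run s1 (ds' @ [g]) = Some t"
      "(\<lambda>w. word_vec (g # ds) w - word_vec (ds' @ [g]) w :: 'k) \<in> low N s1 t 1" by blast
    have "(\<lambda>w. word_vec (g # ds) w + (-1) * word_vec (ds' @ [g]) w :: 'k) \<in> low N s1 t 1" using ds'(3) by simp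
    from low_wrap[OF this s1(1), of "[]" t "Suc (cnt u0)", unfolded wrap_add wrap_mult wrap_word_vec]
    have 2: "(\<lambda>w. word_vec (g # ds @ u0) w + (-1) * word_vec (ds' @ g # u0) w :: 'k) \<in> low N s t (cnt (g # u))"
      using False u0(4) by (simp add: cnt_def)
    have "run s ((ds' @ [g]) @ u0) = Some t" using s1 ds'(2) unfolding run_append by simp
    then show ?thesis using low_add[OF 1 2] ds' u0 False
      by (intro exI[of _ ds'] exI[of _ "g # u0"]) (simp add: cnt_def)
  qed
qed

section \<open>Reduced words modulo shorter words\<close>

text \<open>Needed to exclude red/red crossings inside a braid, where the two strands need not be
  adjacent at first.\<close>

lemma red_order:
  assumes "legit s y" "i < k" "k < length y" "is_red (col s (y ! i))" "is_red (col s (y ! k))"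
  shows "y ! i < y ! k"
proof -
  have "sorted_wrt (<) (filter (\<lambda>q. is_red (col s q)) y)"
    using assms(1) sorted_base distinct_base strict_sorted_iff[of "base (length s)"] unfolding legit_def
    by (metis sorted_wrt_filter)
  moreover have "y = take i y @ y ! i # drop (Suc i) y"
    using assms by (simp add: id_take_nth_drop)
  then have "filter (\<lambda>q. is_red (col s q)) y =
      filter (\<lambda>q. is_red (col s q)) (take i y) @ y ! i # filter (\<lambda>q. is_red (col s q)) (drop (Suc i) y)"
    using assms(4) by (metis filter.simps(2) filter_append)
  moreover have "y ! k \<in> set (drop (Suc i) y)"
    using nth_mem[of "k - Suc i" "drop (Suc i) y"] assms(2,3) by simp
  ultimately show ?thesis using assms(5) by (auto simp: sorted_wrt_append)
qed

lemma reduced_chain: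
  assumes "reduced s (u @ c) y" "reduced s c y'"
  shows "run (map (col s) y') u = Some (map (col s) y)" 
  using assms unfolding reduced_def run_append by simp

lemma lead_eq_ideal:
  assumes "(\<lambda>w. word_vec u w - word_vec v w :: 'k::comm_ring_1) \<in> Ideal N s t"
  shows "lead_eq TYPE('k) N s t L u v"
  unfolding lead_eq_def using low_ideal[OF assms] by (intro exI[of _ 1]) simp

lemma dots_low:
  assumes "\<And>d. d \<in> set ds \<Longrightarrow> is_dot d \<and> step s d = Some s" "0 < L"
  shows "run s ds = Some s" "word_vec ds \<in> low N s s L"
proof -
  show r: "run s ds = Some s" using assms(1) by (induction ds) auto
  have "cnt ds = 0" using assms(1) by (intro cnt_dots) auto
  then show "word_vec ds \<in> low N s s L" using r assms(2) by (intro low_word) auto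
qed

lemma low_lc:
  fixes xs :: "(gen list \<times> 'k::comm_ring_1) list"
  assumes "\<And>x. x \<in> set xs \<Longrightarrow> (word_vec (fst x) :: _ \<Rightarrow> 'k) \<in> low N s t L"
  shows "lc xs \<in> low N s t L"
  using assms
proof (induction xs)
  case (Cons x xs)
  obtain a b where x: "x = (a, b)" by (cases x)
  have 1: "lc xs \<in> low N s t L" by (rule Cons.IH) (simp add: Cons.prems)
  have 2: "(word_vec a :: _ \<Rightarrow> 'k) \<in> low N s t L" using Cons.prems[of x] x by simp
  from low_add[OF low_mult[OF 2, of b] 1] show ?case unfolding x by simp
qed (simp add: low_0)

text \<open>A black/black double crossing and a double nail are zero; a black/red double crossing
  turns into dots, of \<open>cnt\<close> 0.\<close>

lemma square_low:
  fixes N :: "nat list"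
  assumes "run s [g, g] = Some t" "\<not> is_dot g"
  shows "(word_vec [g, g] :: _ \<Rightarrow> 'k::comm_ring_1) \<in> low N s t 2"
proof (cases g)
  case Nail
  then have "blk s 0" using assms(1) by (auto simp: blk_def split: if_splits)
  from rel_ideal[OF templ_nail(2)[OF this], of t] assms(1) show ?thesis
    unfolding Nail by (intro low_ideal) simp
next
  case (Cross j)
  from assms(1)[unfolded Cross] obtain s1 where s1: "step s (Cross j) = Some s1" "step s1 (Cross j) = Some t"
    by (auto split: option.splits simp del: step.simps)
  then have j: "Suc j < length s" "\<not> (is_red (s ! j) \<and> is_red (s ! Suc j))" and t: "t = s"
    unfolding step_Cross_Some by auto
  have r: "run s [Cross j, Cross j] = Some s" using assms(1) Cross t by simp
  consider "blk s j" "blk s (Suc j)" | i where "blk s j" "rd s (Suc j) i" | i where "rd s j i" "blk s (Suc j)"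
    using j unfolding blk_def rd_def by (cases "s ! j"; cases "s ! Suc j") (auto simp: is_red_def)
  then show ?thesis
  proof cases
    case 1
    from rel_ideal[OF templ_bb(1)[OF 1], of t] r show ?thesis
      unfolding Cross t by (intro low_ideal) simp
  next
    case 2
    let ?d = "replicate (N ! i) (Dot j)"
    have d: "run s ?d = Some s" "word_vec ?d \<in> low N s s 2"
      using dots_low[of ?d s 2] 2 j(1) by (auto simp: blk_def)
    from low_add[OF low_ideal[OF rel2[OF templ_br(2)[OF 2] r d(1)]] d(2)]
    show ?thesis unfolding Cross t by simp
  next
    case 3
    let ?d = "replicate (N ! i) (Dot (Suc j))"
    have d: "run s ?d = Some s" "word_vec ?d \<in> low N s s 2"
      using dots_low[of ?d s 2] 3 j(1) by (auto simp: blk_def)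
    from low_add[OF low_ideal[OF rel2[OF templ_rb(2)[OF 3] r d(1)]] d(2)]
    show ?thesis unfolding Cross t by simp
  qed
qed (use assms in simp)

text \<open>With a black middle strand the relation is exact. With a red one, both outer strands are
  black and the extra terms are words of dots.\<close>

lemma braid_lead_eq:
  fixes N :: "nat list"
  assumes "legit s y'" "run (map (col s) y') [Cross j, Cross (Suc j), Cross j] = Some t"
    "run (map (col s) y') [Cross (Suc j), Cross j, Cross (Suc j)] = Some t"
    "Suc (Suc j) < length y'"
    and reds: "\<not> (is_red (col s (y' ! j)) \<and> is_red (col s (y' ! Suc j)))"
      "\<not> (is_red (col s (y' ! j)) \<and> is_red (col s (y' ! Suc (Suc j))))"
      "\<not> (is_red (col s (y' ! Suc j)) \<and> is_red (col s (y' ! Suc (Suc j))))"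
  shows "lead_eq TYPE('k::comm_ring_1) N (map (col s) y') t 3
     [Cross j, Cross (Suc j), Cross j] [Cross (Suc j), Cross j, Cross (Suc j)]"
proof (cases "col s (y' ! Suc j) = Blk")
  case True
  then have "blk (map (col s) y') (Suc j)" "Suc (Suc j) < length (map (col s) y')"
    "blk (map (col s) y') j \<or> blk (map (col s) y') (Suc (Suc j))"
    using assms(4) reds unfolding blk_def by (auto simp flip: not_red)
  from rel2[OF templ_braid[OF this] assms(2,3)] show ?thesis by (rule lead_eq_ideal)
next
  case False
  let ?s = "map (col s) y'"
  from False obtain i where i: "col s (y' ! Suc j) = Rd i" by (cases "col s (y' ! Suc j)") auto
  then have bl: "col s (y' ! j) = Blk" "col s (y' ! Suc (Suc j)) = Blk"
    using reds by (auto simp: is_red_def simp flip: not_red)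
  then have b: "blk ?s j" "rd ?s (Suc j) i" "blk ?s (Suc (Suc j))"
    using i assms(4) by (auto simp: blk_def rd_def)
  have t: "t = ?s"
  proof -
    have "t = swp j (swp (Suc j) (swp j ?s))"
      using assms(2) by (auto split: if_splits option.splits)
    also have "\<dots> = ?s" using assms(4) bl by (intro nth_equalityI) (auto simp: nth_swp)
    finally show ?thesis .
  qed
  let ?d = "\<lambda>k. replicate k (Dot j) @ replicate (N ! i - 1 - k) (Dot (Suc (Suc j)))"
  let ?D = "map (\<lambda>k. (?d k, -1 :: 'k)) [0..<N ! i]"
  have d: "run ?s (?d k) = Some ?s" "(word_vec (?d k) :: _ \<Rightarrow> 'k) \<in> low N ?s ?s 3" for k
  proof -
    have *: "is_dot d' \<and> step ?s d' = Some ?s" if "d' \<in> set (?d k)" for d'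
      using that bl assms(4) by (auto simp: set_replicate_conv_if split: if_splits)
    show "run ?s (?d k) = Some ?s" "(word_vec (?d k) :: _ \<Rightarrow> 'k) \<in> low N ?s ?s 3"
      by (rule dots_low[where L = 3], erule *, simp)+
  qed
  have D: "lc ?D \<in> low N ?s ?s 3" by (rule low_lc) (auto simp: d[simplified])
  have "lc ([([Cross j, Cross (Suc j), Cross j], 1), ([Cross (Suc j), Cross j, Cross (Suc j)], -1)] @ ?D) \<in> Ideal N ?s t"
    by (rule rel_ideal[OF templ_braid_red[OF b]]) (use assms(2,3) d[simplified] t in auto)
  from low_diff[OF low_ideal[OF this[unfolded t], of 3] D] show ?thesis
    unfolding lead_eq_def t by (intro exI[of _ 1]) (simp add: lc_append)
qed

lemma nail_braid_lead_eq:
  fixes N :: "nat list"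
  assumes "run s [Cross 0, Nail, Cross 0, Nail] = Some t" "run s [Nail, Cross 0, Nail, Cross 0] = Some t"
    "blk s 0" "blk s 1"
  shows "lead_eq TYPE('k::comm_ring_1) N s t 4 [Cross 0, Nail, Cross 0, Nail] [Nail, Cross 0, Nail, Cross 0]"
proof -
  have "lc [([Cross 0, Nail, Cross 0, Nail], 1), ([Nail, Cross 0, Nail, Cross 0], 1 :: 'k)] \<in> Ideal N s t"
    by (rule rel_ideal[OF templ_nail_braid[OF assms(3,4)]]) (use assms(1,2) in auto)
  from low_ideal[OF this, of 4] show ?thesis
    unfolding lead_eq_def by (intro exI[of _ "-1"]) simp
qed

text \<open>The rank two case of Matsumoto's theorem. In its instances \<open>y'\<close> is the
  shortest arrangement in the orbit of \<open>y\<close> under \<open>g\<close> and \<open>h\<close>,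
  and \<open>g # p\<close>, \<open>h # q\<close> are the two alternating words of the longest
  element of the dihedral group generated by them.\<close>

definition dihedral :: "'k::comm_ring_1 itself \<Rightarrow> nat list \<Rightarrow> color list \<Rightarrow> int list \<Rightarrow> gen \<Rightarrow> gen \<Rightarrow> bool" where
  "dihedral k N s y g h \<longleftrightarrow> (\<exists>p q y'. legit s y' \<and>
     (\<forall>c. reduced s c y' \<longrightarrow> reduced s (p @ c) (sact g y) \<and> reduced s (q @ c) (sact h y)) \<and>
     lead_eq k N (map (col s) y') (map (col s) y) (Suc (length p)) (g # p) (h # q))"

lemma dihedral_sym:
  assumes "legit s y" "desc g y" "desc h y" "dihedral TYPE('k::comm_ring_1) N s y g h"
  shows "dihedral TYPE('k) N s y h g"
proof -
  obtain p q y' where d: "legit s y'"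
     "\<And>c. reduced s c y' \<Longrightarrow> reduced s (p @ c) (sact g y) \<and> reduced s (q @ c) (sact h y)"
     "lead_eq TYPE('k) N (map (col s) y') (map (col s) y) (Suc (length p)) (g # p) (h # q)"
    using assms(4) unfolding dihedral_def by blast
  obtain c where c: "reduced s c y'" using ex_reduced[OF d(1)] ..
  have "length p = length q"
    using d(2)[OF c] desc_sact(2)[OF assms(1,2)] desc_sact(2)[OF assms(1,3)] unfolding reduced_def by simp
  then show ?thesis unfolding dihedral_def using d lead_eq_sym by (intro exI[of _ q] exI[of _ p] exI[of _ y']) auto
qed

lemma dihedral_far:
  assumes "legit s y" "desc g y" "desc h y" "supp g \<inter> supp h = {}"
  shows "dihedral TYPE('k::comm_ring_1) N s y g h"
proof -
  let ?y' = "sact h (sact g y)"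
  have eq: "sact g (sact h y) = ?y'"
    using assms by (cases g; cases h) (auto simp: swp_def list_update_swap)
  have dh: "desc h (sact g y)" "desc g (sact h y)"
    using assms by (cases g; cases h; auto simp: nth_swp)+
  note g = desc_sact[OF assms(1,2)] and h = desc_sact[OF assms(1,3)]
  have l: "legit s ?y'" using desc_sact(1)[OF g(1) dh(1)] .
  have red: "reduced s ([h] @ c) (sact g y) \<and> reduced s ([g] @ c) (sact h y)" if "reduced s c ?y'" for c
    using reduced_Cons_desc[OF g(1) dh(1) that] reduced_Cons_desc[OF h(1) dh(2)] that eq by simp
  obtain c where c: "reduced s c ?y'" using ex_reduced[OF l] ..
  have "reduced s ([g, h] @ c) y" using reduced_Cons_desc[OF assms(1,2)] red[OF c] by simp
  from reduced_chain[OF this c] isotopy_ideal[OF assms(4)]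
  have "lead_eq TYPE('k) N (map (col s) ?y') (map (col s) y) 2 [g, h] [h, g]"
    by (blast intro: lead_eq_ideal)
  then show ?thesis unfolding dihedral_def using l red
    by (intro exI[of _ "[h]"] exI[of _ "[g]"] exI[of _ ?y']) (simp add: numeral_2_eq_2)
qed

lemma swp_append2:
  assumes "length p = j"
  shows "swp j (p @ a # b # r) = p @ b # a # r" "swp (Suc j) (p @ a # b # c # r) = p @ a # c # b # r"
  using swp_append[of p a b r] swp_append[of "p @ [a]" b c r] assms by simp_all

text \<open>Two adjacent descents mean three decreasing labels; both chains of swaps sort them. No
  two of the three are red, because red labels increase.\<close>

lemma dihedral_braid:
  assumes "legit s y" "desc (Cross j) y" "desc (Cross (Suc j)) y"
  shows "dihedral TYPE('k::comm_ring_1) N s y (Cross j) (Cross (Suc j))"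
proof -
  have "Suc (Suc j) < length y" using assms(3) by simp
  then have dec: "y = take j y @ y ! j # y ! Suc j # y ! Suc (Suc j) # drop (Suc (Suc (Suc j))) y"
    by (simp add: Cons_nth_drop_Suc)
  define P a b c R where defs: "P = take j y" "a = y ! j" "b = y ! Suc j" "c = y ! Suc (Suc j)"
    "R = drop (Suc (Suc (Suc j))) y"
  have y: "y = P @ a # b # c # R" and P: "length P = j" using dec defs \<open>Suc (Suc j) < length y\<close> by auto
  have ord: "c < b" "b < a" using assms(2,3) defs by auto
  let ?y' = "P @ c # b # a # R"
  note sw = swp_append2[OF P]
  have nth: "(P @ u # v # w # R) ! j = u" "(P @ u # v # w # R) ! Suc j = v" "(P @ u # v # w # R) ! Suc (Suc j) = w" for u v w
    using P by (auto simp: nth_append)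
  have ds: "desc (Cross j) (P @ u # v # w # R) \<longleftrightarrow> v < u" "desc (Cross (Suc j)) (P @ u # v # w # R) \<longleftrightarrow> w < v" for u v w
    using P nth by auto
  note sd = desc_sact(1)
  have l1: "legit s (P @ b # a # c # R)" using sd[OF assms(1,2)] y sw by simp
  have l2: "legit s (P @ b # c # a # R)" using sd[OF l1, of "Cross (Suc j)"] ds ord sw by auto
  have l3: "legit s (P @ a # c # b # R)" using sd[OF assms(1,3)] y sw by simp
  have l4: "legit s (P @ c # a # b # R)" using sd[OF l3, of "Cross j"] ds ord sw by auto
  have l: "legit s ?y'" using sd[OF l2, of "Cross j"] ds ord sw by auto
  have red: "reduced s ([Cross (Suc j), Cross j] @ x) (sact (Cross j) y) \<and>
      reduced s ([Cross j, Cross (Suc j)] @ x) (sact (Cross (Suc j)) y)" if "reduced s x ?y'" for x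
  proof -
    have "reduced s (Cross j # x) (P @ b # c # a # R)"
      by (rule reduced_Cons_desc[OF l2]) (use ds ord sw that in auto)
    then have 1: "reduced s (Cross (Suc j) # Cross j # x) (P @ b # a # c # R)"
      by (intro reduced_Cons_desc[OF l1]) (use ds ord sw in auto)
    have "reduced s (Cross (Suc j) # x) (P @ c # a # b # R)"
      by (rule reduced_Cons_desc[OF l4]) (use ds ord sw that in auto)
    then have 2: "reduced s (Cross j # Cross (Suc j) # x) (P @ a # c # b # R)"
      by (intro reduced_Cons_desc[OF l3]) (use ds ord sw in auto)
    show ?thesis using 1 2 y sw by simp
  qed
  obtain x where x: "reduced s x ?y'" using ex_reduced[OF l] ..
  have 1: "reduced s ([Cross j, Cross (Suc j), Cross j] @ x) y"
    using reduced_Cons_desc[OF assms(1,2)] red[OF x] by simp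
  have 2: "reduced s ([Cross (Suc j), Cross j, Cross (Suc j)] @ x) y"
    using reduced_Cons_desc[OF assms(1,3)] red[OF x] by simp
  have ly: "length y = Suc (Suc (Suc (j + length R)))" using y P by simp
  have nr: "\<not> (is_red (col s a) \<and> is_red (col s b))" "\<not> (is_red (col s a) \<and> is_red (col s c))"
      "\<not> (is_red (col s b) \<and> is_red (col s c))"
    using red_order[OF assms(1), of j "Suc j"] red_order[OF assms(1), of j "Suc (Suc j)"]
      red_order[OF assms(1), of "Suc j" "Suc (Suc j)"] ord ly unfolding defs(2-4) by (auto simp del: not_red)
  have "lead_eq TYPE('k) N (map (col s) ?y') (map (col s) y) 3
     [Cross j, Cross (Suc j), Cross j] [Cross (Suc j), Cross j, Cross (Suc j)]"
    by (rule braid_lead_eq[OF l reduced_chain[OF 1 x] reduced_chain[OF 2 x]]) (use nr nth P in \<open>auto simp del: not_red\<close>)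
  then show ?thesis unfolding dihedral_def using l red
    by (intro exI[of _ "[Cross (Suc j), Cross j]"] exI[of _ "[Cross j, Cross (Suc j)]"] exI[of _ ?y'])
      (simp add: numeral_3_eq_3)
qed

text \<open>The two descents force both labels to be negative. The longest element of type B2
  negates both; the two chains of four steps from \<open>y\<close> to \<open>?y'\<close> run through
  \<open>l1\<close>, \<open>l2\<close>, \<open>l3\<close> and through \<open>m1\<close>,
  \<open>m2\<close>, \<open>m3\<close>.\<close>

lemma dihedral_nail:
  assumes "legit s y" "desc Nail y" "desc (Cross 0) y"
  shows "dihedral TYPE('k::comm_ring_1) N s y Nail (Cross 0)"
proof -
  obtain a b R where y: "y = a # b # R" using assms(3) by (cases y; cases "tl y") auto
  have ord: "a < 0" "b < a" using assms(2,3) y by auto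
  let ?y' = "- a # - b # R"
  have sw: "swp 0 (u # v # R) = v # u # R" for u v using swp_append[of "[]" u v R] by simp
  note sd = desc_sact(1)
  have l1: "legit s (- a # b # R)" using sd[OF assms(1,2)] y by simp
  have l2: "legit s (b # - a # R)" using sd[OF l1, of "Cross 0"] ord by (simp add: sw)
  have l3: "legit s (- b # - a # R)" using sd[OF l2, of Nail] ord by simp
  have l: "legit s ?y'" using sd[OF l3, of "Cross 0"] ord by (simp add: sw)
  have m1: "legit s (b # a # R)" using sd[OF assms(1,3)] y by (simp add: sw)
  have m2: "legit s (- b # a # R)" using sd[OF m1, of Nail] ord by simp
  have m3: "legit s (a # - b # R)" using sd[OF m2, of "Cross 0"] ord by (simp add: sw)
  have red: "reduced s ([Cross 0, Nail, Cross 0] @ x) (sact Nail y) \<and>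
      reduced s ([Nail, Cross 0, Nail] @ x) (sact (Cross 0) y)" if "reduced s x ?y'" for x
  proof -
    have "reduced s (Cross 0 # x) (- b # - a # R)"
      by (rule reduced_Cons_desc[OF l3]) (use ord that in \<open>auto simp: sw\<close>)
    then have "reduced s (Nail # Cross 0 # x) (b # - a # R)"
      by (intro reduced_Cons_desc[OF l2]) (use ord in auto)
    then have 1: "reduced s (Cross 0 # Nail # Cross 0 # x) (- a # b # R)"
      by (intro reduced_Cons_desc[OF l1]) (use ord in \<open>auto simp: sw\<close>)
    have "reduced s (Nail # x) (a # - b # R)"
      by (rule reduced_Cons_desc[OF m3]) (use ord that in auto)
    then have "reduced s (Cross 0 # Nail # x) (- b # a # R)"
      by (intro reduced_Cons_desc[OF m2]) (use ord in \<open>auto simp: sw\<close>)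
    then have 2: "reduced s (Nail # Cross 0 # Nail # x) (b # a # R)"
      by (intro reduced_Cons_desc[OF m1]) (use ord in auto)
    show ?thesis using 1 2 y by (simp add: sw)
  qed
  obtain x where x: "reduced s x ?y'" using ex_reduced[OF l] ..
  have 1: "reduced s ([Nail, Cross 0, Nail, Cross 0] @ x) y"
    using reduced_Cons_desc[OF assms(1,2)] red[OF x] by simp
  have 2: "reduced s ([Cross 0, Nail, Cross 0, Nail] @ x) y"
    using reduced_Cons_desc[OF assms(1,3)] red[OF x] by simp
  have "col s a = Blk" "col s b = Blk" using assms(1) ord y by (auto simp: legit_def)
  then have "blk (map (col s) ?y') 0" "blk (map (col s) ?y') 1" by (auto simp: blk_def col_def)
  from nail_braid_lead_eq[OF reduced_chain[OF 2 x] reduced_chain[OF 1 x] this]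
  have "lead_eq TYPE('k) N (map (col s) ?y') (map (col s) y) 4 [Cross 0, Nail, Cross 0, Nail] [Nail, Cross 0, Nail, Cross 0]" .
  from lead_eq_sym[OF this] show ?thesis unfolding dihedral_def using l red
    by (intro exI[of _ "[Cross 0, Nail, Cross 0]"] exI[of _ "[Nail, Cross 0, Nail]"] exI[of _ ?y'])
      (simp add: eval_nat_numeral)
qed

lemma dihedral:
  assumes "legit s y" "desc g y" "desc h y" "g \<noteq> h"
  shows "dihedral TYPE('k::comm_ring_1) N s y g h"
proof (cases "supp g \<inter> supp h = {}")
  case True
  then show ?thesis by (rule dihedral_far[OF assms(1-3)])
next
  case False
  note sym = dihedral_sym[OF assms(1) assms(3,2)]
  show ?thesis
  proof (cases g)
    case (Dot j)
    then show ?thesis using assms by simp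
  next
    case g: (Cross j)
    show ?thesis
    proof (cases h)
      case (Dot i)
      then show ?thesis using assms by simp
    next
      case h: (Cross i)
      then consider "i = Suc j" | "j = Suc i" using False g assms(4) by auto
      then show ?thesis
        using dihedral_braid[OF assms(1), of j] dihedral_braid[OF assms(1), of i] sym assms(2,3) g h
        by cases auto
    next
      case Nail
      then have "j = 0" using False g by simp
      then show ?thesis using dihedral_nail[OF assms(1)] sym assms(2,3) g Nail by auto
    qed
  next
    case Nail
    show ?thesis
    proof (cases h)
      case (Cross i)
      then have "i = 0" using False Nail by simp
      then show ?thesis using dihedral_nail[OF assms(1)] assms(2,3) Cross Nail by auto
    qed (use assms Nail in auto)
  qed
qed

text \<open>Tits' argument for Matsumoto's theorem in type B.\<close>
lemma matsumoto:
  fixes N :: "nat list"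
  assumes "reduced s u y" "reduced s v y"
  shows "lead_eq TYPE('k::comm_ring_1) N s (map (col s) y) (length u) u v"
  using assms
proof (induction u arbitrary: v y rule: measure_induct_rule[of length])
  case (less u)
  have len: "length v = length u" using less.prems unfolding reduced_def by simp
  have ly: "legit s y" using reduced_legit less.prems by blast
  show ?case
  proof (cases u)
    case Nil
    then show ?thesis using len by (simp add: lead_eq_refl)
  next
    case u: (Cons g a)
    then obtain h a' where v: "v = h # a'" using len by (cases v) auto
    note gr = reduced_ConsD[OF less.prems(1)[unfolded u]]
    note hr = reduced_ConsD[OF less.prems(2)[unfolded v]]
    note sg = desc_sact[OF ly gr(1)] and sh = desc_sact[OF ly hr(1)]
    have wrap_g: "lead_eq TYPE('k) N s (map (col s) y) (length u) (g # a) (g # x)" if "reduced s x (sact g y)" for x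
    proof -
      have "lead_eq TYPE('k) N s (map (col s) (sact g y)) (length a) a x"
        by (rule less.IH[OF _ gr(2) that]) (simp add: u)
      from lead_eq_wrap[OF this, of s "[]" "[g]" "map (col s) y" "length u"] sg(4,5) u
      show ?thesis by (simp add: cnt_dotfree)
    qed
    have wrap_h: "lead_eq TYPE('k) N s (map (col s) y) (length u) (h # x) (h # a')" if "reduced s x (sact h y)" for x
    proof -
      have lx: "Suc (length x) = length u" using that sh(2) less.prems(1) unfolding reduced_def by simp
      have "lead_eq TYPE('k) N s (map (col s) (sact h y)) (length x) x a'"
        by (rule less.IH[OF _ that hr(2)]) (use lx in simp)
      from lead_eq_wrap[OF this, of s "[]" "[h]" "map (col s) y" "length u"] sh(4,5) lx
      show ?thesis by (simp add: cnt_dotfree)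
    qed
    show ?thesis
    proof (cases "g = h")
      case True
      then show ?thesis using wrap_g[of a'] hr(2) u v by simp
    next
      case False
      \<comment> \<open>Through a reduced word \<open>c\<close> of \<open>y'\<close> one gets
        reduced words \<open>g # p @ c\<close> and \<open>h # q @ c\<close> of \<open>y\<close>.
        They are linked by the dihedral relation, and each shares its first letter with
        \<open>u\<close> or \<open>v\<close>, so the induction hypothesis does the rest.\<close>
      from dihedral[OF ly gr(1) hr(1) False, where ?'k = 'k and N = N] obtain p q y' where d: "legit s y'"
        "\<And>c. reduced s c y' \<Longrightarrow> reduced s (p @ c) (sact g y) \<and> reduced s (q @ c) (sact h y)"
        "lead_eq TYPE('k) N (map (col s) y') (map (col s) y) (Suc (length p)) (g # p) (h # q)"
        unfolding dihedral_def by blast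
      obtain c where c: "reduced s c y'" using ex_reduced[OF d(1)] ..
      have lc: "Suc (length p) + cnt c = length u"
        using d(2)[OF c] c sg(2) less.prems(1) unfolding reduced_def by (simp add: cnt_dotfree)
      have rc: "run s c = Some (map (col s) y')" using c by (simp add: reduced_def)
      have "lead_eq TYPE('k) N s (map (col s) y) (length u) (g # p @ c) (h # q @ c)"
        using lead_eq_wrap[OF d(3) rc, of "[]" "map (col s) y" "length u"] lc by simp
      from lead_eq_trans[OF wrap_g[of "p @ c"] lead_eq_trans[OF this wrap_h[of "q @ c"]]]
      show ?thesis using d(2)[OF c] u v by simp
    qed
  qed
qed

text \<open>At the lowest letter \<open>g\<close> where the length drops, the word below is reduced
  and has the descent \<open>g\<close>. Matsumoto's theorem lets it begin with \<open>g\<close>, and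
  then \<open>square_low\<close> applies.\<close>

lemma nonreduced_low:
  fixes N :: "nat list"
  assumes "run s u = Some t" "\<forall>g\<in>set u. \<not> is_dot g" "blen (arr (length s) u) < length u"
  shows "(word_vec u :: _ \<Rightarrow> 'k::comm_ring_1) \<in> low N s t (length u)"
  using assms
proof (induction u arbitrary: t)
  case (Cons g u)
  from Cons.prems(1) obtain s0 where s0: "run s u = Some s0" "step s0 g = Some t" by (rule run_ConsE)
  define y where "y = arr (length s) u"
  have ly: "legit s y" and s0y: "s0 = map (col s) y" using run_legit[OF s0(1)] by (auto simp: y_def)
  have nd: "\<not> is_dot g" "\<forall>g\<in>set u. \<not> is_dot g" using Cons.prems by auto
  have w: "word_vec (g # u) = wrap [g] [] (word_vec u)" by (simp add: wrap_word_vec)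
  show ?case
  proof (cases "blen y < length u")
    case True
    have "(word_vec u :: _ \<Rightarrow> 'k) \<in> low N s s0 (length u)"
      using Cons.IH[OF s0(1) nd(2)] True by (simp add: y_def)
    from low_wrap[OF this, of s "[]" "[g]" t "length (g # u)"] show ?thesis
      unfolding w using s0(2) nd(1) by (simp add: cnt_dotfree)
  next
    case False
    then have len: "length u = blen y" using blen_arr_le[OF s0(1)] nd(2) by (simp add: y_def cnt_dotfree)
    have ru: "reduced s u y" unfolding reduced_def using s0(1) s0y y_def nd(2) len by simp
    have st: "step (map (col s) y) g = Some t" using s0(2) s0y by simp
    have d: "desc g y"
      using blen_step[OF ly st nd(1)] Cons.prems(3) len y_def by (auto split: if_splits)
    obtain c where c: "reduced s c (sact g y)" using ex_reduced[OF desc_sact(1)[OF ly d]] ..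
    note rgc = reduced_Cons_desc[OF ly d c]
    have lc: "length u = Suc (length c)" using rgc len by (simp add: reduced_def)
    have 1: "lead_eq TYPE('k) N s t (length (g # u)) (g # u) (g # g # c)"
      using lead_eq_wrap[OF matsumoto[OF ru rgc], of s "[]" "[g]" t "length (g # u)"] st nd(1)
      by (simp add: cnt_dotfree)
    have "run (map (col s) (sact g y)) [g, g] = Some t" using desc_sact(4)[OF ly d] st by simp
    from low_wrap[OF square_low[OF this nd(1)], of s c "[]" t "length (g # u)"] 
    have "(word_vec (g # g # c) :: _ \<Rightarrow> 'k) \<in> low N s t (length (g # u))"
      using c lc by (simp add: wrap_word_vec reduced_def cnt_dotfree)
    with 1 show ?thesis by (rule lead_eq_low)
  qed
qed simp

section \<open>Basis words are reduced\<close>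

lemma sw_less: "Suc i < n \<Longrightarrow> p < n \<Longrightarrow> sw i p < n"
  by (auto simp: sw_def)

lemma sw_sw_apply [simp]: "sw i (sw i p) = p"
  by (auto simp: sw_def)

lemma perm_of_less: "\<forall>i\<in>set u. Suc i < n \<Longrightarrow> p < n \<Longrightarrow> perm_of u p < n"
  by (induction u) (auto intro: sw_less)

lemma perm_of_ge: "\<forall>i\<in>set u. Suc i < n \<Longrightarrow> n \<le> p \<Longrightarrow> perm_of u p = p"
  by (induction u) (auto simp: sw_def)

lemma perm_of_rev [simp]: "perm_of u (perm_of (rev u) p) = p"
  by (induction u arbitrary: p) (simp_all add: perm_of_append)

lemma perm_of_rev' [simp]: "perm_of (rev u) (perm_of u p) = p"
  using perm_of_rev[of "rev u"] by simp

lemma length_arr [simp]: "length (arr n u) = n"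
proof (induction u)
  case (Cons g u)
  then show ?case by (cases g) auto
qed simp

lemma arr_cross_nth:
  assumes "\<forall>i\<in>set u. Suc i < n" "p < n"
  shows "arr n (map Cross u) ! perm_of u p = int (Suc p)"
  using assms
proof (induction u)
  case (Cons i u)
  let ?y = "arr n (map Cross u)"
  have "perm_of u p < n" using Cons.prems by (intro perm_of_less) auto
  then have "swp i ?y ! sw i (perm_of u p) = ?y ! perm_of u p"
    using Cons.prems by (auto simp: nth_swp sw_def)
  then show ?case using Cons by simp
qed (simp add: base_nth)

lemma arr_cross_positive:
  assumes "\<forall>i\<in>set u. Suc i < n" "a \<in> set (arr n (map Cross u))"
  shows "0 < a"
proof -
  obtain k where k: "k < n" "arr n (map Cross u) ! k = a" using assms(2) by (auto simp: in_set_conv_nth)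
  have "perm_of (rev u) k < n" using assms(1) k by (intro perm_of_less) auto
  from arr_cross_nth[OF assms(1) this] k show ?thesis by simp
qed

lemma reduced_positive:
  assumes "reduced s u y" "\<forall>a\<in>set y. 0 < a"
  shows "\<exists>js. u = map Cross js \<and> (\<forall>j\<in>set js. Suc j < length s)"
  using assms
proof (induction u arbitrary: y)
  case (Cons g u)
  note r = reduced_ConsD[OF Cons.prems(1)]
  have ly: "length y = length s" using legit_length reduced_legit Cons.prems(1) by blast
  have "g \<noteq> Nail" using r(1) Cons.prems(2) by (cases y) auto
  then obtain j where g: "g = Cross j" using r(1) by (cases g) auto
  have j: "Suc j < length y" using r(1) g by simp
  have "\<forall>a\<in>set (sact g y). 0 < a" using Cons.prems(2) g j by (simp add: set_swp)
  from Cons.IH[OF r(2) this] obtain js where "u = map Cross js" "\<forall>j\<in>set js. Suc j < length s" by blast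
  then show ?case using g j ly by (intro exI[of _ "j # js"]) simp
qed simp

lemma run_cross_black:
  assumes "\<forall>i\<in>set u. Suc i < n"
  shows "run (replicate n Blk) (map Cross u) = Some (replicate n Blk)"
  using assms
proof (induction u)
  case (Cons i u)
  have "swp i (replicate n Blk) = replicate n Blk"
    using Cons.prems by (intro nth_equalityI) (auto simp: nth_swp)
  then show ?case using Cons by simp
qed simp

lemma col_replicate: "legit (replicate n Blk) y \<Longrightarrow> map (col (replicate n Blk)) y = replicate n Blk"
proof -
  assume l: "legit (replicate n Blk) y"
  have "col (replicate n Blk) q = Blk" if "q \<in> set y" for q
  proof -
    have "\<bar>q\<bar> \<in> set (base n)" using l that unfolding legit_def by auto
    then have "nat \<bar>q\<bar> - 1 < n" by (auto simp: set_base)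
    then show ?thesis by (simp add: col_def)
  qed
  then show ?thesis using legit_length[OF l] by (intro nth_equalityI) auto
qed

text \<open>Links minimality among words of transpositions to \<open>blen\<close>. The all-black
  colouring allows every crossing, and a reduced word of a positive arrangement contains no nail, so
  it competes with \<open>is\<close> in the definition of \<open>reduced_expr\<close>.\<close>

lemma reduced_expr_reduced:
  assumes "reduced_expr n w is"
  shows "reduced (replicate n Blk) (map Cross is) (arr n (map Cross is))"
proof -
  let ?s = "replicate n Blk" and ?y = "arr n (map Cross is)"
  have bd: "\<forall>i\<in>set is. Suc i < n" and w: "perm_of is = w" using assms by (auto simp: reduced_expr_def)
  have run: "run ?s (map Cross is) = Some ?s" by (rule run_cross_black[OF bd])
  have leg: "legit ?s ?y" using run_legit[OF run] by simp
  obtain u where u: "reduced ?s u ?y" using ex_reduced[OF leg] ..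
  obtain js where js: "u = map Cross js" "\<forall>j\<in>set js. Suc j < n"
    using reduced_positive[OF u] arr_cross_positive[OF bd] by auto
  have "arr n (map Cross js) = ?y" using u js by (simp add: reduced_def)
  have "perm_of js p = perm_of is p" for p
  proof (cases "p < n")
    case True
    let ?a = "perm_of js p" and ?c = "perm_of is p"
    have "?y ! ?a = ?y ! ?c"
      using arr_cross_nth[OF js(2) True] arr_cross_nth[OF bd True] \<open>arr n (map Cross js) = ?y\<close> by simp
    moreover have "?a < n" "?c < n" using perm_of_less js bd True by auto
    ultimately show ?thesis using legit_distinct[OF leg] by (simp add: nth_eq_iff_index_eq)
  next
    case False
    then show ?thesis using perm_of_ge[of _ n] js bd by simp
  qed
  then have "perm_of js = w" using w by auto
  then have "length is \<le> length js" using reduced_exprD[OF assms _ js(2)] by blast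
  moreover have "length js = blen ?y" using u js by (simp add: reduced_def)
  moreover have "blen ?y \<le> length is"
    using blen_arr_le[OF run] by (simp add: cnt_def)
  ultimately show ?thesis unfolding reduced_def using run col_replicate[OF leg] by simp
qed

lemma reduced_suffix:
  assumes "reduced s (u @ v) y"
  shows "reduced s v (arr (length s) v)"
  using assms
proof (induction u arbitrary: y)
  case Nil
  then show ?case by (simp add: reduced_def)
next
  case (Cons g u)
  then show ?case using reduced_ConsD[of s g "u @ v" y] by simp
qed

lemma reduced_Cons_asc:
  assumes "reduced s u y" "step (map (col s) y) g = Some t" "\<not> desc g y" "\<not> is_dot g"
  shows "reduced s (g # u) (sact g y)"
proof -
  have l: "legit s y" using reduced_legit assms(1) .
  have "blen (sact g y) = Suc (blen y)" using blen_step[OF l assms(2,4)] assms(3) by simp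
  then show ?thesis using assms legit_step[OF l assms(2)] unfolding reduced_def by simp
qed

lemma reduced_Cross:
  assumes "reduced s u y" "Suc j < length y" "y ! j < y ! Suc j"
    "\<not> (is_red (col s (y ! j)) \<and> is_red (col s (y ! Suc j)))"
  shows "reduced s (Cross j # u) (swp j y)"
  using reduced_Cons_asc[OF assms(1), of "Cross j"] assms(2-4) by simp

lemma nail_piece_Suc: "nail_piece (Suc m) = Cross m # nail_piece m @ [Cross m]"
  by (simp add: nail_piece_def)

text \<open>The label at \<open>m\<close> exceeds all labels on its left in absolute value, so each
  crossing on the way left, the nail, and each crossing on the way back lengthen the arrangement.
  The induction strips the outermost pair of crossings.\<close>

lemma reduced_nail_piece:
  assumes "reduced s u y" "m < length y" "0 < y ! m" "col s (y ! m) = Blk" "\<forall>i<m. \<bar>y ! i\<bar> < y ! m"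
  shows "reduced s (nail_piece m @ u) (y[m := - (y ! m)])"
  using assms
proof (induction m arbitrary: u y)
  case 0
  then have "reduced s (Nail # u) (sact Nail y)" by (intro reduced_Cons_asc) auto
  then show ?case by (simp add: nail_piece_def)
next
  case (Suc m)
  let ?a = "y ! Suc m" and ?c = "y ! m"
  have c: "\<bar>?c\<bar> < ?a" using Suc.prems(5) by simp
  have nr: "\<not> is_red (col s ?a)" using Suc.prems(4) by simp
  have 1: "reduced s (Cross m # u) (swp m y)"
    using Suc.prems c nr by (intro reduced_Cross) auto
  have n1: "swp m y ! m = ?a" "swp m y ! Suc m = ?c" "\<And>i. i < m \<Longrightarrow> swp m y ! i = y ! i"
    using Suc.prems(2) by (auto simp: nth_swp)
  have 2: "reduced s (nail_piece m @ Cross m # u) ((swp m y)[m := - ?a])"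
    using Suc.IH[OF 1] Suc.prems n1 by simp
  have n2: "(swp m y)[m := - ?a] ! m = - ?a" "(swp m y)[m := - ?a] ! Suc m = ?c"
    using Suc.prems(2) n1 by auto
  have "col s (- ?a) = Blk" using Suc.prems(4) by (simp add: col_def)
  then have "reduced s (Cross m # nail_piece m @ Cross m # u) (swp m ((swp m y)[m := - ?a]))"
    using 2 Suc.prems(2) n2 c by (intro reduced_Cross) auto
  moreover have "swp m ((swp m y)[m := - ?a]) = y[Suc m := - ?a]"
    using Suc.prems(2) by (intro nth_equalityI) (auto simp: nth_swp nth_list_update)
  ultimately show ?case by (simp add: nail_piece_Suc)
qed

lemma col_label: "\<bar>q\<bar> = int (Suc p) \<Longrightarrow> col s q = s ! p"
  unfolding col_def by (metis diff_Suc_1 nat_int)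

section \<open>Trajectories of strands in a left-adjusted word\<close>

locale left_adjusted_word =
  fixes n :: nat and w :: "nat \<Rightarrow> nat" and "is" :: "nat list"
  assumes la: "left_adjusted n w is"
begin

abbreviation "k \<equiv> length is"
abbreviation "pos \<equiv> lvlpos is"
abbreviation "foot q \<equiv> lvlpos is q (length is)"

lemma red: "reduced_expr n w is"
  using la by (simp add: left_adjusted_def)

lemma letters: "\<forall>i\<in>set is. Suc i < n" and perm: "perm_of is = w"
  using red by (auto simp: reduced_expr_def)

lemma letters_nth: "t < k \<Longrightarrow> Suc (is ! t) < n"
  using letters by simp

lemma pos_less: "q < n \<Longrightarrow> pos q t < n"
  unfolding lvlpos_def by (rule perm_of_less) (use letters in \<open>auto dest: in_set_takeD\<close>)

lemma pos_inj: "pos q t = pos q' t \<longleftrightarrow> q = q'"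
  unfolding lvlpos_def by (metis perm_of_rev)

lemma pos_surj:
  assumes "j < n" obtains q where "q < n" "pos q t = j"
proof
  show "perm_of (take t is) j < n"
    by (rule perm_of_less) (use letters assms in \<open>auto dest: in_set_takeD\<close>)
qed (simp add: lvlpos_def)

lemma pos_Suc: "t < k \<Longrightarrow> pos q (Suc t) = sw (is ! t) (pos q t)"
  by (rule lvlpos_Suc)

lemma pos_Suc': "t < k \<Longrightarrow> pos q t = sw (is ! t) (pos q (Suc t))"
  by (simp add: pos_Suc)

lemma w_bot: "w (foot q) = q"
  by (simp add: lvlpos_def perm[symmetric])

lemma pos_bot: "perm_of (drop t is) (foot q) = pos q t"
proof -
  have "rev is = rev (drop t is) @ rev (take t is)" by (metis append_take_drop_id rev_append)
  then have "foot q = perm_of (rev (drop t is)) (pos q t)"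
    unfolding lvlpos_def by (simp add: perm_of_append)
  then show ?thesis by simp
qed

text \<open>The suffix starting with crossing \<open>t\<close> is reduced, so its top letter is a
  descent. Labels are bottom positions plus one, hence the two strands arrive at the crossing in the
  order of their feet.\<close>

lemma crossing_bot:
  assumes "t < k" "q < n" "q' < n" "pos q (Suc t) = is ! t" "pos q' (Suc t) = Suc (is ! t)"
  shows "foot q < foot q'"
proof -
  let ?u = "map Cross (drop (Suc t) is)"
  let ?y = "arr n ?u"
  have "map Cross is = map Cross (take t is) @ Cross (is ! t) # ?u"
    using assms(1) by (metis Cons_nth_drop_Suc append_take_drop_id list.simps(9) map_append)
  then have r: "reduced (replicate n Blk) (Cross (is ! t) # ?u) (arr n (Cross (is ! t) # ?u))"
    using reduced_suffix[of "replicate n Blk" "map Cross (take t is)" "Cross (is ! t) # ?u"]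
      reduced_expr_reduced[OF red] by simp
  from reduced_ConsD(1)[OF r] have "swp (is ! t) ?y ! Suc (is ! t) < swp (is ! t) ?y ! (is ! t)" by simp
  then have lt: "?y ! (is ! t) < ?y ! Suc (is ! t)" using letters_nth[OF assms(1)] by (simp add: nth_swp)
  have d: "\<forall>i\<in>set (drop (Suc t) is). Suc i < n" using letters by (auto dest: in_set_dropD)
  have "?y ! pos p (Suc t) = int (Suc (foot p))" if "p < n" for p
    using arr_cross_nth[OF d pos_less[OF that, of k]] pos_bot[of "Suc t" p] by simp
  from this[OF assms(2)] this[OF assms(3)] lt assms(4,5) show ?thesis by simp
qed

text \<open>Above the crossing the new order persists: a second crossing of the same two strands
  would contradict \<open>crossing_bot\<close>.\<close>

lemma crossing_top:
  assumes "t < k" "q < n" "q' < n" "pos q (Suc t) = is ! t" "pos q' (Suc t) = Suc (is ! t)"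
  shows "q' < q"
proof -
  have b: "foot q < foot q'" by (rule crossing_bot[OF assms])
  have "pos q' i < pos q i" if "i \<le> t" for i
    using that
  proof (induction i rule: inc_induct)
    case base
    then show ?case using pos_Suc'[OF assms(1)] assms(4,5) by (simp add: sw_def)
  next
    case (step i)
    then have i: "i < k" using assms(1) by simp
    have p: "pos q i = sw (is ! i) (pos q (Suc i))" "pos q' i = sw (is ! i) (pos q' (Suc i))"
      using pos_Suc'[OF i] by auto
    have "\<not> (pos q' (Suc i) = is ! i \<and> pos q (Suc i) = Suc (is ! i))"
      using crossing_bot[OF i assms(3,2)] b by auto
    then show ?case using step.IH unfolding p by (auto simp: sw_def)
  qed
  from this[of 0] show ?thesis by simp
qed

lemma leftmost_le: "t \<le> k \<Longrightarrow> leftmost is q \<le> pos q t"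
  unfolding leftmost_def by (intro Min_le) auto

lemma leftlvl: "leftlvl is q \<le> k" "pos q (leftlvl is q) = leftmost is q"
proof -
  have "leftmost is q \<in> pos q ` {0..k}" unfolding leftmost_def by (rule Min_in) auto
  then obtain t where "t \<le> k \<and> pos q t = leftmost is q" by auto
  then have "leftlvl is q \<le> k \<and> pos q (leftlvl is q) = leftmost is q"
    unfolding leftlvl_def by (rule LeastI)
  then show "leftlvl is q \<le> k" "pos q (leftlvl is q) = leftmost is q" by auto
qed

text \<open>If the strand has moved right since its leftmost level,
  \<open>left_adjusted_valley\<close> applies; otherwise it still sits at its minimum at
  \<open>t1\<close>.\<close>

lemma rightward_below_leftlvl:
  assumes "leftlvl is q \<le> t1" "t1 \<le> t2" "t2 \<le> k"
  shows "pos q t1 \<le> pos q t2"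
proof (cases "\<exists>t. leftlvl is q \<le> t \<and> t < t1 \<and> pos q (Suc t) > pos q t")
  case True
  then obtain t where t: "leftlvl is q \<le> t" "t < t1" "pos q (Suc t) > pos q t" by blast
  have "t < k" using t assms by simp
  then have "pos q (Suc t) = Suc (pos q t)" using t(3) pos_Suc[of t q] by (auto simp: sw_def split: if_splits)
  from left_adjusted_valley[OF la \<open>t < k\<close> this] t assms show ?thesis by simp
next
  case False
  have "pos q i \<le> leftmost is q" if "leftlvl is q \<le> i" "i \<le> t1" for i
    using that
  proof (induction i rule: dec_induct)
    case base
    then show ?case using leftlvl by simp
  next
    case (step i)
    then have "\<not> pos q (Suc i) > pos q i" using False by auto
    then show ?case using step by simp
  qed
  from this[of t1] assms leftmost_le[OF assms(3), of q] show ?thesis by simp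
qed

text \<open>To get past \<open>q\<close>, the strand \<open>p\<close> would have to push it left,
  which is impossible below the leftmost level of \<open>q\<close>. This yields the bound on labels
  that \<open>reduced_nail_piece\<close> asks for.\<close>

lemma left_of_leftmost:
  assumes "pos p (leftlvl is q) < pos q (leftlvl is q)"
  shows "foot p < foot q"
proof -
  have "pos p t < pos q t" if "leftlvl is q \<le> t" "t \<le> k" for t
    using that
  proof (induction t rule: dec_induct)
    case base
    show ?case by (rule assms)
  next
    case (step t)
    then have t: "t < k" by simp
    have "pos q t \<le> pos q (Suc t)" using rightward_below_leftlvl[of q t "Suc t"] step by simp
    then show ?case using step pos_Suc[OF t, of p] pos_Suc[OF t, of q] by (auto simp: sw_def split: if_splits)
  qed
  then show ?thesis using leftlvl by simp
qed

text \<open>Were the minimum first attained below a right move, the strand would have to come back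
  to the left after that move.\<close>

lemma leftlvl_rightward:
  assumes "t < k" "pos q (Suc t) = Suc (pos q t)"
  shows "leftlvl is q \<le> t"
proof (rule ccontr)
  assume "\<not> ?thesis"
  then have "pos q (Suc t) \<le> pos q (leftlvl is q)"
    using left_adjusted_valley[OF la assms, of "Suc t" "leftlvl is q"] leftlvl(1)[of q] by simp
  then show False using leftlvl(2)[of q] leftmost_le[of t q] assms by simp
qed

text \<open>The invariant for reading a basis word from the bottom: \<open>u\<close> is the part
  read so far, ending at level \<open>t\<close>, and \<open>F\<close> is the set of strands nailed
  in it.\<close>

definition signed_labels :: "color list \<Rightarrow> nat set \<Rightarrow> nat \<Rightarrow> gen list \<Rightarrow> bool" where
  "signed_labels s F t u \<longleftrightarrow> (\<exists>y. reduced s u y \<and>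
     (\<forall>q<n. y ! pos q t = (if q \<in> F then - int (Suc (foot q)) else int (Suc (foot q)))))"

text \<open>The strand moving right on the way down has its leftmost level at or above the crossing,
  so it is not nailed yet. Its positive label exceeds the absolute value of the other one, and the
  crossing lengthens the arrangement whether or not the other strand is nailed.\<close>

lemma signed_labels_Cross:
  assumes "signed_labels s F (Suc t) u" "length s = n" "t < k" "\<forall>q\<in>F. t < leftlvl is q"
    and reds: "\<And>p p'. p < p' \<Longrightarrow> p' < n \<Longrightarrow> is_red (s ! p) \<Longrightarrow> is_red (s ! p') \<Longrightarrow> w p < w p'"
  shows "signed_labels s F t (Cross (is ! t) # u)"
proof -
  from assms(1) obtain y where y: "reduced s u y"
    "\<And>q. q < n \<Longrightarrow> y ! pos q (Suc t) = (if q \<in> F then - int (Suc (foot q)) else int (Suc (foot q)))"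
    unfolding signed_labels_def by blast
  have ly: "length y = n" using legit_length reduced_legit y(1) assms(2) by blast
  let ?j = "is ! t"
  have j: "Suc ?j < n" by (rule letters_nth[OF assms(3)])
  obtain q where q: "q < n" "pos q (Suc t) = ?j" using j by (metis pos_surj Suc_lessD)
  obtain q' where q': "q' < n" "pos q' (Suc t) = Suc ?j" using j by (metis pos_surj)
  have b: "foot q < foot q'" by (rule crossing_bot[OF assms(3) q(1) q'(1) q(2) q'(2)])
  have tp: "q' < q" by (rule crossing_top[OF assms(3) q(1) q'(1) q(2) q'(2)])
  have "pos q' t = ?j" using pos_Suc'[OF assms(3), of q'] q' by (simp add: sw_def)
  then have "leftlvl is q' \<le> t" using leftlvl_rightward[OF assms(3), of q'] q' by simp
  then have "q' \<notin> F" using assms(4) by auto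
  then have y': "y ! Suc ?j = int (Suc (foot q'))" and yq: "\<bar>y ! ?j\<bar> = int (Suc (foot q))"
    using y(2)[OF q(1)] y(2)[OF q'(1)] q q' by auto
  have "\<not> (is_red (col s (y ! ?j)) \<and> is_red (col s (y ! Suc ?j)))"
  proof
    assume "is_red (col s (y ! ?j)) \<and> is_red (col s (y ! Suc ?j))"
    then have "is_red (s ! foot q)" "is_red (s ! foot q')" 
      using col_label[of "y ! ?j" "foot q" s] col_label[of "y ! Suc ?j" "foot q'" s] y' yq by simp_all
    from reds[OF b pos_less[OF q'(1)] this] tp show False by (simp add: w_bot)
  qed
  then have r: "reduced s (Cross ?j # u) (swp ?j y)"
    using y(1) ly j y' yq b by (intro reduced_Cross) auto
  have "swp ?j y ! pos p t = y ! pos p (Suc t)" if "p < n" for p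
    using pos_less[OF that, of t] ly j pos_Suc[OF assms(3), of p] by (auto simp: nth_swp sw_def)
  then show ?thesis unfolding signed_labels_def using r y(2) by auto
qed

lemma signed_labels_nail:
  assumes "signed_labels s F t u" "length s = n" "q < n" "q \<notin> F" "leftlvl is q = t" "s ! foot q = Blk"
  shows "signed_labels s (insert q F) t (nail_piece (leftmost is q) @ u)"
proof -
  from assms(1) obtain y where y: "reduced s u y"
    "\<And>q. q < n \<Longrightarrow> y ! pos q t = (if q \<in> F then - int (Suc (foot q)) else int (Suc (foot q)))"
    unfolding signed_labels_def by blast
  have ly: "length y = n" using legit_length reduced_legit y(1) assms(2) by blast
  let ?m = "pos q t"
  have m: "?m = leftmost is q" using leftlvl(2)[of q] assms(5) by simp
  have ym: "y ! ?m = int (Suc (foot q))" using y(2)[OF assms(3)] assms(4) by simp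
  have "\<bar>y ! i\<bar> < y ! ?m" if i: "i < ?m" for i
  proof -
    obtain p where p: "p < n" "pos p t = i" 
      using i pos_less[OF assms(3), of t] by (metis pos_surj less_trans)
    then have "foot p < foot q" using left_of_leftmost[of p q] i assms(5) by simp
    then show ?thesis using y(2)[OF p(1)] p ym by auto
  qed
  then have "reduced s (nail_piece ?m @ u) (y[?m := - (y ! ?m)])"
    using y(1) ly pos_less[OF assms(3)] ym assms(6) col_label[of "y ! ?m" "foot q" s]
    by (intro reduced_nail_piece) auto
  moreover have "y[?m := - (y ! ?m)] ! pos p t = (if p \<in> insert q F then - int (Suc (foot p)) else int (Suc (foot p)))"
    if "p < n" for p
    using y(2)[OF that] ym pos_less[OF assms(3), of t] ly by (auto simp: nth_list_update pos_inj)
  ultimately show ?thesis unfolding signed_labels_def m by blast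
qed

text \<open>Several strands may be nailed at one level. A nail piece changes only one sign, so the
  bounds on absolute values persist for the others.\<close>

lemma signed_labels_nails:
  assumes "signed_labels s F t u" "length s = n" "distinct qs" "set qs \<inter> F = {}"
    "\<forall>q\<in>set qs. q < n \<and> leftlvl is q = t \<and> s ! foot q = Blk"
  shows "signed_labels s (set qs \<union> F) t (concat (map (\<lambda>q. nail_piece (leftmost is q)) qs) @ u)"
  using assms(3-5)
proof (induction qs)
  case Nil
  then show ?case using assms(1) by simp
next
  case (Cons q qs)
  then show ?case using signed_labels_nail[of s "set qs \<union> F" t _ q] assms(2) by auto
qed

text \<open>Level numbers grow downwards and the nails of level \<open>t\<close> lie just above
  crossing \<open>t\<close>. Hence the strands nailed by the time level \<open>t\<close> is finished
  are those with \<open>t \<le> leftlvl is q\<close>.\<close>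

lemma signed_labels_word:
  fixes s :: "color list" and qs :: "nat list" and nailed :: "nat \<Rightarrow> bool"
  defines "P \<equiv> \<lambda>t. concat (map (\<lambda>q. if nailed q \<and> leftlvl is q = t then nail_piece (leftmost is q) else []) qs)"
  assumes "length s = n" "distinct qs" "\<forall>q\<in>set qs. q < n \<and> s ! foot q = Blk"
    and reds: "\<And>p p'. p < p' \<Longrightarrow> p' < n \<Longrightarrow> is_red (s ! p) \<Longrightarrow> is_red (s ! p') \<Longrightarrow> w p < w p'"
    and "t \<le> k"
  shows "signed_labels s {q \<in> set qs. nailed q \<and> t \<le> leftlvl is q} t
    (concat (map (\<lambda>t. P t @ (if t < k then [Cross (is ! t)] else [])) [t..<Suc k]))"
proof -
  let ?F = "\<lambda>t. {q \<in> set qs. nailed q \<and> t \<le> leftlvl is q}"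
  let ?qs = "\<lambda>t. filter (\<lambda>q. nailed q \<and> leftlvl is q = t) qs"
  have P: "P t = concat (map (\<lambda>q. nail_piece (leftmost is q)) (?qs t))" for t
    unfolding P_def by (induction qs) auto
  have nails: "signed_labels s (?F t) t (P t @ u)" if "signed_labels s (?F (Suc t)) t u" for t u
  proof -
    have "?F t = set (?qs t) \<union> ?F (Suc t)" by auto
    moreover have "signed_labels s (set (?qs t) \<union> ?F (Suc t)) t (P t @ u)"
      unfolding P by (rule signed_labels_nails[OF that assms(2)]) (use assms(3,4) in auto)
    ultimately show ?thesis by simp
  qed
  show ?thesis using assms(6)
  proof (induction t rule: inc_induct)
    case base
    have "\<not> Suc k \<le> leftlvl is q" for q using leftlvl(1)[of q] by simp
    then have "?F (Suc k) = {}" by simp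
    have "reduced s [] (base n)" using assms(2) by (auto simp: reduced_def map_col_base[of s, unfolded assms(2)])
    moreover have "base n ! pos q k = int (Suc (foot q))" if "q < n" for q
      using pos_less[OF that] by (rule base_nth)
    ultimately have "signed_labels s (?F (Suc k)) k []"
      unfolding signed_labels_def \<open>?F (Suc k) = {}\<close> by auto
    from nails[OF this] show ?case by simp
  next
    case (step t)
    let ?W = "concat (map (\<lambda>t. P t @ (if t < k then [Cross (is ! t)] else [])) [Suc t..<Suc k])"
    have "signed_labels s (?F (Suc t)) t (Cross (is ! t) # ?W)"
      by (rule signed_labels_Cross[OF step.IH assms(2) step.hyps(2) _ reds]) auto
    from nails[OF this] step.hyps show ?case by (simp add: upt_conv_Cons del: upt_Suc)
  qed
qed

end

section \<open>The polynomial representation\<close>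

text \<open>The Koszul sign for inserting the exterior generator of \<open>a\<close> into the
  product of those of the nailed strands, sorted by bottom label. It does not depend on the order of
  the strands from left to right.\<close>

definition nail_sign :: "int \<Rightarrow> int list \<Rightarrow> 'r::comm_ring_1" where
  "nail_sign a r = (\<Prod>c\<leftarrow>r. if c < 0 \<and> \<bar>c\<bar> < \<bar>a\<bar> then -1 else 1)"

lemma nail_sign_Cons: "nail_sign a (c # r) = (if c < 0 \<and> \<bar>c\<bar> < \<bar>a\<bar> then -1 else 1) * nail_sign a r"
  by (simp add: nail_sign_def)

lemma nail_sign_swp: "Suc j < length r \<Longrightarrow> nail_sign a (swp j r) = nail_sign a r"
  by (elim split_at_pair) (auto simp: nail_sign_def)

lemma nail_sign_unit: "nail_sign a r dvd 1"
  by (induction r) (auto simp: nail_sign_def)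

lemma swp_Suc_Cons: "swp (Suc j) (a # r) = a # swp j r"
  by (simp add: swp_def)

lemma swp_commute: "Suc i < j \<Longrightarrow> Suc j < length y \<Longrightarrow> swp i (swp j y) = swp j (swp i y)"
  by (intro nth_equalityI) (auto simp: nth_swp)

text \<open>The polynomial representation in localized form: a vector assigns a coefficient to every
  arrangement of the signed labels. Black crossings are Demazure operators, a black strand passing to the left
  over a red one picks up its power, and a nail multiplies by the exterior generator of the strand.\<close>
locale localized_rep =
  fixes N :: "nat list" and s :: "color list" and h :: "'k::comm_ring_1 \<Rightarrow> 'r::comm_ring_1"
    and z :: "nat \<Rightarrow> 'r" and d :: "nat \<Rightarrow> nat \<Rightarrow> 'r"
  assumes h_0: "h 0 = 0" and h_1: "h 1 = 1" and h_add: "h (a + b) = h a + h b" and h_mult: "h (a * b) = h a * h b"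
    and d: "p \<noteq> q \<Longrightarrow> (z p - z q) * d p q = 1" and z_unit: "z p dvd 1"
begin

abbreviation "Z q \<equiv> z (nat \<bar>q :: int\<bar>)"
abbreviation "D a c \<equiv> d (nat \<bar>a :: int\<bar>) (nat \<bar>c :: int\<bar>)"

lemma h_minus_1: "h (-1) = -1"
proof -
  have "h (-1) + h 1 = h 0" unfolding h_add[symmetric] by simp
  then show ?thesis by (simp add: h_0 h_1 eq_neg_iff_add_eq_0)
qed

lemma D: "\<bar>a\<bar> \<noteq> \<bar>c\<bar> \<Longrightarrow> (Z a - Z c) * D a c = 1"
  using d[of "nat \<bar>a\<bar>" "nat \<bar>c\<bar>"] by (simp add: nat_eq_iff)

lemma D_swap:
  assumes "\<bar>a\<bar> \<noteq> \<bar>c\<bar>" shows "D c a = - D a c"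
proof -
  have 1: "(Z a - Z c) * D a c = 1" "(Z c - Z a) * D c a = 1" using D assms by auto
  have "D c a = D c a * ((Z a - Z c) * D a c)" using 1 by simp
  also have "\<dots> = - ((Z c - Z a) * D c a) * D a c" by (simp add: algebra_simps)
  finally show ?thesis using 1 by simp
qed

text \<open>Partial fractions, from \<open>Z a - Z c\<close> as the sum of \<open>Z a - Z b\<close>
  and \<open>Z b - Z c\<close>. This identity is what makes Demazure operators satisfy the braid
  relation.\<close>

lemma D_Arnold:
  assumes "\<bar>a\<bar> \<noteq> \<bar>b\<bar>" "\<bar>b\<bar> \<noteq> \<bar>c\<bar>" "\<bar>a\<bar> \<noteq> \<bar>c\<bar>"
  shows "D a b * D b c - D a c * D a b - D a c * D b c = 0"
proof -
  have 1: "(Z a - Z b) * D a b = 1" "(Z b - Z c) * D b c = 1" "(Z a - Z c) * D a c = 1" using D assms by auto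
  have "D a b * D b c = D a b * D b c * ((Z a - Z c) * D a c)" using 1 by simp
  also have "\<dots> = ((Z a - Z b) * D a b) * D b c * D a c + ((Z b - Z c) * D b c) * D a b * D a c"
    by (simp add: algebra_simps)
  finally show ?thesis unfolding 1 by (simp add: algebra_simps)
qed

text \<open>The value at \<open>y\<close> collects the contributions of the arrangements from which
  \<open>y\<close> is reached. A red crossing has a factor in one direction only, so that a double
  crossing gives exactly \<open>N ! i\<close> dots.\<close>

fun act :: "gen \<Rightarrow> (int list \<Rightarrow> 'r) \<Rightarrow> int list \<Rightarrow> 'r" where
  "act (Dot j) V y = Z (y ! j) * V y"
| "act (Cross j) V y = (case col s (y ! j) of
      Blk \<Rightarrow> (case col s (y ! Suc j) of Blk \<Rightarrow> D (y ! j) (y ! Suc j) * (V y + V (swp j y))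
                                  | Rd i \<Rightarrow> Z (y ! j) ^ (N ! i) * V (swp j y))
    | Rd i \<Rightarrow> (case col s (y ! Suc j) of Blk \<Rightarrow> V (swp j y) | Rd _ \<Rightarrow> 0))"
| "act Nail V y = (if y ! 0 < 0 then nail_sign (y ! 0) (tl y) * V (y[0 := - (y ! 0)]) else 0)"

definition acts :: "gen list \<Rightarrow> (int list \<Rightarrow> 'r) \<Rightarrow> int list \<Rightarrow> 'r" where
  "acts u V = foldr act u V"

lemma acts_simps [simp]: "acts [] V = V" "acts (g # u) V = act g (acts u V)"
  by (simp_all add: acts_def)

lemma acts_append: "acts (u @ v) V = acts u (acts v V)"
  by (simp add: acts_def)

lemma act_add: "act g (\<lambda>y. V y + W y) = (\<lambda>y. act g V y + act g W y)"
  by (rule ext, cases g) (auto simp: algebra_simps split: color.split)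

lemma act_scale: "act g (\<lambda>y. c * V y) = (\<lambda>y. c * act g V y)"
  by (rule ext, cases g) (auto simp: algebra_simps split: color.split)

lemma acts_add: "acts u (\<lambda>y. V y + W y) = (\<lambda>y. acts u V y + acts u W y)"
  by (induction u) (simp_all add: act_add)

lemma acts_scale: "acts u (\<lambda>y. c * V y) = (\<lambda>y. c * acts u V y)"
  by (induction u) (simp_all add: act_scale)

lemma acts_sum: "acts u (\<lambda>y. \<Sum>p\<leftarrow>xs. c p * F p y) = (\<lambda>y. \<Sum>p\<leftarrow>xs. c p * acts u (F p) y)"
proof (induction xs)
  case Nil
  then show ?case using acts_scale[of u 0 "\<lambda>_. 0"] by simp
qed (simp add: acts_add acts_scale)

definition over :: "color list \<Rightarrow> int list \<Rightarrow> bool" where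
  "over t y \<longleftrightarrow> map (col s) y = t \<and> distinct (map abs y)"

lemma over_swp:
  assumes "over t y" "Suc j < length t"
  shows "over (swp j t) (swp j y)"
proof -
  have "length y = length t" using assms(1) by (auto simp: over_def)
  then show ?thesis using assms unfolding over_def by (auto simp: map_swp distinct_swp)
qed

lemma over_neg: "over t y \<Longrightarrow> over t (y[0 := - (y ! 0)])"
  by (cases y) (auto simp: over_def col_def)

text \<open>Values over \<open>t\<close> depend only on values over \<open>t0\<close>. Hence a
  relation that acts by zero over its own colour sequence still does so after multiplication from
  above.\<close>

lemma act_cong:
  assumes "step t0 g = Some t" "\<And>y. over t0 y \<Longrightarrow> V y = W y" "over t y"
  shows "act g V y = act g W y"
proof (cases g)
  case (Dot j)
  then show ?thesis using assms by (auto split: if_splits)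
next
  case (Cross j)
  then have j: "Suc j < length t0" and t: "t = swp j t0"
    using assms(1) unfolding Cross step_Cross_Some by auto
  have ly: "length y = length t0" using assms(3) t unfolding over_def by (metis length_map length_swp)
  have o: "over t0 (swp j y)" using over_swp[OF assms(3), of j] j t by simp
  show ?thesis
  proof (cases "col s (y ! j) = Blk \<and> col s (y ! Suc j) = Blk")
    case True
    have "map (col s) (swp j y) = map (col s) y"
      using True j ly by (intro nth_equalityI) (auto simp: nth_swp)
    then have "over t0 y" using o assms(3) unfolding over_def by simp
    then show ?thesis using assms(2) o True unfolding Cross by simp
  next
    case False
    then show ?thesis using assms(2)[OF o] unfolding Cross by (auto split: color.split)
  qed
next
  case Nail
  then have "t = t0" using assms(1) by (auto split: if_splits)
  then show ?thesis using assms(2)[OF over_neg] assms(3) Nail by auto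
qed

lemma acts_cong:
  assumes "run t0 u = Some t" "\<And>y. over t0 y \<Longrightarrow> V y = W y" "over t y"
  shows "acts u V y = acts u W y"
  using assms(1,3)
proof (induction u arbitrary: t y)
  case (Cons g u)
  from Cons.prems(1) obtain t1 where t1: "run t0 u = Some t1" "step t1 g = Some t" by (rule run_ConsE)
  show ?case unfolding acts_simps by (rule act_cong[OF t1(2) Cons.IH[OF t1(1)] Cons.prems(2)])
qed (use assms(2) in simp)

lemma nth_app:
  assumes "length P = j"
  shows "(P @ a # R) ! j = a" "(P @ a # b # R) ! Suc j = b" "(P @ a # b # c # R) ! Suc (Suc j) = c"
  using assms by (auto simp: nth_append)

lemma over_split2:
  assumes "over t y" "Suc j < length t"
  obtains P a b R where "y = P @ a # b # R" "length P = j" "col s a = t ! j" "col s b = t ! Suc j" "\<bar>a\<bar> \<noteq> \<bar>b\<bar>"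
proof -
  have y: "Suc j < length y" "t = map (col s) y" using assms by (auto simp: over_def)
  from y(1) obtain P a b R where P: "y = P @ a # b # R" "length P = j" by (rule split_at_pair)
  have "distinct (map abs (P @ a # b # R))" using assms(1) P(1) by (simp only: over_def)
  then have "\<bar>a\<bar> \<noteq> \<bar>b\<bar>" by simp
  moreover have "t ! j = col s (y ! j)" "t ! Suc j = col s (y ! Suc j)" using y(1) unfolding y(2) by simp_all
  then have "t ! j = col s a" "t ! Suc j = col s b" unfolding P(1) nth_app[OF P(2)] by auto
  ultimately show ?thesis using that[OF P] by simp
qed

lemma over_split3:
  assumes "over t y" "Suc (Suc j) < length t"
  obtains P a b c R where "y = P @ a # b # c # R" "length P = j" "col s a = t ! j" "col s b = t ! Suc j"
    "col s c = t ! Suc (Suc j)" "\<bar>a\<bar> \<noteq> \<bar>b\<bar>" "\<bar>b\<bar> \<noteq> \<bar>c\<bar>" "\<bar>a\<bar> \<noteq> \<bar>c\<bar>"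
proof -
  have y: "Suc (Suc j) < length y" "t = map (col s) y" using assms by (auto simp: over_def)
  have P: "y = take j y @ y ! j # y ! Suc j # y ! Suc (Suc j) # drop (Suc (Suc (Suc j))) y" "length (take j y) = j"
    using y(1) by (simp_all add: Cons_nth_drop_Suc)
  have "distinct (map abs (take j y @ y ! j # y ! Suc j # y ! Suc (Suc j) # drop (Suc (Suc (Suc j))) y))"
    using assms(1) P(1) unfolding over_def by metis
  then have "\<bar>y ! j\<bar> \<noteq> \<bar>y ! Suc j\<bar>" "\<bar>y ! Suc j\<bar> \<noteq> \<bar>y ! Suc (Suc j)\<bar>" "\<bar>y ! j\<bar> \<noteq> \<bar>y ! Suc (Suc j)\<bar>" by auto
  then show ?thesis using that[OF P] y by simp
qed

lemma acts_dots: "acts (replicate m (Dot j)) V y = Z (y ! j) ^ m * V y"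
  by (induction m) (simp_all add: mult.assoc)

text \<open>The case to watch is a nail and a crossing further right: they commute because
  \<open>nail_sign\<close> ignores the order of the tail.\<close>

lemma act_far:
  assumes "supp g \<inter> supp g' = {}" "\<forall>i\<in>supp g \<union> supp g'. i < length y"
  shows "act g (act g' V) y = act g' (act g V) y"
proof -
  have cc: "act (Cross i) (act (Cross j) V) y = act (Cross j) (act (Cross i) V) y"
    if ij: "Suc i < j" "Suc j < length y" for i j
    using ij swp_commute[OF ij]
    by (auto simp: nth_swp algebra_simps split: color.split)
  have nc: "act Nail (act (Cross (Suc j)) V) y = act (Cross (Suc j)) (act Nail V) y"
    if j: "Suc (Suc j) < length y" for j
  proof -
    obtain a r where y: "y = a # r" using j by (cases y) auto
    then show ?thesis using j
      by (auto simp: swp_Suc_Cons nail_sign_swp algebra_simps split: color.split)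
  qed
  have dd: "act (Dot i) (act (Dot j) V) y = act (Dot j) (act (Dot i) V) y" for i j
    by (simp add: algebra_simps)
  have dc: "act (Dot i) (act (Cross j) V) y = act (Cross j) (act (Dot i) V) y"
    if "i \<noteq> j" "i \<noteq> Suc j" "i < length y" "Suc j < length y" for i j
    using that by (auto simp: nth_swp algebra_simps split: color.split)
  have dn: "act (Dot i) (act Nail V) y = act Nail (act (Dot i) V) y" if "i \<noteq> 0" "i < length y" for i
    using that by (auto simp: algebra_simps)
  show ?thesis
  proof (cases g; cases g')
    fix i j assume g: "g = Cross i" "g' = Cross j"
    then have "Suc i < j \<or> Suc j < i" "Suc i < length y" "Suc j < length y"
      using assms by auto
    then show ?thesis using cc[of i j] cc[of j i] g by auto
  next
    fix i assume g: "g = Cross i" "g' = Nail"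
    then obtain i' where "i = Suc i'" using assms(1) by (cases i) auto
    then show ?thesis using nc[of i'] g assms(2) by simp
  next
    fix i assume g: "g = Nail" "g' = Cross i"
    then obtain i' where "i = Suc i'" using assms(1) by (cases i) auto
    then show ?thesis using nc[of i'] g assms(2) by simp
  qed (use assms dd dc dn in \<open>auto simp del: act.simps\<close>)
qed

lemma braid_act:
  assumes y: "y = P @ a # b # c # R" "length P = j" and "\<bar>a\<bar> \<noteq> \<bar>b\<bar>" "\<bar>b\<bar> \<noteq> \<bar>c\<bar>" "\<bar>a\<bar> \<noteq> \<bar>c\<bar>"
    and b: "col s b = Blk" and ac: "col s a = Blk \<or> col s c = Blk"
  shows "acts [Cross j, Cross (Suc j), Cross j] V y = acts [Cross (Suc j), Cross j, Cross (Suc j)] V y"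
proof -
  note sw = swp_append2[OF y(2)] nth_app[OF y(2)]
  consider "col s a = Blk" "col s c = Blk" | i where "col s a = Rd i" "col s c = Blk" | i where "col s a = Blk" "col s c = Rd i"
    using ac by (cases "col s a"; cases "col s c") auto
  then show ?thesis
  proof cases
    case 1
    define X Y W where "X = D a b" "Y = D b c" "W = D a c"
    have sk: "D b a = - X" "D c b = - Y" "D c a = - W" 
      using D_swap[OF assms(3)] D_swap[OF assms(4)] D_swap[OF assms(5)] X_Y_W_def by simp_all
    have rel: "X * Y - W * X - W * Y = 0" using D_Arnold[OF assms(3-5)] X_Y_W_def by simp
    let ?V = "\<lambda>a b c. V (P @ a # b # c # R)"
    \<comment> \<open>Only the given order and its two adjacent swaps survive in the difference,
      each with the Arnold expression as a factor.\<close>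
    have "acts [Cross j, Cross (Suc j), Cross j] V y - acts [Cross (Suc j), Cross j, Cross (Suc j)] V y
       = (X * Y - W * X - W * Y) * (X * (?V a b c + ?V b a c) - Y * (?V a b c + ?V a c b))"
      using 1 b unfolding y(1) by (simp add: sw sk flip: X_Y_W_def) (simp add: algebra_simps)
    then show ?thesis unfolding rel by simp
  next
    case 2
    then show ?thesis using b unfolding y(1) by (simp add: sw)
  next
    case 3
    then show ?thesis using b unfolding y(1) by (simp add: sw algebra_simps)
  qed
qed

text \<open>Either \<open>a\<close> or \<open>c\<close> pays for passing the red strand, according
  to the side taken by the crossing. Dividing the difference of the two powers by
  \<open>Z a - Z c\<close> gives the dot terms of relation (iv).\<close>

lemma braid_red_act:
  assumes y: "y = P @ a # b # c # R" "length P = j" and "\<bar>a\<bar> \<noteq> \<bar>c\<bar>"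
    and "col s a = Blk" "col s b = Rd i" "col s c = Blk"
  shows "acts [Cross j, Cross (Suc j), Cross j] V y - acts [Cross (Suc j), Cross j, Cross (Suc j)] V y
    = (\<Sum>k<N ! i. Z a ^ k * Z c ^ (N ! i - Suc k)) * V y"
proof -
  note sw = swp_append2[OF y(2)] nth_app[OF y(2)]
  have "acts [Cross j, Cross (Suc j), Cross j] V y - acts [Cross (Suc j), Cross j, Cross (Suc j)] V y
     = ((Z a ^ (N ! i) - Z c ^ (N ! i)) * D a c) * V y"
    using assms(3-6) unfolding y(1) by (simp add: sw algebra_simps)
  also have "(Z a ^ (N ! i) - Z c ^ (N ! i)) * D a c
      = ((Z a - Z c) * D a c) * (\<Sum>k<N ! i. Z a ^ k * Z c ^ (N ! i - Suc k))"
    unfolding power_diff_sumr2 by (simp add: mult_ac)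
  finally show ?thesis using D[OF assms(3)] by simp
qed

text \<open>Both words vanish at \<open>y\<close> unless \<open>a\<close> and \<open>b\<close> are
  negative. The Koszul signs of the two nailing orders are opposite, which offsets the antisymmetry
  of \<open>D\<close> in the first word; that word then carries the square of \<open>D a b\<close>,
  the second its negative, up to a common sign.\<close>

lemma nail_braid_act:
  assumes y: "y = a # b # R" and "\<bar>a\<bar> \<noteq> \<bar>b\<bar>" and "col s a = Blk" "col s b = Blk"
  shows "acts [Cross 0, Nail, Cross 0, Nail] V y + acts [Nail, Cross 0, Nail, Cross 0] V y = 0"
proof -
  have sw: "swp 0 (u # v # R) = v # u # R" for u v using swp_append[of "[]" u v R] by simp
  have neg: "col s (- q) = col s q" for q by (simp add: col_def)
  have ba: "D b a = - D a b" by (rule D_swap[OF assms(2)])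
  have bn: "a < 0 \<Longrightarrow> b < 0 \<Longrightarrow> d (nat (- b)) (nat (- a)) = - d (nat (- a)) (nat (- b))" using ba by simp
  show ?thesis
    using assms(2-4) unfolding y
    by (auto simp: sw neg ba bn nail_sign_Cons algebra_simps abs_if split: if_splits)
qed

end

section \<open>The relations act by zero\<close>

lemma templ_cases:
  assumes "xs \<in> (templ N s :: (gen list \<times> 'k::comm_ring_1) list set)"
  obtains
    (bb1) j where "xs = [([Cross j, Cross j], 1)]" "blk s j" "blk s (Suc j)"
  | (bb2) j where "xs = [([Cross j, Dot j], 1), ([Dot (Suc j), Cross j], -1), ([], -1)]" "blk s j" "blk s (Suc j)"
  | (bb3) j where "xs = [([Dot j, Cross j], 1), ([Cross j, Dot (Suc j)], -1), ([], -1)]" "blk s j" "blk s (Suc j)"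
  | (br1) j i where "xs = [([Dot (Suc j), Cross j], 1), ([Cross j, Dot j], -1)]" "blk s j" "rd s (Suc j) i"
  | (rb1) j i where "xs = [([Dot j, Cross j], 1), ([Cross j, Dot (Suc j)], -1)]" "rd s j i" "blk s (Suc j)"
  | (br2) j i where "xs = [([Cross j, Cross j], 1), (replicate (N ! i) (Dot j), -1)]" "blk s j" "rd s (Suc j) i"
  | (rb2) j i where "xs = [([Cross j, Cross j], 1), (replicate (N ! i) (Dot (Suc j)), -1)]" "rd s j i" "blk s (Suc j)"
  | (braid) j where "xs = [([Cross j, Cross (Suc j), Cross j], 1), ([Cross (Suc j), Cross j, Cross (Suc j)], -1)]"
      "blk s (Suc j)" "Suc (Suc j) < length s" "blk s j \<or> blk s (Suc (Suc j))"
  | (braid_red) j i where "xs = [([Cross j, Cross (Suc j), Cross j], 1), ([Cross (Suc j), Cross j, Cross (Suc j)], -1)]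
        @ map (\<lambda>k. (replicate k (Dot j) @ replicate (N ! i - 1 - k) (Dot (Suc (Suc j))), -1)) [0..<N ! i]"
      "blk s j" "rd s (Suc j) i" "blk s (Suc (Suc j))"
  | (nail_dot) "xs = [([Nail, Dot 0], 1), ([Dot 0, Nail], -1)]" "blk s 0"
  | (nail2) "xs = [([Nail, Nail], 1)]" "blk s 0"
  | (nail_braid) "xs = [([Cross 0, Nail, Cross 0, Nail], 1), ([Nail, Cross 0, Nail, Cross 0], 1)]" "blk s 0" "blk s 1"
  | (far) g g' where "xs = [([g, g'], 1), ([g', g], - ((-1) ^ (hdeg g * hdeg g')))]" "supp g \<inter> supp g' = {}"
proof -
  note I = assms[unfolded templ_def]
  show thesis
    using I
    apply (elim UnE)
    subgoal by (elim CollectE exE conjE) (rule bb1)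
    subgoal by (elim CollectE exE conjE) (rule bb2)
    subgoal by (elim CollectE exE conjE) (rule bb3)
    subgoal by (elim CollectE exE conjE) (rule br1)
    subgoal by (elim CollectE exE conjE) (rule rb1)
    subgoal by (elim CollectE exE conjE) (rule br2)
    subgoal by (elim CollectE exE conjE) (rule rb2)
    subgoal by (elim CollectE exE conjE) (rule braid)
    subgoal by (elim CollectE exE conjE) (rule braid_red)
    subgoal using nail_dot nail2 by (metis empty_iff insert_iff)
    subgoal using nail_braid by (metis empty_iff insert_iff)
    subgoal by (elim CollectE exE conjE) (rule far)
    done
qed

lemma step_length: "step s g = Some t \<Longrightarrow> length t = length s"
  by (cases g) (auto split: if_splits)

lemma step_supp: "step s g = Some t \<Longrightarrow> i \<in> supp g \<Longrightarrow> i < length s"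
  by (cases g) (auto split: if_splits)

lemma run_length: "run s u = Some t \<Longrightarrow> length t = length s"
  by (induction u arbitrary: t) (auto split: option.splits dest: step_length)

lemma run_supp: "run s u = Some t \<Longrightarrow> g \<in> set u \<Longrightarrow> i \<in> supp g \<Longrightarrow> i < length s"
  by (induction u arbitrary: t) (auto split: option.splits dest!: step_supp run_length)

lemma step_Cross_swp: "step s (Cross j) = Some t \<Longrightarrow> t = swp j s \<and> Suc j < length s"
  unfolding step_Cross_Some by simp

lemma run_cross2: "run s [Cross j, Cross j] = Some t \<Longrightarrow> t = s"
  by (elim run_ConsE) (auto dest!: step_Cross_swp simp del: step.simps)

lemma run_cross3:
  assumes "run s [Cross j, Cross (Suc j), Cross j] = Some t"
  shows "t ! j = s ! Suc (Suc j)" "t ! Suc j = s ! Suc j" "t ! Suc (Suc j) = s ! j" "Suc (Suc j) < length s"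
  using assms by (elim run_ConsE; auto dest!: step_Cross_swp simp: nth_swp simp del: step.simps)+

context localized_rep
begin

lemma templ_vanish:
  fixes V :: "int list \<Rightarrow> 'r"
  assumes xs: "xs \<in> templ N s0" and run: "\<forall>p\<in>set xs. run s0 (fst p) = Some t" and o: "over t y"
  shows "(\<Sum>p\<leftarrow>xs. h (snd p) * acts (fst p) V y) = 0"
  using xs
proof (cases rule: templ_cases)
  case (bb1 j)
  then have "run s0 [Cross j, Cross j] = Some t" using run by simp
  then have "t = s0" by (rule run_cross2)
  then have c: "Suc j < length t" "t ! j = Blk" "t ! Suc j = Blk" using bb1 by (auto simp: blk_def)
  obtain P a b R where y: "y = P @ a # b # R" "length P = j" "col s a = Blk" "col s b = Blk" "\<bar>a\<bar> \<noteq> \<bar>b\<bar>"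
    using over_split2[OF o c(1)] c(2,3) by metis
  show ?thesis using bb1(1) y(3,4) D_swap[OF y(5)] unfolding y(1)
    by (simp add: h_1 nth_app[OF y(2)] swp_append2[OF y(2)] add.commute)
next
  case (bb2 j)
  then have "t = s0" using run by simp
  then have c: "Suc j < length t" "t ! j = Blk" "t ! Suc j = Blk" using bb2 by (auto simp: blk_def)
  obtain P a b R where y: "y = P @ a # b # R" "length P = j" "col s a = Blk" "col s b = Blk" "\<bar>a\<bar> \<noteq> \<bar>b\<bar>"
    using over_split2[OF o c(1)] c(2,3) by metis
  have "(\<Sum>p\<leftarrow>xs. h (snd p) * acts (fst p) V y) = ((Z a - Z b) * D a b) * V y - V y"
    using bb2(1) y(3,4) unfolding y(1)
    by (simp add: h_1 h_minus_1 nth_app[OF y(2)] swp_append2[OF y(2)] algebra_simps)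
  then show ?thesis using D[OF y(5)] by simp
next
  case (bb3 j)
  then have "t = s0" using run by simp
  then have c: "Suc j < length t" "t ! j = Blk" "t ! Suc j = Blk" using bb3 by (auto simp: blk_def)
  obtain P a b R where y: "y = P @ a # b # R" "length P = j" "col s a = Blk" "col s b = Blk" "\<bar>a\<bar> \<noteq> \<bar>b\<bar>"
    using over_split2[OF o c(1)] c(2,3) by metis
  have "(\<Sum>p\<leftarrow>xs. h (snd p) * acts (fst p) V y) = ((Z a - Z b) * D a b) * V y - V y"
    using bb3(1) y(3,4) unfolding y(1)
    by (simp add: h_1 h_minus_1 nth_app[OF y(2)] swp_append2[OF y(2)] algebra_simps)
  then show ?thesis using D[OF y(5)] by simp
next
  case (br1 j i)
  then have "run s0 [Cross j, Dot j] = Some t" using run by simp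
  then have "t = swp j s0" "Suc j < length s0"
    by (elim run_ConsE; auto simp: step_Dot_Some dest!: step_Cross_swp simp del: step.simps)+
  then have c: "Suc j < length t" "t ! j = Rd i" "t ! Suc j = Blk" using br1 by (auto simp: blk_def rd_def nth_swp)
  obtain P a b R where y: "y = P @ a # b # R" "length P = j" "col s a = Rd i" "col s b = Blk" "\<bar>a\<bar> \<noteq> \<bar>b\<bar>"
    using over_split2[OF o c(1)] c(2,3) by metis
  show ?thesis using br1(1) y(3,4) unfolding y(1)
    by (simp add: h_1 h_minus_1 nth_app[OF y(2)] swp_append2[OF y(2)])
next
  case (rb1 j i)
  then have "run s0 [Cross j, Dot (Suc j)] = Some t" using run by simp
  then have "t = swp j s0" "Suc j < length s0"
    by (elim run_ConsE; auto simp: step_Dot_Some dest!: step_Cross_swp simp del: step.simps)+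
  then have c: "Suc j < length t" "t ! j = Blk" "t ! Suc j = Rd i" using rb1 by (auto simp: blk_def rd_def nth_swp)
  obtain P a b R where y: "y = P @ a # b # R" "length P = j" "col s a = Blk" "col s b = Rd i" "\<bar>a\<bar> \<noteq> \<bar>b\<bar>"
    using over_split2[OF o c(1)] c(2,3) by metis
  show ?thesis using rb1(1) y(3,4) unfolding y(1)
    by (simp add: h_1 h_minus_1 nth_app[OF y(2)] swp_append2[OF y(2)] algebra_simps)
next
  case (br2 j i)
  then have "run s0 [Cross j, Cross j] = Some t" using run by simp
  then have "t = s0" by (rule run_cross2)
  then have c: "Suc j < length t" "t ! j = Blk" "t ! Suc j = Rd i" using br2 by (auto simp: blk_def rd_def)
  obtain P a b R where y: "y = P @ a # b # R" "length P = j" "col s a = Blk" "col s b = Rd i" "\<bar>a\<bar> \<noteq> \<bar>b\<bar>"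
    using over_split2[OF o c(1)] c(2,3) by metis
  show ?thesis using br2(1) y(3,4) unfolding y(1)
    by (simp add: h_1 h_minus_1 acts_dots nth_app[OF y(2)] swp_append2[OF y(2)])
next
  case (rb2 j i)
  then have "run s0 [Cross j, Cross j] = Some t" using run by simp
  then have "t = s0" by (rule run_cross2)
  then have c: "Suc j < length t" "t ! j = Rd i" "t ! Suc j = Blk" using rb2 by (auto simp: blk_def rd_def)
  obtain P a b R where y: "y = P @ a # b # R" "length P = j" "col s a = Rd i" "col s b = Blk" "\<bar>a\<bar> \<noteq> \<bar>b\<bar>"
    using over_split2[OF o c(1)] c(2,3) by metis
  show ?thesis using rb2(1) y(3,4) unfolding y(1)
    by (simp add: h_1 h_minus_1 acts_dots nth_app[OF y(2)] swp_append2[OF y(2)])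
next
  case (braid j)
  then have r: "run s0 [Cross j, Cross (Suc j), Cross j] = Some t" using run by simp
  then have lt: "length t = length s0" by (rule run_length)
  obtain P a b c R where y: "y = P @ a # b # c # R" "length P = j" "col s a = t ! j" "col s b = t ! Suc j"
    "col s c = t ! Suc (Suc j)" "\<bar>a\<bar> \<noteq> \<bar>b\<bar>" "\<bar>b\<bar> \<noteq> \<bar>c\<bar>" "\<bar>a\<bar> \<noteq> \<bar>c\<bar>"
    using over_split3[OF o, of j] run_cross3(4)[OF r] lt by metis
  have "acts [Cross j, Cross (Suc j), Cross j] V y = acts [Cross (Suc j), Cross j, Cross (Suc j)] V y"
    by (rule braid_act[OF y(1,2,6-8)]) (use y(3-5) run_cross3[OF r] braid in \<open>auto simp: blk_def\<close>)
  then show ?thesis using braid(1) by (simp add: h_1 h_minus_1 del: acts_simps act.simps)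
next
  case (braid_red j i)
  then have r: "run s0 [Cross j, Cross (Suc j), Cross j] = Some t" using run by simp
  then have lt: "length t = length s0" by (rule run_length)
  obtain P a b c R where y: "y = P @ a # b # c # R" "length P = j" "col s a = t ! j" "col s b = t ! Suc j"
    "col s c = t ! Suc (Suc j)" "\<bar>a\<bar> \<noteq> \<bar>b\<bar>" "\<bar>b\<bar> \<noteq> \<bar>c\<bar>" "\<bar>a\<bar> \<noteq> \<bar>c\<bar>"
    using over_split3[OF o, of j] run_cross3(4)[OF r] lt by metis
  have e: "acts [Cross j, Cross (Suc j), Cross j] V y - acts [Cross (Suc j), Cross j, Cross (Suc j)] V y
    = (\<Sum>k<N ! i. Z a ^ k * Z c ^ (N ! i - Suc k)) * V y"
    by (rule braid_red_act[OF y(1,2,8)]) (use y(3-5) run_cross3[OF r] braid_red in \<open>auto simp: blk_def rd_def\<close>)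
  have "(\<Sum>p\<leftarrow>map (\<lambda>k. (replicate k (Dot j) @ replicate (N ! i - 1 - k) (Dot (Suc (Suc j))), -1)) [0..<N ! i].
        h (snd p) * acts (fst p) V y) = (\<Sum>k\<leftarrow>[0..<N ! i]. - (Z a ^ k * Z c ^ (N ! i - Suc k)) * V y)"
    unfolding map_map comp_def fst_conv snd_conv acts_append acts_dots
    using y(1) nth_app[OF y(2)] by (simp add: h_minus_1 mult.assoc)
  also have "\<dots> = - ((\<Sum>k<N ! i. Z a ^ k * Z c ^ (N ! i - Suc k)) * V y)"
    by (simp add: interv_sum_list_conv_sum_set_nat atLeast0LessThan sum_distrib_right sum_negf)
  finally show ?thesis using e braid_red(1)
    by (simp add: h_1 h_minus_1 algebra_simps del: acts_simps act.simps)
next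
  case nail_dot
  then have "0 < length t" using run step_length by (fastforce simp: blk_def split: if_splits)
  then obtain a r where "y = a # r" using o by (cases y) (auto simp: over_def)
  then show ?thesis using nail_dot(1) by (simp add: h_1 h_minus_1)
next
  case nail2
  then have "0 < length t" using run step_length by (fastforce simp: blk_def split: if_splits)
  then obtain a r where "y = a # r" using o by (cases y) (auto simp: over_def)
  then show ?thesis using nail2(1) by simp
next
  case nail_braid
  then have r: "run s0 [Nail, Cross 0, Nail, Cross 0] = Some t" using run by simp
  have c: "s0 ! 0 = Blk" "s0 ! Suc 0 = Blk" "Suc 0 < length s0" using nail_braid by (auto simp: blk_def)
  have "swp 0 s0 = s0" using c by (intro nth_equalityI) (auto simp: nth_swp)
  then have "t = s0" using r c by (auto split: if_splits)
  then obtain P a b R where y: "y = P @ a # b # R" "length P = 0" "col s a = Blk" "col s b = Blk" "\<bar>a\<bar> \<noteq> \<bar>b\<bar>"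
    using over_split2[OF o, of 0] c by metis
  then have "y = a # b # R" by simp
  from nail_braid_act[OF this y(5,3,4), of V] show ?thesis
    using nail_braid(1) by (simp add: h_1 del: acts_simps act.simps)
next
  case (far g g')
  have hd0: "hdeg g * hdeg g' = 0" using far(2) by (cases g; cases g') auto
  have r: "run s0 [g, g'] = Some t" using far(1) run by simp
  have "length y = length s0" using run_length[OF r] o by (auto simp: over_def)
  then have "\<forall>i\<in>supp g \<union> supp g'. i < length y" using run_supp[OF r] by auto
  from act_far[OF far(2) this, of V] show ?thesis
    using far(1) hd0 by (simp add: h_1 h_minus_1 del: act.simps)
qed

section \<open>Evaluation at the starting arrangement, and leading coefficients\<close>

definition vac :: "int list \<Rightarrow> 'r" where
  "vac y = (if y = base (length s) then 1 else 0)"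

text \<open>The linear extension of \<open>acts w vac\<close>. The sum is meaningful only for finite
  support, so finiteness is carried along in the lemmas that follow.\<close>

definition phi :: "(gen list \<Rightarrow> 'k) \<Rightarrow> int list \<Rightarrow> 'r" where
  "phi f y = (\<Sum>w | f w \<noteq> 0. h (f w) * acts w vac y)"

lemma phi_superset:
  assumes "finite S" "{w. f w \<noteq> 0} \<subseteq> S"
  shows "phi f y = (\<Sum>w\<in>S. h (f w) * acts w vac y)"
  unfolding phi_def using assms by (intro sum.mono_neutral_left) (auto simp: h_0)

lemma phi_add:
  assumes "finite {w. f w \<noteq> 0}" "finite {w. g w \<noteq> 0}"
  shows "finite {w. f w + g w \<noteq> 0}" "phi (\<lambda>w. f w + g w) y = phi f y + phi g y"
proof -
  let ?S = "{w. f w \<noteq> 0} \<union> {w. g w \<noteq> 0}"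
  have S: "finite ?S" "{w. f w + g w \<noteq> 0} \<subseteq> ?S" using assms by auto
  then show "finite {w. f w + g w \<noteq> 0}" by (rule finite_subset[rotated])
  show "phi (\<lambda>w. f w + g w) y = phi f y + phi g y"
    using S phi_superset[OF S] phi_superset[of ?S f] phi_superset[of ?S g]
    by (simp add: h_add algebra_simps sum.distrib)
qed

lemma phi_mult:
  assumes "finite {w. f w \<noteq> 0}"
  shows "finite {w. c * f w \<noteq> 0}" "phi (\<lambda>w. c * f w) y = h c * phi f y"
proof -
  have S: "{w. c * f w \<noteq> 0} \<subseteq> {w. f w \<noteq> 0}" by auto
  then show "finite {w. c * f w \<noteq> 0}" using assms by (rule finite_subset)
  show "phi (\<lambda>w. c * f w) y = h c * phi f y"
    using phi_superset[OF assms S] by (simp add: phi_def h_mult sum_distrib_left mult.assoc)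
qed

lemma phi_0: "phi (\<lambda>_. 0) y = 0"
  by (simp add: phi_def)

lemma phi_word:
  shows "finite {u. (word_vec v u :: 'k) \<noteq> 0}" "phi (word_vec v) y = acts v vac y"
proof -
  have "{u. (word_vec v u :: 'k) \<noteq> 0} = {v}" by (auto simp: word_vec_def)
  then show "finite {u. (word_vec v u :: 'k) \<noteq> 0}" "phi (word_vec v) y = acts v vac y"
    by (simp_all add: phi_def word_vec_def h_1)
qed

lemma phi_lc: "finite {w. lc xs w \<noteq> 0}" "phi (lc xs) y = (\<Sum>p\<leftarrow>xs. h (snd p) * acts (fst p) vac y)"
proof -
  have "finite {w. lc xs w \<noteq> 0} \<and> phi (lc xs) y = (\<Sum>p\<leftarrow>xs. h (snd p) * acts (fst p) vac y)"
  proof (induction xs)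
    case (Cons x xs)
    obtain w c where x: "x = (w, c)" by (cases x)
    note m = phi_mult(1)[OF phi_word(1)[of w], of c] phi_mult(2)[OF phi_word(1)[of w], of c y]
    have IH: "finite {w. lc xs w \<noteq> 0}" "phi (lc xs) y = (\<Sum>p\<leftarrow>xs. h (snd p) * acts (fst p) vac y)"
      using Cons by auto
    show ?case unfolding x lc_Cons using phi_add[OF m(1) IH(1)] m(2) IH(2) by (simp add: phi_word)
  qed (simp add: phi_0)
  then show "finite {w. lc xs w \<noteq> 0}" "phi (lc xs) y = (\<Sum>p\<leftarrow>xs. h (snd p) * acts (fst p) vac y)" by auto
qed

lemma wrap_lc: "wrap u v (lc xs) = lc (map (\<lambda>p. (u @ fst p @ v, snd p)) xs)"
proof (induction xs)
  case (Cons x xs)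
  then show ?case by (cases x) (simp add: wrap_add wrap_mult wrap_word_vec)
qed (simp add: wrap_0)

text \<open>A relation with \<open>v\<close> below it is applied to the vector
  \<open>acts v vac\<close>, where \<open>templ_vanish\<close> makes it zero over \<open>t0\<close>;
  \<open>acts_cong\<close> carries this through \<open>u\<close>.\<close>

lemma ideal_phi:
  assumes "f \<in> Ideal N s t"
  shows "finite {w. f w \<noteq> 0} \<and> (\<forall>y. over t y \<longrightarrow> phi f y = 0)"
  using assms
proof induction
  case I0
  then show ?case by (simp add: phi_0)
next
  case (Iadd f g)
  then show ?case using phi_add by simp
next
  case (Ismult f c)
  then show ?case using phi_mult by simp
next
  case (Igen xs s0 t0 v u)
  let ?V = "\<lambda>y. \<Sum>p\<leftarrow>xs. h (snd p) * acts (fst p) (acts v vac) y"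
  have "phi (wrap u v (lc xs)) y = 0" if "over t y" for y
  proof -
    have "phi (wrap u v (lc xs)) y = (\<Sum>p\<leftarrow>xs. h (snd p) * acts u (acts (fst p) (acts v vac)) y)"
      unfolding wrap_lc phi_lc by (simp add: acts_append comp_def)
    also have "\<dots> = acts u ?V y" by (simp add: acts_sum)
    also have "\<dots> = acts u (\<lambda>_. 0) y"
      by (rule acts_cong[OF Igen(4) _ that]) (rule templ_vanish[OF Igen(1,2)])
    also have "\<dots> = 0" using acts_scale[of u 0 "\<lambda>_. 0"] by (simp add: fun_eq_iff)
    finally show ?thesis .
  qed
  then show ?case unfolding wrap_lc using phi_lc(1) by blast
qed

lemma D_unit: "\<bar>a\<bar> \<noteq> \<bar>c\<bar> \<Longrightarrow> D a c dvd 1"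
  by (metis D dvd_triv_right)

lemma unit_mult: "x dvd 1 \<Longrightarrow> y dvd 1 \<Longrightarrow> x * y dvd (1::'r)"
  using mult_dvd_mono[of x 1 y 1] by simp

lemma unit_power: "x dvd 1 \<Longrightarrow> x ^ m dvd (1::'r)"
  by (induction m) (auto intro: unit_mult)

text \<open>A word no longer than \<open>blen y\<close> reaches \<open>y\<close> only if every
  letter is a length increasing step. So at most one path from \<open>base\<close> contributes, and
  its coefficient is a product of units.\<close>

lemma leading_term:
  assumes "run s u = Some (map (col s) y)" "\<forall>g\<in>set u. \<not> is_dot g" "legit s y" "length u \<le> blen y"
  shows "if arr (length s) u = y then acts u vac y dvd 1 else acts u vac y = 0"
  using assms
proof (induction u arbitrary: y)
  case Nil
  then show ?case by (simp add: vac_def)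
next
  case (Cons g u)
  have nd: "\<not> is_dot g" "\<forall>g\<in>set u. \<not> is_dot g" using Cons.prems by auto
  from Cons.prems(1) obtain s0 where s0: "run s u = Some s0" "step s0 g = Some (map (col s) y)" by (rule run_ConsE)
  define x where "x = arr (length s) u"
  have lx: "legit s x" "s0 = map (col s) x" using run_legit[OF s0(1)] x_def by auto
  have bx: "blen x \<le> length u" using blen_arr_le[OF s0(1)] nd(2) by (simp add: x_def cnt_dotfree)
  have st: "step (map (col s) y) g = Some s0"
    using step_back[OF lx(1)] s0(2) lx(2) by auto
  let ?y = "sact g y"
  have ly: "legit s ?y" and s0y: "s0 = map (col s) ?y" using legit_step[OF Cons.prems(3) st] by auto
  have len_y: "length u \<le> blen ?y" using blen_step[OF Cons.prems(3) st nd(1)] Cons.prems(4) by (auto split: if_splits)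
  have ss: "sact g ?y = y" using step_sact_sact[OF Cons.prems(3) st] .
  have ssx: "sact g (sact g x) = x" using step_sact_sact[OF lx(1)] s0(2) lx(2) by blast
  have eq: "sact g x = y \<longleftrightarrow> x = ?y" using ss ssx by metis
  have IH: "if x = ?y then acts u vac ?y dvd 1 else acts u vac ?y = 0"
    using Cons.IH[OF _ nd(2) ly len_y] s0(1) s0y by (simp add: x_def)
  have dist: "distinct (map abs y)" using Cons.prems(3) by (simp add: legit_def)
  have unit: "if sact g x = y then acts (g # u) vac y dvd 1 else acts (g # u) vac y = 0"
    if "acts (g # u) vac y = c * acts u vac ?y" "c dvd 1" for c
    using IH that unit_mult unfolding eq by auto
  have "if sact g x = y then acts (g # u) vac y dvd 1 else acts (g # u) vac y = 0"
  proof (cases g)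
    case (Dot j)
    then show ?thesis using nd by simp
  next
    case g: (Cross j)
    then have j: "Suc j < length y" and nr: "\<not> (is_red (col s (y ! j)) \<and> is_red (col s (y ! Suc j)))"
      using st by (auto split: if_splits simp del: not_red)
    have ab: "\<bar>y ! j\<bar> \<noteq> \<bar>y ! Suc j\<bar>"
      using dist j nth_eq_iff_index_eq[of "map abs y" j "Suc j"] by simp
    show ?thesis
    proof (cases "col s (y ! j)"; cases "col s (y ! Suc j)")
      assume bb: "col s (y ! j) = Blk" "col s (y ! Suc j) = Blk"
      have "map (col s) (swp j y) = map (col s) y"
        using bb j by (intro nth_equalityI) (auto simp: nth_swp)
      then have s0': "s0 = map (col s) y" using s0y g by simp
      have "length u < blen y" using Cons.prems(4) by simp
      then have "x \<noteq> y" using bx by auto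
      \<comment> \<open>The summand of the Demazure operator that leaves \<open>y\<close> in place:
        \<open>u\<close> is too short to reach \<open>y\<close>.\<close>
      then have "acts u vac y = 0"
        using Cons.IH[OF _ nd(2) Cons.prems(3)] s0(1) s0' Cons.prems(4) by (simp add: x_def split: if_splits)
      then show ?thesis using bb g by (intro unit[OF _ D_unit[OF ab]]) simp
    next
      fix i assume br: "col s (y ! j) = Blk" "col s (y ! Suc j) = Rd i"
      then show ?thesis using g by (intro unit[OF _ unit_power[OF z_unit]]) simp
    next
      fix i assume rb: "col s (y ! j) = Rd i" "col s (y ! Suc j) = Blk"
      then show ?thesis using g by (intro unit[of 1]) simp_all
    qed (use nr in \<open>simp add: is_red_def del: not_red\<close>)
  next
    case g: Nail
    show ?thesis
    proof (cases "y ! 0 < 0")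
      case True
      then show ?thesis using g by (intro unit[OF _ nail_sign_unit]) simp
    next
      case False
      then have "blen ?y = Suc (blen y)" using blen_step[OF Cons.prems(3) st nd(1)] g by simp
      then have "x \<noteq> ?y" using bx Cons.prems(4) by auto
      then show ?thesis using eq g False by simp
    qed
  qed
  then show ?case by (simp add: x_def del: acts_simps)
qed

end

section \<open>Laurent series\<close>

text \<open>Here \<open>fls_shift (- int m) 1\<close> is the power X^m, and the inverse is the
  geometric series with coefficient 1 at the multiples of \<open>m\<close>.\<close>

lemma one_minus_X_power_unit:
  assumes "0 < m"
  shows "\<exists>g :: 'k::comm_ring_1 fls. (1 - fls_shift (- int m) 1) * g = 1"
proof -
  let ?G = "Abs_fps (\<lambda>n. if m dvd n then 1 else 0) :: 'k fps"
  have "(1 - fps_X ^ m) * ?G = 1"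
  proof (rule fps_ext)
    fix n
    have "((1 - fps_X ^ m) * ?G) $ n = ?G $ n - (fps_X ^ m * ?G) $ n"
      by (simp add: left_diff_distrib)
    also have "\<dots> = (1 :: 'k fps) $ n"
      using assms dvd_imp_le[of m n] dvd_minus_self[of m n] by (auto simp: fps_X_power_mult_nth)
    finally show "((1 - fps_X ^ m) * ?G) $ n = (1 :: 'k fps) $ n" .
  qed
  then have "fps_to_fls ((1 - fps_X ^ m) * ?G) = 1" by simp
  moreover have "fps_to_fls (fps_X ^ m) = (fls_shift (- int m) 1 :: 'k fls)"
    by (rule fls_eqI) (auto simp: fps_X_power_nth)
  ultimately show ?thesis
    by (intro exI[of _ "fps_to_fls ?G"]) (simp add: fls_times_fps_to_fls)
qed

lemma X_power_unit: "fls_shift i 1 dvd (1 :: 'k::comm_ring_1 fls)"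
  using fls_X_intpow_times_fls_X_intpow[of "-i" i, where ?'a = 'k] 
  by (intro dvdI[of _ _ "fls_shift (-i) 1"]) simp

lemma X_power_diff_unit:
  assumes "i \<noteq> j"
  shows "\<exists>g :: 'k::comm_ring_1 fls. (fls_shift (- int i) 1 - fls_shift (- int j) 1) * g = 1"
proof -
  have *: "\<exists>g :: 'k fls. (fls_shift (- int i) 1 - fls_shift (- int j) 1) * g = 1" if ij: "i < j" for i j
  proof -
    obtain g :: "'k fls" where g: "(1 - fls_shift (- int (j - i)) 1) * g = 1"
      using one_minus_X_power_unit[of "j - i", where ?'k = 'k] ij by auto
    obtain g' :: "'k fls" where g': "1 = fls_shift (- int i) 1 * g'" using X_power_unit[of "- int i", where ?'k = 'k] by (rule dvdE)
    have "fls_shift (- int j) 1 = (fls_shift (- int i) 1 * fls_shift (- int (j - i)) 1 :: 'k fls)"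
      using fls_X_intpow_times_fls_X_intpow[of "int i" "int (j - i)", where ?'a = 'k] ij by simp
    then have "(fls_shift (- int i) 1 - fls_shift (- int j) 1) * (g * g')
       = ((1 - fls_shift (- int (j - i)) 1) * g) * (fls_shift (- int i) 1 * g')"
      by (simp add: algebra_simps)
    also have "\<dots> = 1" using g g' by simp
    finally show ?thesis by blast
  qed
  show ?thesis
  proof (cases "i < j")
    case True
    then show ?thesis by (rule *)
  next
    case False
    then obtain g :: "'k fls" where "(fls_shift (- int j) 1 - fls_shift (- int i) 1) * g = 1"
      using *[of j i] assms by auto
    then show ?thesis by (intro exI[of _ "- g"]) (simp add: algebra_simps)
  qed
qed

text \<open>The bound on \<open>M\<close> makes the exponents \<open>M ^ q\<close> pairwise
  distinct, so \<open>X_power_diff_unit\<close> inverts all differences.\<close>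

lemma ex_localized_rep:
  assumes "2 \<le> (M :: nat)"
  shows "\<exists>d. localized_rep (fls_const :: 'k::comm_ring_1 \<Rightarrow> 'k fls) (\<lambda>q. fls_shift (- int (M ^ q)) 1) d"
proof -
  let ?z = "\<lambda>q :: nat. fls_shift (- int (M ^ q)) 1 :: 'k fls"
  have "\<exists>g. p \<noteq> q \<longrightarrow> (?z p - ?z q) * g = 1" for p q
    using X_power_diff_unit[of "M ^ p" "M ^ q", where ?'k = 'k] assms by (cases "p = q") auto
  then obtain d where "\<And>p q. p \<noteq> q \<Longrightarrow> (?z p - ?z q) * d p q = 1" by metis
  then have "localized_rep (fls_const :: 'k \<Rightarrow> 'k fls) ?z d"
    using X_power_unit by unfold_locales (auto simp: fls_plus_const fls_const_mult_const)
  then show ?thesis by blast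
qed

text \<open>The digits below the largest place \<open>m\<close> add up to less than
  \<open>M ^ m\<close>, so division by \<open>M ^ m\<close> reads off the top digit.\<close>

lemma digits_unique:
  fixes f g :: "nat \<Rightarrow> nat"
  assumes "finite E" "\<forall>e\<in>E. f e < M \<and> g e < M" "(\<Sum>e\<in>E. f e * M ^ e) = (\<Sum>e\<in>E. g e * M ^ e)"
  shows "\<forall>e\<in>E. f e = g e"
  using assms
proof (induction E rule: finite_linorder_max_induct)
  case (insert m E)
  have bound: "(\<Sum>e\<in>E. u e * M ^ e) < M ^ m" if "\<forall>e\<in>E. u e < M" "\<forall>e\<in>E. e < m" "finite E" for u :: "nat \<Rightarrow> nat" and E and m :: nat
    using that(3,1,2)
  proof (induction E arbitrary: m rule: finite_linorder_max_induct)
    case empty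
    show ?case using insert.prems(1) by auto
  next
    case (insert k E)
    have "(\<Sum>e\<in>E. u e * M ^ e) < M ^ k" using insert by auto
    moreover have "k \<notin> E" using insert.hyps(2) by auto
    ultimately have "(\<Sum>e\<in>insert k E. u e * M ^ e) < u k * M ^ k + M ^ k" using insert.hyps(1) by simp
    also have "\<dots> = Suc (u k) * M ^ k" by simp
    also have "\<dots> \<le> M * M ^ k" using insert.prems(1) by (intro mult_le_mono1) auto
    also have "\<dots> = M ^ Suc k" by simp
    also have "\<dots> \<le> M ^ m" using insert.prems by (intro power_increasing) auto
    finally show ?case .
  qed
  let ?F = "\<Sum>e\<in>E. f e * M ^ e" and ?G = "\<Sum>e\<in>E. g e * M ^ e"
  have F: "?F < M ^ m" "?G < M ^ m" using bound[of E f m] bound[of E g m] insert.hyps insert.prems(1) by auto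
  have "m \<notin> E" using insert.hyps(2) by auto
  then have eq: "f m * M ^ m + ?F = g m * M ^ m + ?G" using insert.prems(2) insert.hyps(1) by simp
  then have "(f m * M ^ m + ?F) div M ^ m = (g m * M ^ m + ?G) div M ^ m" by simp
  moreover have "M ^ m \<noteq> 0" using F(1) by linarith
  ultimately have "f m = g m" using F by (simp add: div_mult_self3)
  then have "?F = ?G" using eq by simp
  then have "\<forall>e\<in>E. f e = g e" using insert.IH insert.prems(1) by simp
  then show ?case using \<open>f m = g m\<close> by simp
qed simp

section \<open>Colour sequences of the idempotents\<close>

lemma filter_black_nth: "map (\<lambda>p. s ! p) (filter (\<lambda>p. s ! p = c) [0..<length s]) = filter (\<lambda>x. x = c) s"
proof -
  have "filter (\<lambda>x. x = c) s = filter (\<lambda>x. x = c) (map (\<lambda>p. s ! p) [0..<length s])" by (simp add: map_nth)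
  then show ?thesis by (simp add: filter_map comp_def)
qed

lemma reds_state: "filter is_red (state \<rho>) = map Rd [0..<length \<rho> - 1]"
proof -
  have "filter is_red (concat (map (\<lambda>i. Rd i # replicate (f i) Blk) xs)) = map Rd xs" for f :: "nat \<Rightarrow> nat" and xs
    by (induction xs) (auto simp: is_red_def)
  then show ?thesis by (simp add: state_def is_red_def)
qed

lemma blacks_state:
  assumes "\<rho> \<in> Pbr b r"
  shows "length (filter (\<lambda>x. x = Blk) (state \<rho>)) = b"
proof -
  have "length (filter (\<lambda>x. x = Blk) (concat (map (\<lambda>i. Rd i # replicate (f i) Blk) xs))) = (\<Sum>i\<leftarrow>xs. f i)" for f :: "nat \<Rightarrow> nat" and xs
    by (induction xs) auto
  then have "length (filter (\<lambda>x. x = Blk) (state \<rho>)) = hd \<rho> + (\<Sum>i\<leftarrow>[0..<length \<rho> - 1]. \<rho> ! Suc i)"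
    by (simp add: state_def)
  also have "\<dots> = sum_list \<rho>"
  proof -
    obtain x xs where "\<rho> = x # xs" using assms by (cases \<rho>) (auto simp: Pbr_def)
    then show ?thesis by (simp add: map_nth)
  qed
  finally show ?thesis using assms by (simp add: Pbr_def)
qed

lemma length_state:
  assumes "\<rho> \<in> Pbr b r"
  shows "length (state \<rho>) = b + r"
proof -
  have "length (state \<rho>) = length (filter (\<lambda>x. x = Blk) (state \<rho>)) + length (filter (\<lambda>x. x \<noteq> Blk) (state \<rho>))"
    by (simp add: sum_length_filter_compl)
  also have "(\<lambda>x. x \<noteq> Blk) = is_red" by (rule ext) (metis not_red)
  finally show ?thesis using blacks_state[OF assms] assms by (simp add: reds_state Pbr_def)
qed

lemma black_pos_facts:
  assumes "\<rho> \<in> Pbr b r"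
  shows "length (black_pos (state \<rho>)) = b" "distinct (black_pos (state \<rho>))"
    "set (black_pos (state \<rho>)) = {p. p < length (state \<rho>) \<and> state \<rho> ! p = Blk}"
proof -
  have "length (black_pos (state \<rho>)) = length (filter (\<lambda>x. x = Blk) (state \<rho>))"
    unfolding black_pos_def filter_black_nth[symmetric] by simp
  then show "length (black_pos (state \<rho>)) = b" using blacks_state[OF assms] by simp
qed (auto simp: black_pos_def)

lemma state_red_mono:
  assumes "p < p'" "p' < length (state \<rho>)" "state \<rho> ! p = Rd i" "state \<rho> ! p' = Rd i'"
  shows "i < i'"
proof -
  let ?s = "state \<rho>"
  have s: "?s = take p ?s @ Rd i # drop (Suc p) ?s"
    using id_take_nth_drop[of p ?s] assms by simp
  have "Rd i' \<in> set (drop (Suc p) ?s)"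
    using nth_mem[of "p' - Suc p" "drop (Suc p) ?s"] assms by simp
  then have "Rd i' \<in> set (filter is_red (drop (Suc p) ?s))" by (simp add: is_red_def)
  moreover have f: "filter is_red (take p ?s) @ Rd i # filter is_red (drop (Suc p) ?s) = map Rd [0..<length \<rho> - 1]"
  proof -
    have "filter is_red ?s = filter is_red (take p ?s @ Rd i # drop (Suc p) ?s)" using s by simp
    then show ?thesis unfolding reds_state by (simp add: is_red_def)
  qed
  have "sorted_wrt (\<lambda>x y. \<forall>i j. x = Rd i \<and> y = Rd j \<longrightarrow> i < j) (map Rd [0..<length \<rho> - 1])"
    by (simp add: sorted_wrt_map)
  then have "\<forall>y\<in>set (filter is_red (drop (Suc p) ?s)). \<forall>j. y = Rd j \<longrightarrow> i < j"
    unfolding f[symmetric] sorted_wrt_append by simp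
  ultimately show ?thesis by blast
qed

text \<open>Red strands have distinct indices, increasing from left to right at both ends, so a map
  that preserves colours preserves their order.\<close>

lemma Sperm_red_mono:
  assumes "\<kappa> \<in> Pbr b r" "\<rho> \<in> Pbr b r" "w \<in> Sperm \<kappa> \<rho>" "p < p'" "p' < length (state \<rho>)"
    "is_red (state \<rho> ! p)" "is_red (state \<rho> ! p')"
  shows "w p < w p'"
proof (rule ccontr)
  assume nless: "\<not> ?thesis"
  obtain i i' where i: "state \<rho> ! p = Rd i" "state \<rho> ! p' = Rd i'" using assms(6,7) by (auto simp: is_red_def)
  have "i < i'" by (rule state_red_mono[OF assms(4,5) i])
  have bij: "bij_betw w {0..<length (state \<rho>)} {0..<length (state \<rho>)}"
    and c: "\<And>p. p < length (state \<rho>) \<Longrightarrow> state \<kappa> ! (w p) = state \<rho> ! p"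
    using assms(3) by (auto simp: Sperm_def)
  have len: "length (state \<kappa>) = length (state \<rho>)" using length_state assms(1,2) by metis
  have "w p \<noteq> w p'" 
    using inj_on_eq_iff[OF bij_betw_imp_inj_on[OF bij], of p p'] assms(4,5) by simp
  moreover have "w p < length (state \<kappa>)" using bij assms(4,5) len by (auto simp: bij_betw_def)
  ultimately have "i' < i"
    using nless state_red_mono[of "w p'" "w p" \<kappa> i' i] c[of p] c[of p'] i assms(4,5) by auto
  then show False using \<open>i < i'\<close> by simp
qed

section \<open>Spanning and linear independence\<close>

text \<open>Passes from the inductive span to the finite coefficient families required by
  \<open>is_basis\<close>. For sums, both families are extended by zero to the union of their
  supports.\<close>

lemma wspan_coefficients:
  fixes J :: "(gen list \<Rightarrow> 'k::comm_ring_1) set" and B :: "'i \<Rightarrow> gen list"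
  assumes "f \<in> wspan J (B ` I)" and J: "(\<lambda>_. 0) \<in> J" "\<And>f g. f \<in> J \<Longrightarrow> g \<in> J \<Longrightarrow> (\<lambda>w. f w + g w) \<in> J"
    "\<And>f c. f \<in> J \<Longrightarrow> (\<lambda>w. c * f w) \<in> J"
  shows "\<exists>c. finite {i \<in> I. c i \<noteq> 0} \<and> (\<lambda>u. f u - (\<Sum>i\<in>{i \<in> I. c i \<noteq> 0}. c i * word_vec (B i) u)) \<in> J"
proof -
  let ?S = "\<lambda>c A u. \<Sum>i\<in>A. c i * (word_vec (B i) u :: 'k)"
  have super: "?S c {i \<in> I. c i \<noteq> 0} = ?S c A" if "finite A" "{i \<in> I. c i \<noteq> 0} \<subseteq> A" "A \<subseteq> I" for c :: "'i \<Rightarrow> 'k" and A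
    using that by (intro ext sum.mono_neutral_left) auto
  show ?thesis using assms(1)
  proof induction
    case (wspan_ideal f)
    then show ?case by (intro exI[of _ "\<lambda>_. 0"]) simp
  next
    case (wspan_word u)
    then obtain i where i: "i \<in> I" "u = B i" by auto
    let ?c = "\<lambda>j. if j = i then 1 else 0 :: 'k"
    have S: "{j \<in> I. ?c j \<noteq> 0} = {i}" using i by auto
    have "(\<lambda>x. word_vec u x - ?S ?c {j \<in> I. ?c j \<noteq> 0} x) = (\<lambda>_. 0)" unfolding S using i by simp
    then show ?case using J(1) S by (intro exI[of _ ?c]) simp
  next
    case (wspan_add f g)
    then obtain c c' where c: "finite {i \<in> I. c i \<noteq> 0}" "(\<lambda>u. f u - ?S c {i \<in> I. c i \<noteq> 0} u) \<in> J"
      and c': "finite {i \<in> I. c' i \<noteq> 0}" "(\<lambda>u. g u - ?S c' {i \<in> I. c' i \<noteq> 0} u) \<in> J" by blast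
    let ?A = "{i \<in> I. c i \<noteq> 0} \<union> {i \<in> I. c' i \<noteq> 0}"
    have A: "finite ?A" "?A \<subseteq> I" using c c' by auto
    have "{i \<in> I. c i + c' i \<noteq> 0} \<subseteq> ?A" by auto
    note e = super[OF A(1) this A(2)] super[OF A(1) _ A(2), of c] super[OF A(1) _ A(2), of c']
    have "(\<lambda>u. (f u + g u) - ?S (\<lambda>i. c i + c' i) {i \<in> I. c i + c' i \<noteq> 0} u) =
      (\<lambda>u. (f u - ?S c {i \<in> I. c i \<noteq> 0} u) + (g u - ?S c' {i \<in> I. c' i \<noteq> 0} u))"
      using e by (simp add: fun_eq_iff algebra_simps sum.distrib)
    then show ?case using J(2)[OF c(2) c'(2)] \<open>{i \<in> I. c i + c' i \<noteq> 0} \<subseteq> ?A\<close> A(1)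
      by (intro exI[of _ "\<lambda>i. c i + c' i"]) (auto intro: finite_subset)
  next
    case (wspan_mult f a)
    then obtain c where c: "finite {i \<in> I. c i \<noteq> 0}" "(\<lambda>u. f u - ?S c {i \<in> I. c i \<noteq> 0} u) \<in> J" by blast
    have sub: "{i \<in> I. a * c i \<noteq> 0} \<subseteq> {i \<in> I. c i \<noteq> 0}" by auto
    have "(\<lambda>u. a * f u - ?S (\<lambda>i. a * c i) {i \<in> I. a * c i \<noteq> 0} u) =
      (\<lambda>u. a * (f u - ?S c {i \<in> I. c i \<noteq> 0} u))"
      using super[OF c(1) sub] by (simp add: fun_eq_iff algebra_simps sum_distrib_left)
    then show ?case using J(3)[OF c(2), of a] finite_subset[OF sub c(1)]
      by (intro exI[of _ "\<lambda>i. a * c i"]) simp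
  qed
qed

lemma dot_past_dots:
  fixes N :: "nat list"
  assumes "\<forall>d\<in>set X. is_dot d" "run s (Dot p # X @ u) = Some t"
  shows "(\<lambda>w. word_vec (Dot p # X @ u) w - word_vec (X @ Dot p # u) w :: 'k::comm_ring_1) \<in> Ideal N s t"
  using assms
proof (induction X)
  case Nil
  then show ?case by (simp add: Ideal.I0)
next
  case (Cons d X)
  obtain p' where d: "d = Dot p'" using Cons.prems is_dotE by auto
  from Cons.prems(2) obtain s1 where s1: "run s (X @ u) = Some s1" "run s1 [Dot p, Dot p'] = Some t"
    unfolding d by (metis append_Cons append_Nil run_appendE)
  have t: "t = s1" and pp: "step s1 (Dot p) = Some s1" "step s1 (Dot p') = Some s1"
    using s1(2) by (auto split: if_splits)
  have 1: "(\<lambda>w. word_vec (Dot p # Dot p' # X @ u) w - word_vec (Dot p' # Dot p # X @ u) w :: 'k) \<in> Ideal N s t"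
  proof (cases "p = p'")
    case True
    then show ?thesis by (simp add: Ideal.I0)
  next
    case False
    then have "(\<lambda>w. word_vec [Dot p, Dot p'] w - word_vec [Dot p', Dot p] w :: 'k) \<in> Ideal N s1 t"
      by (intro isotopy_ideal[OF _ s1(2)]) simp
    then have "(\<lambda>w. word_vec [Dot p, Dot p'] w + (-1) * word_vec [Dot p', Dot p] w :: 'k) \<in> Ideal N s1 t" by simp
    from Ideal_wrap[OF this s1(1), of "[]" t, unfolded wrap_add wrap_mult wrap_word_vec]
    show ?thesis by simp
  qed
  have "run s (Dot p # X @ u) = Some s1" using s1(1) pp by simp
  from Cons.IH[OF _ this[folded t]] Cons.prems(1)
  have "(\<lambda>w. word_vec (Dot p # X @ u) w + (-1) * word_vec (X @ Dot p # u) w :: 'k) \<in> Ideal N s t" by simp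
  from Ideal_wrap[OF this, of s "[]" "[Dot p']" t, unfolded wrap_add wrap_mult wrap_word_vec] pp t
  have 2: "(\<lambda>w. word_vec (Dot p' # Dot p # X @ u) w + (-1) * word_vec (Dot p' # X @ Dot p # u) w :: 'k) \<in> Ideal N s t"
    by simp
  from Ideal.Iadd[OF 1 2] show ?case unfolding d by simp
qed

lemma run_dots: "\<forall>d\<in>set ds. is_dot d \<Longrightarrow> run t ds = Some t' \<Longrightarrow> t' = t"
  by (induction ds arbitrary: t') (auto split: option.splits if_splits elim!: is_dotE)

definition dot_word :: "nat list \<Rightarrow> nat list \<Rightarrow> gen list" where
  "dot_word qs a = concat (map (\<lambda>i. replicate (a ! i) (Dot (qs ! i))) [0..<length qs])"

lemma dot_word_update:
  assumes "i < length qs" "length a = length qs"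
  obtains X Y where "dot_word qs a = X @ Y" "dot_word qs (a[i := Suc (a ! i)]) = X @ Dot (qs ! i) # Y"
    "\<forall>d\<in>set X. is_dot d"
proof -
  let ?f = "\<lambda>a j. replicate (a ! j) (Dot (qs ! j))"
  let ?a = "a[i := Suc (a ! i)]"
  have split: "[0..<length qs] = [0..<i] @ i # [Suc i..<length qs]"
    using assms(1) upt_add_eq_append[of 0 i "length qs - i"] by (simp add: upt_conv_Cons)
  have l: "map (?f ?a) [0..<i] = map (?f a) [0..<i]"
    and r: "map (?f ?a) [Suc i..<length qs] = map (?f a) [Suc i..<length qs]" by auto
  show ?thesis
  proof (rule that)
    show "dot_word qs a = concat (map (?f a) [0..<i]) @ (?f a i @ concat (map (?f a) [Suc i..<length qs]))"
      unfolding dot_word_def split by simp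
    show "dot_word qs ?a = concat (map (?f a) [0..<i]) @ Dot (qs ! i) # (?f a i @ concat (map (?f a) [Suc i..<length qs]))"
      unfolding dot_word_def split map_append list.map l r using assms by simp
  qed auto
qed

text \<open>Dots commute exactly, so sorting them by strand costs no lower terms and the congruence
  is modulo the ideal itself.\<close>

lemma dots_normal_form:
  fixes N :: "nat list"
  assumes "\<forall>d\<in>set ds. is_dot d" "run s (ds @ u) = Some t" "set qs = {p. p < length t \<and> t ! p = Blk}"
  shows "\<exists>a. length a = length qs \<and> run s (dot_word qs a @ u) = Some t \<and>
    (\<lambda>w. word_vec (ds @ u) w - word_vec (dot_word qs a @ u) w :: 'k::comm_ring_1) \<in> Ideal N s t"
  using assms(1,2)
proof (induction ds)
  case Nil
  have "dot_word qs (replicate (length qs) 0) = []" by (auto simp: dot_word_def concat_eq_Nil_conv)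
  then show ?case using Nil by (intro exI[of _ "replicate (length qs) 0"]) (simp add: Ideal.I0)
next
  case (Cons d ds)
  obtain p where d: "d = Dot p" using Cons.prems is_dotE by auto
  from Cons.prems(2) have r: "run s (ds @ u) = Some t" and p: "step t (Dot p) = Some t"
    unfolding d by (auto split: option.splits if_splits)
  from Cons.IH[OF _ r] Cons.prems(1) obtain a where a: "length a = length qs" "run s (dot_word qs a @ u) = Some t"
    "(\<lambda>w. word_vec (ds @ u) w - word_vec (dot_word qs a @ u) w :: 'k) \<in> Ideal N s t" by auto
  have "p \<in> set qs" using p assms(3) by (auto split: if_splits)
  then obtain i where i: "i < length qs" "qs ! i = p" by (auto simp: in_set_conv_nth)
  obtain X Y where XY: "dot_word qs a = X @ Y" "dot_word qs (a[i := Suc (a ! i)]) = X @ Dot (qs ! i) # Y"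
    "\<forall>d\<in>set X. is_dot d" using dot_word_update[OF i(1) a(1)] .
  have rp: "run s (Dot p # X @ Y @ u) = Some t" using a(2) XY(1) p by simp
  have "(\<lambda>w. word_vec (ds @ u) w + (-1) * word_vec (dot_word qs a @ u) w :: 'k) \<in> Ideal N s t" using a(3) by simp
  from Ideal_wrap[OF this, of s "[]" "[Dot p]" t, unfolded wrap_add wrap_mult wrap_word_vec] p
  have 1: "(\<lambda>w. word_vec (d # ds @ u) w + (-1) * word_vec (Dot p # X @ Y @ u) w :: 'k) \<in> Ideal N s t"
    unfolding d XY(1) by simp
  from Ideal.Iadd[OF 1 dot_past_dots[OF XY(3) rp, where ?'k = 'k and N = N]]
  have "(\<lambda>w. word_vec ((d # ds) @ u) w - word_vec (dot_word qs (a[i := Suc (a ! i)]) @ u) w :: 'k) \<in> Ideal N s t"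
    unfolding XY(2) i(2) by simp
  moreover have "run s (dot_word qs (a[i := Suc (a ! i)]) @ u) = Some t"
  proof -
    have drop_dots: "run s (X @ v) = Some t \<longleftrightarrow> run s v = Some t \<and> (\<forall>d\<in>set X. step t d = Some t)"
      if "\<forall>d\<in>set X. is_dot d" for X v
      using that
    proof (induction X)
      case (Cons d X)
      then obtain k where "d = Dot k" using is_dotE by auto
      then show ?case using Cons by (auto split: option.splits if_splits)
    qed simp
    from rp show ?thesis unfolding XY(2) i(2) using drop_dots[OF XY(3)] p
      by (auto split: option.splits if_splits)
  qed
  ultimately show ?case using a(1) by (intro exI[of _ "a[i := Suc (a ! i)]"]) simp
qed

section \<open>Basis words and their signed permutations\<close>

locale klrw_basis =
  fixes N :: "nat list" and b :: nat and \<kappa> \<rho> :: "nat list" and red :: "(nat \<Rightarrow> nat) \<Rightarrow> nat list"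
  assumes \<kappa>: "\<kappa> \<in> Pbr b (length N)" and \<rho>: "\<rho> \<in> Pbr b (length N)"
    and red: "\<forall>w\<in>Sperm \<kappa> \<rho>. left_adjusted (length (state \<rho>)) w (red w)"
begin

abbreviation "s \<equiv> state \<rho>"
abbreviation "t \<equiv> state \<kappa>"
abbreviation "n \<equiv> length (state \<rho>)"
abbreviation "qs \<equiv> black_pos (state \<kappa>)"

lemma len: "length t = n"
  using length_state \<kappa> \<rho> by metis

lemma qs: "length qs = b" "distinct qs" "set qs = {p. p < n \<and> t ! p = Blk}"
  using black_pos_facts[OF \<kappa>] len by auto

definition nword :: "(nat \<Rightarrow> nat) \<Rightarrow> bool list \<Rightarrow> gen list" where
  "nword w l = concat (map (\<lambda>i. concat (map (\<lambda>j. if l ! j \<and> leftlvl (red w) (qs ! j) = i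
      then nail_piece (leftmost (red w) (qs ! j)) else []) [0..<b]) @ (if i < length (red w) then [Cross (red w ! i)] else []))
    [0..<Suc (length (red w))])"

lemma bword_eq: "bword \<kappa> b (red w) l a = dot_word qs a @ nword w l"
  by (simp add: bword_def nword_def dot_word_def Let_def qs)

text \<open>One-line notation of the signed permutation given by \<open>w\<close> and
  \<open>l\<close>.\<close>

definition pat :: "(nat \<Rightarrow> nat) \<Rightarrow> bool list \<Rightarrow> int list" where
  "pat w l = arr n (nword w l)"

lemma nword_reduced:
  assumes w: "w \<in> Sperm \<kappa> \<rho>" and l: "length l = b"
  shows "reduced s (nword w l) (pat w l)" "map (col s) (pat w l) = t"
    "\<And>p. p < n \<Longrightarrow> \<bar>pat w l ! w p\<bar> = int (Suc p)"
    "\<And>i. i < b \<Longrightarrow> pat w l ! (qs ! i) < 0 \<longleftrightarrow> l ! i"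
proof -
  interpret left_adjusted_word n w "red w" using red w by unfold_locales auto
  \<comment> \<open>The list \<open>l\<close> is indexed by black strands counted at the top,
    whereas \<open>signed_labels_word\<close> expects a predicate on top positions.\<close>
  define nailed where "nailed q \<longleftrightarrow> (\<exists>i<b. qs ! i = q \<and> l ! i)" for q
  have nl: "nailed (qs ! i) \<longleftrightarrow> l ! i" if "i < b" for i
    unfolding nailed_def using that qs(1,2) by (auto simp: nth_eq_iff_index_eq)
  have bij: "bij_betw w {0..<n} {0..<n}" and c: "\<And>p. p < n \<Longrightarrow> t ! (w p) = s ! p"
    using w by (auto simp: Sperm_def)
  have blackq: "\<forall>q\<in>set qs. q < n \<and> s ! foot q = Blk"
  proof
    fix q assume "q \<in> set qs"
    then have q: "q < n" "t ! q = Blk" using qs by auto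
    then show "q < n \<and> s ! foot q = Blk" using c[OF pos_less[OF q(1)], of k] by (simp add: w_bot)
  qed
  have P: "concat (map (\<lambda>q. if nailed q \<and> leftlvl (red w) q = i then nail_piece (leftmost (red w) q) else []) qs)
     = concat (map (\<lambda>j. if l ! j \<and> leftlvl (red w) (qs ! j) = i then nail_piece (leftmost (red w) (qs ! j)) else []) [0..<b])" for i
  proof -
    have "map f qs = map (\<lambda>j. f (qs ! j)) [0..<b]" for f :: "nat \<Rightarrow> gen list"
      using qs(1) by (intro nth_equalityI) auto
    then show ?thesis using nl by (auto intro!: arg_cong[of _ _ concat])
  qed
  have "signed_labels s {q \<in> set qs. nailed q \<and> 0 \<le> leftlvl (red w) q} 0 (nword w l)"
    unfolding nword_def P[symmetric]
    by (rule signed_labels_word[OF refl qs(2) blackq]) (auto intro: Sperm_red_mono[OF \<kappa> \<rho> w])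
  then obtain y where y: "reduced s (nword w l) y"
    "\<And>q. q < n \<Longrightarrow> y ! q = (if q \<in> set qs \<and> nailed q then - int (Suc (foot q)) else int (Suc (foot q)))"
    unfolding signed_labels_def by auto
  have py: "pat w l = y" using y(1) by (simp add: pat_def reduced_def)
  show "reduced s (nword w l) (pat w l)" using y(1) py by simp
  have yl: "length y = n" using legit_length reduced_legit[OF y(1)] by auto
  show a: "\<bar>pat w l ! w p\<bar> = int (Suc p)" if "p < n" for p
  proof -
    have wp: "w p < n" using bij that by (auto simp: bij_betw_def)
    have "w (foot (w p)) = w p" by (rule w_bot)
    then have "foot (w p) = p"
      using inj_on_eq_iff[OF bij_betw_imp_inj_on[OF bij]] that pos_less[OF wp] by auto
    then show ?thesis using y(2)[OF wp] py by auto
  qed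
  show "map (col s) (pat w l) = t"
  proof (rule nth_equalityI)
    fix q assume "q < length (map (col s) (pat w l))"
    then have q: "q < n" using yl py by simp
    have "\<bar>y ! q\<bar> = int (Suc (foot q))" using y(2)[OF q] by auto
    then have "col s (y ! q) = s ! foot q" by (rule col_label)
    also have "\<dots> = t ! q" using c[OF pos_less[OF q], of k] by (simp add: w_bot)
    finally show "map (col s) (pat w l) ! q = t ! q" using q yl py by simp
  qed (use yl py len in simp)
  show "pat w l ! (qs ! i) < 0 \<longleftrightarrow> l ! i" if "i < b" for i
  proof -
    have "qs ! i \<in> set qs" using that qs(1) by simp
    moreover from this have "qs ! i < n" using qs(3) by auto
    ultimately show ?thesis using y(2) py nl[OF that] by auto
  qed
qed

lemma pat_inj:
  assumes "w \<in> Sperm \<kappa> \<rho>" "length l = b" "w' \<in> Sperm \<kappa> \<rho>" "length l' = b" "pat w l = pat w' l'"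
  shows "w = w' \<and> l = l'"
proof
  have lp: "length (pat w l) = n" using legit_length reduced_legit[OF nword_reduced(1)[OF assms(1,2)]] by auto
  have dist: "distinct (map abs (pat w l))"
    using reduced_legit[OF nword_reduced(1)[OF assms(1,2)]] by (simp add: legit_def)
  show "w = w'"
  proof
    fix p
    show "w p = w' p"
    proof (cases "p < n")
      case True
      then have "w p < n" "w' p < n" using assms(1,3) by (auto simp: Sperm_def bij_betw_def)
      moreover have "\<bar>pat w l ! w p\<bar> = \<bar>pat w l ! w' p\<bar>"
        using nword_reduced(3)[OF assms(1,2) True] nword_reduced(3)[OF assms(3,4) True] assms(5) by simp
      ultimately show ?thesis using nth_eq_iff_index_eq[OF dist, of "w p" "w' p"] lp by simp
    next
      case False
      then show ?thesis using assms(1,3) by (simp add: Sperm_def)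
    qed
  qed
  show "l = l'"
    using assms(2,4,5) nword_reduced(4)[OF assms(1,2)] nword_reduced(4)[OF assms(3,4)]
    by (intro nth_equalityI) auto
qed

text \<open>The absolute values of \<open>y\<close> give \<open>w\<close>, and the signs at black
  positions give \<open>l\<close>. Red labels are positive in both arrangements, so they agree as
  well.\<close>

lemma pat_surj:
  assumes "legit s y" "map (col s) y = t"
  shows "\<exists>w\<in>Sperm \<kappa> \<rho>. \<exists>l. length l = b \<and> pat w l = y"
proof -
  have ly: "length y = n" using legit_length assms(1) by auto
  have dist: "distinct (map abs y)" and set: "set (map abs y) = set (base n)" using assms(1) by (auto simp: legit_def)
  have ex: "\<exists>q<n. \<bar>y ! q\<bar> = int (Suc p)" if "p < n" for p
  proof -
    have "int (Suc p) \<in> set (map abs y)" unfolding set set_base using that by (intro imageI) simp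
    then show ?thesis unfolding in_set_conv_nth using ly by auto
  qed
  define w where "w p = (if p < n then SOME q. q < n \<and> \<bar>y ! q\<bar> = int (Suc p) else p)" for p
  have w: "w p < n" "\<bar>y ! w p\<bar> = int (Suc p)" if "p < n" for p
    using someI_ex[OF ex[OF that]] that unfolding w_def by auto
  have inj: "inj_on w {0..<n}" using w by (intro inj_onI) (metis atLeastLessThan_iff nat.inject of_nat_eq_iff)
  have "w ` {0..<n} \<subseteq> {0..<n}" using w by auto
  then have bij: "bij_betw w {0..<n} {0..<n}"
    using inj by (simp add: bij_betw_def endo_inj_surj)
  have col: "t ! w p = s ! p" if "p < n" for p
  proof -
    have "t ! w p = col s (y ! w p)" using assms(2) w(1)[OF that] ly by (metis nth_map)
    then show ?thesis using col_label[OF w(2)[OF that], of s] by simp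
  qed
  have wS: "w \<in> Sperm \<kappa> \<rho>" using bij col by (auto simp: Sperm_def w_def)
  define l where "l = map (\<lambda>i. y ! (qs ! i) < 0) [0..<b]"
  have ll: "length l = b" by (simp add: l_def)
  note r = nword_reduced[OF wS ll]
  have "pat w l = y"
  proof (rule nth_equalityI)
    have lp: "length (pat w l) = n" using legit_length reduced_legit[OF r(1)] by auto
    then show "length (pat w l) = length y" using ly by simp
    fix q assume "q < length (pat w l)"
    then have q: "q < n" using lp by simp
    then obtain p where p: "p < n" "q = w p" using bij unfolding bij_betw_def by force
    have abs: "\<bar>pat w l ! q\<bar> = \<bar>y ! q\<bar>" "y ! q \<noteq> 0" using r(3)[OF p(1)] w(2)[OF p(1)] p(2) by auto
    have "pat w l ! q < 0 \<longleftrightarrow> y ! q < 0"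
    proof (cases "t ! q = Blk")
      case True
      then have "q \<in> set qs" using q qs by simp
      then obtain i where "i < b" "qs ! i = q" using qs(1) by (auto simp: in_set_conv_nth)
      then show ?thesis using r(4)[of i] by (simp add: l_def)
    next
      case False
      have c1: "col s (pat w l ! q) = t ! q" using r(2) q lp by (metis nth_map)
      have c2: "col s (y ! q) = t ! q" using assms(2) q ly by (metis nth_map)
      have "0 < pat w l ! q" by (rule red_positive[OF reduced_legit[OF r(1)]]) (use False c1 q lp in \<open>auto simp flip: not_red\<close>)
      moreover have "0 < y ! q" by (rule red_positive[OF assms(1)]) (use False c2 q ly in \<open>auto simp flip: not_red\<close>)
      ultimately show ?thesis by simp
    qed
    then show "pat w l ! q = y ! q" using abs by (auto simp: abs_if split: if_splits)
  qed
  then show ?thesis using wS ll by blast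
qed

abbreviation "B \<equiv> \<lambda>(w, l, a). bword \<kappa> b (red w) l a"

lemma run_nword:
  assumes "w \<in> Sperm \<kappa> \<rho>" "length l = b"
  shows "run s (nword w l) = Some t"
  using nword_reduced(1,2)[OF assms] by (simp add: reduced_def)

lemma run_B:
  assumes "i \<in> Bidx b \<kappa> \<rho>"
  shows "run s (B i) = Some t"
proof -
  obtain w l a where i: "i = (w, l, a)" "w \<in> Sperm \<kappa> \<rho>" "length l = b" using assms by (auto simp: Bidx_def)
  have "is_dot d \<and> step t d = Some t" if d: "d \<in> set (dot_word qs a)" for d
  proof -
    obtain j where "j < length qs" "d = Dot (qs ! j)"
      using d by (auto simp: dot_word_def set_replicate_conv_if split: if_splits)
    then show ?thesis using nth_mem[of j qs] qs(3) len by simp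
  qed
  then have "run t (dot_word qs a) = Some t" by (rule dots_low(1)[where L = 1]) simp_all
  then show ?thesis using run_nword[OF i(2,3)] unfolding i(1) by (simp add: bword_eq run_append)
qed

text \<open>Induction on \<open>cnt\<close> puts all of \<open>low\<close> at this level into the
  span. Dots are lifted first: multiplication by them does not raise \<open>cnt\<close>, so the
  dot-free part can be reduced on its own and the result multiplied by the dots.\<close>

lemma spanning:
  assumes "run s v = Some t"
  shows "(word_vec v :: _ \<Rightarrow> 'k::comm_ring_1) \<in> wspan (Ideal N s t) (B ` Bidx b \<kappa> \<rho>)"
  using assms
proof (induction "cnt v" arbitrary: v rule: less_induct)
  case less
  let ?H = "wspan (Ideal N s t) (B ` Bidx b \<kappa> \<rho>) :: (_ \<Rightarrow> 'k) set"
  have low: "f \<in> ?H" if "f \<in> low N s t (cnt v)" for f :: "_ \<Rightarrow> 'k"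
    using that unfolding low_def by (rule wspan_trans) (use less.hyps in auto)
  obtain ds u where u: "\<forall>d\<in>set ds. is_dot d" "\<forall>d\<in>set u. \<not> is_dot d" "run s (ds @ u) = Some t" "cnt u = cnt v"
    "(\<lambda>w. word_vec v w - word_vec (ds @ u) w :: 'k) \<in> low N s t (cnt v)"
    using dots_up[OF less.prems, where ?'k = 'k and N = N] by blast
  obtain t0 where t0: "run s u = Some t0" "run t0 ds = Some t" using u(3) by (rule run_appendE)
  have tt: "t0 = t" using run_dots[OF u(1) t0(2)] by simp
  have lu: "length u = cnt v" using u(2,4) cnt_dotfree by simp
  define y where "y = arr n u"
  have ly: "legit s y" "map (col s) y = t" using run_legit[OF t0(1)] tt by (auto simp: y_def)
  have wrap_dots: "wrap ds [] f \<in> low N s t (cnt v)" if "f \<in> low N s t (cnt v)" for f :: "_ \<Rightarrow> 'k"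
    by (rule low_wrap[OF that]) (use t0(2) tt u(1) in \<open>auto simp: cnt_dots\<close>)
  have dsu: "word_vec (ds @ u) \<in> ?H"
  proof (cases "blen y < length u")
    case True
    then have "(word_vec u :: _ \<Rightarrow> 'k) \<in> low N s t (cnt v)"
      using nonreduced_low[OF t0(1) u(2)] tt lu by (simp add: y_def)
    from low[OF wrap_dots[OF this]] show ?thesis by (simp add: wrap_word_vec)
  next
    case False
    have "blen y \<le> length u" using blen_arr_le[OF t0(1)] lu u(4) by (simp add: y_def)
    with False have ru: "reduced s u y" unfolding reduced_def using t0(1) tt ly u(2) by (simp add: y_def)
    obtain w l where w: "w \<in> Sperm \<kappa> \<rho>" "length l = b" "pat w l = y" using pat_surj[OF ly] by blast
    have "reduced s (nword w l) y" using nword_reduced(1)[OF w(1,2)] w(3) by simp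
    from matsumoto[OF ru this, where ?'k = 'k and N = N] obtain e :: 'k where
      "(\<lambda>x. word_vec u x - e * word_vec (nword w l) x) \<in> low N s t (cnt v)"
      unfolding lead_eq_def using ly lu by auto
    then have "(\<lambda>x. word_vec u x + (- e) * word_vec (nword w l) x) \<in> low N s t (cnt v)" by simp
    from low[OF wrap_dots[OF this], unfolded wrap_add wrap_mult wrap_word_vec]
    have 1: "(\<lambda>x. word_vec (ds @ u) x - e * word_vec (ds @ nword w l) x) \<in> ?H"
      by simp
    have "run s (ds @ nword w l) = Some t" using run_nword[OF w(1,2)] t0(2) tt by (simp add: run_append)
    from dots_normal_form[OF u(1) this, of qs, where ?'k = 'k and N = N] qs len obtain a where
      a: "length a = b" "(\<lambda>x. word_vec (ds @ nword w l) x - word_vec (dot_word qs a @ nword w l) x :: 'k) \<in> Ideal N s t"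
      by auto
    have "(w, l, a) \<in> Bidx b \<kappa> \<rho>" using w a by (simp add: Bidx_def)
    then have "word_vec (B (w, l, a)) \<in> ?H" by (intro wspan_word) blast
    then have "word_vec (dot_word qs a @ nword w l) \<in> ?H" by (simp add: bword_eq)
    from wspan_add[OF wspan_ideal[OF a(2)] this] have "word_vec (ds @ nword w l) \<in> ?H" by simp
    from wspan_cong_word[OF 1 this] show ?thesis .
  qed
  from wspan_add[OF low[OF u(5)] dsu] show ?case by simp
qed

end

section \<open>Linear independence\<close>

context localized_rep
begin

lemma acts_dot_word:
  "acts (dot_word qs a) V y = (\<Prod>i<length qs. Z (y ! (qs ! i)) ^ (a ! i)) * V y"
proof -
  have "acts (concat (map (\<lambda>i. replicate (a ! i) (Dot (qs ! i))) [0..<m])) V y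
      = (\<Prod>i<m. Z (y ! (qs ! i)) ^ (a ! i)) * V y" for m V
    by (induction m arbitrary: V) (simp_all add: acts_append acts_dots mult.assoc)
  then show ?thesis by (simp add: dot_word_def)
qed

end

lemma unit_mult_eq_0:
  fixes x u :: "'r::comm_ring_1"
  assumes "x * u = 0" "u dvd 1"
  shows "x = 0"
proof -
  obtain g where "1 = u * g" using assms(2) by (rule dvdE)
  then have "x = x * (u * g)" by simp
  also have "\<dots> = (x * u) * g" by (simp only: mult.assoc)
  finally show ?thesis using assms(1) by simp
qed

lemma X_power_prod:
  fixes e f :: "nat \<Rightarrow> nat"
  shows "(\<Prod>i<m. fls_shift (- int (e i)) 1 ^ f i) = (fls_shift (- int (\<Sum>i<m. f i * e i)) 1 :: 'k::comm_ring_1 fls)"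
proof (induction m)
  case (Suc m)
  have "fls_shift (- int (e m)) 1 ^ f m = (fls_shift (- int (f m * e m)) 1 :: 'k fls)"
    using fls_X_intpow_power[of "int (e m)" "f m", where ?'a = 'k] by simp
  then show ?case
    using Suc fls_X_intpow_times_fls_X_intpow[of "int (\<Sum>i<m. f i * e i)" "int (f m * e m)", where ?'a = 'k]
    by (simp add: add.commute)
qed simp

text \<open>Kronecker substitution: exponents below \<open>M\<close> are read off as base-\<open>M\<close> digits.\<close>
lemma monomials_independent:
  fixes c :: "nat list \<Rightarrow> 'k::comm_ring_1" and L :: "nat \<Rightarrow> nat"
  assumes "finite A" "\<forall>a\<in>A. length a = b \<and> (\<forall>x\<in>set a. x < M)" "inj_on L {..<b}"
    and zero: "(\<Sum>a\<in>A. fls_const (c a) * (\<Prod>i<b. (fls_shift (- int (M ^ L i)) 1) ^ (a ! i))) = 0"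
    and "a \<in> A"
  shows "c a = 0"
proof -
  let ?e = "\<lambda>a. \<Sum>i<b. a ! i * M ^ L i"
  have inj: "a = a'" if aa: "a \<in> A" "a' \<in> A" "?e a = ?e a'" for a a'
  proof -
    let ?g = "\<lambda>a e. a ! the_inv_into {..<b} L e"
    have e: "?e a = (\<Sum>e\<in>L ` {..<b}. ?g a e * M ^ e)" for a
      using assms(3) by (subst sum.reindex) (auto simp: the_inv_into_f_f intro!: sum.cong)
    have "\<forall>e\<in>L ` {..<b}. ?g a e = ?g a' e"
    proof (rule digits_unique)
      show "\<forall>e\<in>L ` {..<b}. ?g a e < M \<and> ?g a' e < M"
        using aa(1,2) assms(2,3) by (auto simp: the_inv_into_f_f)
    qed (use aa(3) e in auto)
    then have "\<forall>i<b. a ! i = a' ! i" using assms(3) by (auto simp: the_inv_into_f_f)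
    then show ?thesis using assms(2) aa by (intro nth_equalityI) auto
  qed
  have "0 = fls_nth (\<Sum>a'\<in>A. fls_const (c a') * fls_shift (- int (?e a')) 1) (int (?e a))"
    using zero unfolding X_power_prod by simp
  also have "\<dots> = (\<Sum>a'\<in>A. fls_nth (fls_const (c a') * fls_shift (- int (?e a')) 1) (int (?e a)))"
    by (rule fls_nth_sum)
  also have "\<dots> = (\<Sum>a'\<in>A. if a' = a then c a' else 0)"
  proof (rule sum.cong)
    fix a' assume a': "a' \<in> A"
    have "fls_nth (fls_const (c a') * fls_shift (- int (?e a')) 1) (int (?e a)) = fls_nth (fls_const (c a')) (int (?e a) - int (?e a'))"
      unfolding fls_X_intpow_times_conv_shift by simp
    moreover have "int (?e a) - int (?e a') = 0 \<longleftrightarrow> a' = a"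
      using inj[OF a' \<open>a \<in> A\<close>] by (metis of_nat_eq_iff right_minus_eq)
    then have "fls_nth (fls_const (c a')) (int (?e a) - int (?e a')) = (if a' = a then c a' else 0)"
      by (simp only: fls_const_nth)
    ultimately show "fls_nth (fls_const (c a') * fls_shift (- int (?e a')) 1) (int (?e a)) = (if a' = a then c a' else 0)" by (rule trans)
  qed simp
  finally show ?thesis using assms(1) \<open>a \<in> A\<close> by simp
qed

context klrw_basis
begin

text \<open>Evaluation at an arrangement \<open>y\<close> of greatest length in the support. By
  \<open>leading_term\<close>, basis words of other signed permutations vanish there, and those of
  \<open>y\<close> share one unit factor; what remains is a linear relation between
  monomials.\<close>

lemma independent:
  fixes c :: "(nat \<Rightarrow> nat) \<times> bool list \<times> nat list \<Rightarrow> 'k::comm_ring_1"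
  defines "S \<equiv> {i \<in> Bidx b \<kappa> \<rho>. c i \<noteq> 0}"
  assumes fin: "finite S" and ideal: "(\<lambda>u. \<Sum>i\<in>S. c i * word_vec (B i) u) \<in> Ideal N s t"
  shows "S = {}"
proof (rule ccontr)
  assume "S \<noteq> {}"
  let ?len = "\<lambda>(w, l, a). blen (pat w l)"
  have "Max (?len ` S) \<in> ?len ` S" using fin \<open>S \<noteq> {}\<close> by simp
  then obtain w0 l0 a0 where i0: "(w0, l0, a0) \<in> S" "blen (pat w0 l0) = Max (?len ` S)" by auto
  have max: "blen (pat w l) \<le> blen (pat w0 l0)" if "(w, l, a) \<in> S" for w l a
    unfolding i0(2) by (rule Max_ge) (use fin that in force)+
  have idx: "w \<in> Sperm \<kappa> \<rho> \<and> length l = b \<and> length a = b" if "(w, l, a) \<in> S" for w l a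
    using that by (auto simp: S_def Bidx_def)
  have wl0: "w0 \<in> Sperm \<kappa> \<rho>" "length l0 = b" using idx[OF i0(1)] by auto
  define y where "y = pat w0 l0"
  note r0 = nword_reduced[OF wl0, folded y_def]
  have ly: "legit s y" using reduced_legit[OF r0(1)] .
  \<comment> \<open>One \<open>Suc\<close> lifts \<open>M\<close> above all exponents in the
    support, the other gives \<open>2 \<le> M\<close>; inserting 0 keeps the maximum defined when
    there are no exponents.\<close>
  define M where "M = Suc (Suc (Max (insert 0 (\<Union>(w, l, a)\<in>S. set a))))"
  have M: "x < M" if "(w, l, a) \<in> S" "x \<in> set a" for w l a x
  proof -
    have "x \<le> Max (insert 0 (\<Union>(w, l, a)\<in>S. set a))" using fin that by (intro Max_ge) auto
    then show ?thesis by (simp add: M_def)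
  qed
  have "2 \<le> M" by (simp add: M_def)
  then obtain z d where z: "z = (\<lambda>q. fls_shift (- int (M ^ q)) 1)"
    and "localized_rep (fls_const :: 'k \<Rightarrow> 'k fls) z d"
    using ex_localized_rep by blast
  then interpret localized_rep N s "fls_const :: 'k \<Rightarrow> 'k fls" z d by simp
  let ?mono = "\<lambda>a. \<Prod>i<b. Z (y ! (qs ! i)) ^ (a ! i)"
  have ov: "over t y" using ly r0(2) by (simp add: over_def legit_def)
  obtain il where il: "set il = S" "distinct il" using finite_distinct_list[OF fin] by blast
  have "lc (map (\<lambda>i. (B i, c i)) il) = (\<lambda>u. \<Sum>i\<leftarrow>il. c i * word_vec (B i) u)"
    by (induction il) simp_all
  also have "\<dots> = (\<lambda>u. \<Sum>i\<in>S. c i * word_vec (B i) u)"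
    using il by (simp add: sum_list_distinct_conv_sum_set)
  finally have "lc (map (\<lambda>i. (B i, c i)) il) \<in> Ideal N s t" using ideal by simp
  then have "phi (lc (map (\<lambda>i. (B i, c i)) il)) y = 0" using ideal_phi ov by blast
  then have "(\<Sum>i\<leftarrow>il. fls_const (c i) * acts (B i) vac y) = 0" by (simp add: phi_lc comp_def)
  then have sum0: "(\<Sum>i\<in>S. fls_const (c i) * acts (B i) vac y) = 0"
    using il by (simp add: sum_list_distinct_conv_sum_set)
  define A where "A = {a. (w0, l0, a) \<in> S}"
  have A: "finite A" using finite_vimageI[OF fin, of "\<lambda>a. (w0, l0, a)"] by (simp add: A_def vimage_def inj_on_def)
  have actsB: "acts (B (w, l, a)) vac y = ?mono a * acts (nword w l) vac y" for w l a
    by (simp add: bword_eq acts_append acts_dot_word qs(1))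
  have lead: "if pat w l = y then acts (nword w l) vac y dvd 1 else acts (nword w l) vac y = 0"
    if i: "(w, l, a) \<in> S" for w l a
  proof -
    have "w \<in> Sperm \<kappa> \<rho>" "length l = b" using idx[OF i] by auto
    note r = nword_reduced[OF this]
    have "length (nword w l) \<le> blen y" using max[OF i] r(1) by (simp add: reduced_def y_def)
    moreover have "run s (nword w l) = Some (map (col s) y)" using r(1,2) r0(2) by (simp add: reduced_def)
    moreover have "\<forall>g\<in>set (nword w l). \<not> is_dot g" using r(1) by (simp add: reduced_def)
    ultimately show ?thesis using leading_term[OF _ _ ly] by (simp add: pat_def)
  qed
  have vanish: "acts (B i) vac y = 0" if "i \<in> S - (\<lambda>a. (w0, l0, a)) ` A" for i
  proof -
    obtain w l a where i: "i = (w, l, a)" by (cases i)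
    have "(w, l) \<noteq> (w0, l0)" using that i by (auto simp: A_def)
    then have "pat w l \<noteq> y" using pat_inj[OF _ _ wl0] idx[of w l a] that i unfolding y_def by auto
    then have "acts (nword w l) vac y = 0" using lead[of w l a] that i by simp
    then show ?thesis unfolding i actsB by simp
  qed
  have "(\<Sum>i\<in>S. fls_const (c i) * acts (B i) vac y)
      = (\<Sum>i\<in>(\<lambda>a. (w0, l0, a)) ` A. fls_const (c i) * acts (B i) vac y)"
    by (rule sum.mono_neutral_right) (use fin vanish in \<open>auto simp: A_def\<close>)
  also have "\<dots> = (\<Sum>a\<in>A. fls_const (c (w0, l0, a)) * ?mono a) * acts (nword w0 l0) vac y"
    unfolding sum_distrib_right by (subst sum.reindex) (auto simp: inj_on_def actsB[simplified] mult.assoc)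
  finally have "(\<Sum>a\<in>A. fls_const (c (w0, l0, a)) * ?mono a) * acts (nword w0 l0) vac y = 0"
    using sum0 by simp
  moreover have "acts (nword w0 l0) vac y dvd 1" using lead[OF i0(1)] by (simp add: y_def)
  ultimately have zero: "(\<Sum>a\<in>A. fls_const (c (w0, l0, a)) * ?mono a) = 0"
    by (rule unit_mult_eq_0)
  have "inj_on (\<lambda>i. nat \<bar>y ! (qs ! i)\<bar>) {..<b}"
  proof (rule inj_onI)
    fix i j assume ij: "i \<in> {..<b}" "j \<in> {..<b}" "nat \<bar>y ! (qs ! i)\<bar> = nat \<bar>y ! (qs ! j)\<bar>"
    have q: "qs ! i < length y" "qs ! j < length y"
      using ij qs(1,3) nth_mem[of i qs] nth_mem[of j qs] legit_length[OF ly] by auto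
    have "distinct (map abs y)" using ly by (simp add: legit_def)
    moreover have "map abs y ! (qs ! i) = map abs y ! (qs ! j)" using ij(3) q by simp
    ultimately have "qs ! i = qs ! j" using nth_eq_iff_index_eq[of "map abs y" "qs ! i" "qs ! j"] q by simp
    then show "i = j" using ij(1,2) qs(1,2) by (simp add: nth_eq_iff_index_eq)
  qed
  moreover have "\<forall>a\<in>A. length a = b \<and> (\<forall>x\<in>set a. x < M)" using idx M by (auto simp: A_def)
  moreover have "a0 \<in> A" using i0(1) by (simp add: A_def)
  ultimately have "c (w0, l0, a0) = 0"
    using monomials_independent[OF A, of b M "\<lambda>i. nat \<bar>y ! (qs ! i)\<bar>" "\<lambda>a. c (w0, l0, a)" a0] zero unfolding z by blast
  then show False using i0(1) by (simp add: S_def)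
qed

end

theorem theorem3p11:
  fixes N :: "nat list" and b :: nat and \<kappa> \<rho> :: "nat list"
    and red :: "(nat \<Rightarrow> nat) \<Rightarrow> nat list"
  assumes "\<kappa> \<in> Pbr b (length N)" and "\<rho> \<in> Pbr b (length N)"
    and "\<forall>w\<in>Sperm \<kappa> \<rho>. left_adjusted (length (state \<rho>)) w (red w)"
  shows "is_basis TYPE('k::comm_ring_1) N (state \<rho>) (state \<kappa>) (Bidx b \<kappa> \<rho>)
           (\<lambda>(w, l, a). bword \<kappa> b (red w) l a)"
proof -
  interpret klrw_basis N b \<kappa> \<rho> red by (rule klrw_basis.intro[OF assms])
  show ?thesis unfolding is_basis_def
  proof (intro conjI ballI allI impI)
    fix i assume "i \<in> Bidx b \<kappa> \<rho>"
    then show "run s (B i) = Some t" by (rule run_B)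
  next
    fix v assume "run s v = Some t"
    from wspan_coefficients[OF spanning[OF this, where ?'k = 'k]] show "\<exists>c :: _ \<Rightarrow> 'k. finite {i \<in> Bidx b \<kappa> \<rho>. c i \<noteq> 0} \<and>
           (\<lambda>u. word_vec v u - (\<Sum>i\<in>{i \<in> Bidx b \<kappa> \<rho>. c i \<noteq> 0}. c i * word_vec (B i) u)) \<in> Ideal N s t"
      by (blast intro: Ideal.intros)
  next
    fix c :: "_ \<Rightarrow> 'k" and i
    assume c: "finite {i \<in> Bidx b \<kappa> \<rho>. c i \<noteq> 0} \<and>
        (\<lambda>u. \<Sum>i\<in>{i \<in> Bidx b \<kappa> \<rho>. c i \<noteq> 0}. c i * word_vec (B i) u) \<in> Ideal N s t" and i: "i \<in> Bidx b \<kappa> \<rho>"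
    from independent[of c] c have "{i \<in> Bidx b \<kappa> \<rho>. c i \<noteq> 0} = {}" by blast
    then show "c i = 0" using i by blast
  qed
qed

end
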